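(* Let $\Omega\subseteq\mathbb{R}^n$ be a bounded domain, $g:\mathbb{R}\to\mathbb{R}$ a bounded continuous function, $f\in L^2(\Omega)$, and let $\lambda_k$ ($k\ge 1$) be the $k$-th Dirichlet eigenvalue of $-\Delta$ on $\Omega$, with eigenspace $\bar H$. Let $G(s)=\int_0^s g(\tau)\,d\tau$ and let $\bar f$ be the component of $f$ in $\bar H$. Assume that at least one of the following two conditions holds: $(\mathrm{SC})_+$: for every sequence $(u_n)\subset H=W^{1,2}_0(\Omega)$ such that $\|u_n\|_2\to\infty$ and $\frac{u_n}{\|u_n\|_2}\to\phi_0$ in $L^2(\Omega)$ for some $\phi_0\in\bar H$, one has $$\lim_{n\to\infty}\left(\int_\Omega G(u_n)\,dx-\int_\Omega \bar f u_n\,dx\right)=+\infty;$$ $(\mathrm{SC})_-$: for every sequence $(u_n)\subset H$ such that $\|u_n\|_2\to\infty$ and $\frac{u_n}{\|u_n\|_2}\to\phi_0$ in $L^2(\Omega)$ for some $\phi_0\in\bar H$, one has $$\lim_{n\to\infty}\left(\int_\Omega G(u_n)\,dx-\int_\Omega \bar f u_n\,dx\right)=-\infty.$$ Then the boundary value problem $$-\Delta u-\lambda_k u+g(u)=f\ \text{ in }\Omega,\qquad u=0\ \text{ on }\partial\Omega,$$ has at least one weak solution, i.e. there exists $u\in H$ such that $$\int_\Omega\nabla u\cdot\nabla v\,dx-\lambda_k\int_\Omega uv\,dx+\int_\Omega g(u)v\,dx=\int_\Omega fv\,dx\quad\text{for all }v\in H.$$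
   Context: $\|\cdot\|_2$ is the norm of $L^2(\Omega)$. The eigenvalues of $-\Delta u=\lambda u$ in $\Omega$, $u=0$ on $\partial\Omega$ (understood weakly in $H=W_0^{1,2}(\Omega)$) are listed with multiplicity as $0<\lambda_1<\lambda_2\le\dots\le\lambda_{k-1}<\lambda_k=\dots=\lambda_{k+m-1}<\lambda_{k+m}\le\dots\to\infty$, where $m\ge1$ is the multiplicity of $\lambda_k$ (so $k$ is the first index at which the value $\lambda_k$ occurs). The corresponding eigenfunctions $(\phi_n)$ form an orthogonal basis of both $L^2(\Omega)$ and $H$, with $\|\phi_n\|_2=1$. $\bar H=\mathrm{span}\{\phi_k,\dots,\phi_{k+m-1}\}$ is the eigenspace of $\lambda_k$. The function $f$ is decomposed as $f=\bar f+f^\perp$ with $\bar f\in\bar H$ and $\int_\Omega f^\perp v\,dx=0$ for all $v\in\bar H$; that is, $\bar f$ is the $L^2(\Omega)$-orthogonal projection of $f$ onto $\bar H$. *)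

theory Defs
  imports "HOL-Analysis.Analysis"
begin

text \<open>
  Elements of Lebesgue and Sobolev spaces are represented by functions on the whole space of which
  only the restriction to \<open>\<Omega>\<close>, up to null sets, matters. Uniqueness and dimension are therefore
  understood modulo equality almost everywhere in \<open>\<Omega>\<close>.
\<close>

definition L2 :: "'a::euclidean_space set \<Rightarrow> ('a \<Rightarrow> 'b::euclidean_space) set" where
  "L2 \<Omega> = {u. u \<in> borel_measurable (lebesgue_on \<Omega>) \<and>
               integrable (lebesgue_on \<Omega>) (\<lambda>x. (norm (u x))\<^sup>2)}"

definition L2_norm :: "'a::euclidean_space set \<Rightarrow> ('a \<Rightarrow> 'b::euclidean_space) \<Rightarrow> real" where
  "L2_norm \<Omega> u = sqrt (LINT x|lebesgue_on \<Omega>. (norm (u x))\<^sup>2)"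

primrec C_k :: "nat \<Rightarrow> ('a::euclidean_space \<Rightarrow> real) \<Rightarrow> bool" where
  "C_k 0 \<phi> \<longleftrightarrow> continuous_on UNIV \<phi>"
| "C_k (Suc k) \<phi> \<longleftrightarrow> (\<forall>x. \<phi> differentiable (at x)) \<and>
     (\<forall>b\<in>Basis. C_k k (\<lambda>x. frechet_derivative \<phi> (at x) b))"

definition test_functions :: "'a::euclidean_space set \<Rightarrow> ('a \<Rightarrow> real) set" where
  "test_functions \<Omega> = {\<phi>. (\<forall>k. C_k k \<phi>) \<and>
     compact (closure {x. \<phi> x \<noteq> 0}) \<and> closure {x. \<phi> x \<noteq> 0} \<subseteq> \<Omega>}"

definition has_weak_gradient ::
    "'a::euclidean_space set \<Rightarrow> ('a \<Rightarrow> real) \<Rightarrow> ('a \<Rightarrow> 'a) \<Rightarrow> bool" where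
  "has_weak_gradient \<Omega> u U \<longleftrightarrow> (\<forall>\<phi>\<in>test_functions \<Omega>. \<forall>b\<in>Basis.
     (LINT x|lebesgue_on \<Omega>. u x * frechet_derivative \<phi> (at x) b) =
     - (LINT x|lebesgue_on \<Omega>. (U x \<bullet> b) * \<phi> x))"

definition W12 :: "'a::euclidean_space set \<Rightarrow> ('a \<Rightarrow> real) set" where
  "W12 \<Omega> = {u. u \<in> L2 \<Omega> \<and> (\<exists>U\<in>L2 \<Omega>. has_weak_gradient \<Omega> u U)}"

text \<open>A representative of the weak gradient, which is unique almost everywhere in \<open>\<Omega>\<close>.\<close>

definition wgrad :: "'a::euclidean_space set \<Rightarrow> ('a \<Rightarrow> real) \<Rightarrow> 'a \<Rightarrow> 'a" where
  "wgrad \<Omega> u = (SOME U. U \<in> L2 \<Omega> \<and> has_weak_gradient \<Omega> u U)"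

definition W12_norm :: "'a::euclidean_space set \<Rightarrow> ('a \<Rightarrow> real) \<Rightarrow> real" where
  "W12_norm \<Omega> u = sqrt ((L2_norm \<Omega> u)\<^sup>2 + (L2_norm \<Omega> (wgrad \<Omega> u))\<^sup>2)"

definition W12_0 :: "'a::euclidean_space set \<Rightarrow> ('a \<Rightarrow> real) set" where
  "W12_0 \<Omega> = {u \<in> W12 \<Omega>. \<forall>\<epsilon>>0. \<exists>\<phi>\<in>test_functions \<Omega>. W12_norm \<Omega> (\<lambda>x. u x - \<phi> x) < \<epsilon>}"

definition eigenspace :: "'a::euclidean_space set \<Rightarrow> real \<Rightarrow> ('a \<Rightarrow> real) set" where
  "eigenspace \<Omega> \<mu> = {u \<in> W12_0 \<Omega>. \<forall>v\<in>W12_0 \<Omega>.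
     (LINT x|lebesgue_on \<Omega>. wgrad \<Omega> u x \<bullet> wgrad \<Omega> v x) = \<mu> * (LINT x|lebesgue_on \<Omega>. u x * v x)}"

definition has_multiplicity :: "'a::euclidean_space set \<Rightarrow> real \<Rightarrow> nat \<Rightarrow> bool" where
  "has_multiplicity \<Omega> \<mu> m \<longleftrightarrow> (\<exists>\<phi>::nat \<Rightarrow> 'a \<Rightarrow> real.
     (\<forall>i<m. \<phi> i \<in> eigenspace \<Omega> \<mu>) \<and>
     (\<forall>c::nat \<Rightarrow> real. (AE x in lebesgue_on \<Omega>. (\<Sum>i<m. c i * \<phi> i x) = 0) \<longrightarrow> (\<forall>i<m. c i = 0)) \<and>
     (\<forall>u\<in>eigenspace \<Omega> \<mu>. \<exists>c::nat \<Rightarrow> real. AE x in lebesgue_on \<Omega>. u x = (\<Sum>i<m. c i * \<phi> i x)))"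

text \<open>
  \<open>\<lambda>\<^sub>1 \<le> \<lambda>\<^sub>2 \<le> \<dots>\<close> lists the Dirichlet eigenvalues with multiplicity; the value at index 0 is
  irrelevant. A number \<open>\<mu>\<close> that is not an eigenvalue has multiplicity 0, so it does not occur in
  the list.
\<close>

definition dirichlet_eigenvalues :: "'a::euclidean_space set \<Rightarrow> (nat \<Rightarrow> real) \<Rightarrow> bool" where
  "dirichlet_eigenvalues \<Omega> lam \<longleftrightarrow>
     (\<forall>i j. 1 \<le> i \<and> i \<le> j \<longrightarrow> lam i \<le> lam j) \<and>
     (\<forall>\<mu>. finite {i. 1 \<le> i \<and> lam i = \<mu>} \<and> has_multiplicity \<Omega> \<mu> (card {i. 1 \<le> i \<and> lam i = \<mu>}))"

text \<open>The oriented integral, so that also \<open>s < 0\<close> is covered.\<close>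

definition primitive :: "(real \<Rightarrow> real) \<Rightarrow> real \<Rightarrow> real" where
  "primitive g s = (LBINT t=0..s. g t)"

definition SC_sequence ::
    "'a::euclidean_space set \<Rightarrow> ('a \<Rightarrow> real) set \<Rightarrow> (nat \<Rightarrow> 'a \<Rightarrow> real) \<Rightarrow> bool" where
  "SC_sequence \<Omega> Hbar u \<longleftrightarrow>
     (\<forall>n. u n \<in> W12_0 \<Omega>) \<and>
     filterlim (\<lambda>n. L2_norm \<Omega> (u n)) at_top sequentially \<and>
     (\<exists>\<phi>\<^sub>0\<in>Hbar. (\<lambda>n. L2_norm \<Omega> (\<lambda>x. u n x / L2_norm \<Omega> (u n) - \<phi>\<^sub>0 x)) \<longlonglongrightarrow> 0)"

definition SC_plus ::
    "'a::euclidean_space set \<Rightarrow> ('a \<Rightarrow> real) set \<Rightarrow> (real \<Rightarrow> real) \<Rightarrow> ('a \<Rightarrow> real) \<Rightarrow> bool" where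
  "SC_plus \<Omega> Hbar g fbar \<longleftrightarrow> (\<forall>u. SC_sequence \<Omega> Hbar u \<longrightarrow>
     filterlim (\<lambda>n. (LINT x|lebesgue_on \<Omega>. primitive g (u n x)) -
                    (LINT x|lebesgue_on \<Omega>. fbar x * u n x)) at_top sequentially)"

definition SC_minus ::
    "'a::euclidean_space set \<Rightarrow> ('a \<Rightarrow> real) set \<Rightarrow> (real \<Rightarrow> real) \<Rightarrow> ('a \<Rightarrow> real) \<Rightarrow> bool" where
  "SC_minus \<Omega> Hbar g fbar \<longleftrightarrow> (\<forall>u. SC_sequence \<Omega> Hbar u \<longrightarrow>
     filterlim (\<lambda>n. (LINT x|lebesgue_on \<Omega>. primitive g (u n x)) -
                    (LINT x|lebesgue_on \<Omega>. fbar x * u n x)) at_bot sequentially)"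

end

theory Submission
  imports Defs "HOL-Library.Diagonal_Subsequence"
begin

text \<open>
  Let \<open>E\<close> be the Hilbert space \<open>W\<^sub>0\<^sup>1\<^sup>2(\<Omega>)\<close> with the inner product \<open>a + b\<close>, where \<open>a\<close> is the Dirichlet form and
  \<open>b\<close> the inner product of \<open>L\<^sup>2(\<Omega>)\<close>. Friedrichs' inequality makes the embedding of \<open>E\<close> into \<open>L\<^sup>2(\<Omega>)\<close>
  compact, so below and at \<open>\<lambda>\<^sub>k\<close> there are finitely many eigenfunctions, and on the orthogonal complement of
  these the form \<open>a - \<lambda>\<^sub>k b\<close> is coercive. Replace \<open>\<lambda>\<^sub>k\<close> by \<open>\<lambda>\<^sub>k - \<epsilon>\<close> under \<open>(SC)\<^sub>+\<close> and by \<open>\<lambda>\<^sub>k + \<epsilon>\<close> under \<open>(SC)\<^sub>-\<close>,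
  and \<open>g\<close> by a Lipschitz difference quotient of \<open>G\<close> whose primitive stays within bounded distance of \<open>G\<close>.
  The energy \<open>J\<close> is then bounded above on the span \<open>V\<close> of the eigenfunctions below the shifted value and
  bounded below on the complement of \<open>V\<close>.

  Explicit gradient descent expands the \<open>V\<close>-coordinates up to bounded errors, so by Brouwer's theorem some
  starting point in \<open>V\<close> is carried into the complement of \<open>V\<close> after \<open>n\<close> steps. Along its orbit the energy drops
  only by a bounded amount, so one of the iterates is an almost critical point whose energy lies between
  the two bounds. The relevant bound does not depend on \<open>\<epsilon>\<close>, and the component of an almost critical point
  outside the resonant eigenspace is bounded; hence an unbounded sequence of almost critical points would
  contradict the solvability condition. A bounded one converges, by compactness, to a solution.
\<close>

section \<open>Brouwer's theorem on cubes of arbitrary dimension\<close>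

text \<open>The obstacle is that at resonance almost critical points may escape to infinity along
  the resonant eigenspace. The shift by \<epsilon> restores a saddle geometry, but one of the two
  energy bounds then blows up like 1/\<epsilon>. The sign of the shift puts the resonant eigenspace
  on the side of that bad bound; the other bound is uniform, and it is the one that opposes the
  solvability condition, because at an almost critical point the shift adds to the energy a term
  whose sign allows it to be dropped. Descent by explicit steps needs a Lipschitz gradient while
  \<open>g\<close> is only continuous, hence the regularisation. Limits are taken only after almost
  critical points have been found at each stage, so the Lipschitz constants may grow. The inner
  product a + b moves every eigenvalue \<lambda> to 1 + \<lambda>. Sobolev functions are represented
  by pairs (u, grad u) of square integrable functions on the whole space, so completeness is
  inherited from one L2 space of vector valued functions.\<close>

lemma finite_family_convergent_subsequence:
  fixes X :: "nat \<Rightarrow> 'i \<Rightarrow> real"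
  assumes "finite I" "\<And>n i. i \<in> I \<Longrightarrow> \<bar>X n i\<bar> \<le> B"
  shows "\<exists>r y. strict_mono (r :: nat \<Rightarrow> nat) \<and> (\<forall>i\<in>I. (\<lambda>n. X (r n) i) \<longlonglongrightarrow> y i)"
  using assms
proof (induction I rule: finite_induct)
  case empty
  then show ?case by (intro exI[of _ id]) (auto simp: strict_mono_def)
next
  case (insert i I)
  then obtain r y where r: "strict_mono (r :: nat \<Rightarrow> nat)" and y: "\<forall>j\<in>I. (\<lambda>n. X (r n) j) \<longlonglongrightarrow> y j"
    by auto
  have "bounded (range (\<lambda>n. X (r n) i))"
    using insert.prems by (intro boundedI[of _ B]) auto
  then obtain l s where s: "strict_mono s" "((\<lambda>n. X (r n) i) \<circ> s) \<longlonglongrightarrow> l"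
    using bounded_imp_convergent_subsequence by blast
  have "(\<lambda>n. X ((r \<circ> s) n) j) \<longlonglongrightarrow> (y(i := l)) j" if "j \<in> insert i I" for j
  proof (cases "j = i")
    case True
    then show ?thesis using s by (simp add: o_def)
  next
    case False
    then have "(\<lambda>n. X (r n) j) \<longlonglongrightarrow> y j" using y that by auto
    from LIMSEQ_subseq_LIMSEQ[OF this s(1)] show ?thesis using False by (simp add: o_def)
  qed
  moreover have "strict_mono (r \<circ> s)" using r s by (simp add: strict_mono_o)
  ultimately show ?case by blast
qed

text \<open>The dimension will be a number of eigenvectors known only inside a proof, so points are
  functions on the naturals of which the first \<open>N\<close> values count. Kuhn's lemma supplies,
  for each mesh and each coordinate, two nearby grid points at which that coordinate of
  \<open>T y - y\<close> has opposite signs; a limit of grid points is fixed.\<close>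

lemma brouwer_unit_cube_nat:
  fixes T :: "(nat \<Rightarrow> real) \<Rightarrow> nat \<Rightarrow> real"
  assumes range: "\<And>y i. (\<forall>j<N. 0 \<le> y j \<and> y j \<le> 1) \<Longrightarrow> i < N \<Longrightarrow> 0 \<le> T y i \<and> T y i \<le> 1"
    and cont: "\<And>X y i. (\<forall>n. \<forall>j<N. 0 \<le> X n j \<and> X n j \<le> 1) \<Longrightarrow> (\<forall>j<N. (\<lambda>n. X n j) \<longlonglongrightarrow> y j)
      \<Longrightarrow> i < N \<Longrightarrow> (\<lambda>n. T (X n) i) \<longlonglongrightarrow> T y i"
  shows "\<exists>y. (\<forall>j<N. 0 \<le> y j \<and> y j \<le> 1) \<and> (\<forall>i<N. T y i = y i)"
proof -
  have grid: "\<exists>q :: nat \<Rightarrow> real. (\<forall>j<N. 0 \<le> q j \<and> q j \<le> 1) \<and> (\<forall>i<N. \<exists>r s.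
      (\<forall>j<N. 0 \<le> r j \<and> r j \<le> 1 \<and> \<bar>r j - q j\<bar> \<le> 1 / real (Suc n)) \<and>
      (\<forall>j<N. 0 \<le> s j \<and> s j \<le> 1 \<and> \<bar>s j - q j\<bar> \<le> 1 / real (Suc n)) \<and> r i \<le> T r i \<and> T s i \<le> s i)" for n
  proof -
    define p where "p = Suc n"
    have p: "p > 0" by (simp add: p_def)
    define sc where "sc = (\<lambda>(x :: nat \<Rightarrow> nat) j. real (x j) / real p)"
    define label where "label = (\<lambda>(x :: nat \<Rightarrow> nat) i. if x i = 0 \<or> (x i \<noteq> p \<and> sc x i \<le> T (sc x) i) then 0 else 1 :: nat)"
    \<comment> \<open>Kuhn's lemma prescribes the labels on opposite faces, which overrides the comparison with \<open>T\<close> there.\<close>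
    have sc01: "\<forall>j<N. 0 \<le> sc x j \<and> sc x j \<le> 1" if "\<forall>j<N. x j \<le> p" for x
      using that p by (auto simp: sc_def divide_le_eq_1)
    have l0: "sc x i \<le> T (sc x) i" if "\<forall>j<N. x j \<le> p" "i < N" "label x i = 0" for x i
      using range[OF sc01[OF that(1)] that(2)] that(3)
      by (auto simp: label_def sc_def split: if_splits)
    have l1: "T (sc x) i \<le> sc x i" if "\<forall>j<N. x j \<le> p" "i < N" "label x i \<noteq> 0" for x i
    proof (cases "x i = p")
      case True
      then have "sc x i = 1" using p by (simp add: sc_def)
      then show ?thesis using range[OF sc01[OF that(1)] that(2)] by simp
    next
      case False
      then show ?thesis using that(3) by (auto simp: label_def split: if_splits)
    qed
    obtain q where q: "\<forall>i<N. q i < p"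
      and rs: "\<forall>i<N. \<exists>r s. (\<forall>j<N. q j \<le> r j \<and> r j \<le> q j + 1) \<and> (\<forall>j<N. q j \<le> s j \<and> s j \<le> q j + 1) \<and> label r i \<noteq> label s i"
      by (rule kuhn_lemma[of p N label]) (use p in \<open>auto simp: label_def\<close>)
    have near: "\<forall>j<N. 0 \<le> sc r j \<and> sc r j \<le> 1 \<and> \<bar>sc r j - sc q j\<bar> \<le> 1 / real (Suc n)"
      and le: "\<forall>j<N. r j \<le> p"
      if "\<forall>j<N. q j \<le> r j \<and> r j \<le> q j + 1" for r
    proof -
      show le: "\<forall>j<N. r j \<le> p" using that q by (metis Suc_eq_plus1 Suc_leI le_trans)
      have "\<bar>sc r j - sc q j\<bar> \<le> 1 / real (Suc n)" if "j < N" for j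
      proof -
        have "real (q j) \<le> real (r j)" "real (r j) \<le> real (q j) + 1"
          using \<open>\<forall>j<N. q j \<le> r j \<and> r j \<le> q j + 1\<close> that by (auto simp flip: of_nat_Suc)
        then show ?thesis
          by (simp add: sc_def p_def divide_right_mono flip: diff_divide_distrib)
      qed
      then show "\<forall>j<N. 0 \<le> sc r j \<and> sc r j \<le> 1 \<and> \<bar>sc r j - sc q j\<bar> \<le> 1 / real (Suc n)"
        using sc01[OF le] by blast
    qed
    have "\<exists>r s. (\<forall>j<N. 0 \<le> r j \<and> r j \<le> 1 \<and> \<bar>r j - sc q j\<bar> \<le> 1 / real (Suc n)) \<and>
      (\<forall>j<N. 0 \<le> s j \<and> s j \<le> 1 \<and> \<bar>s j - sc q j\<bar> \<le> 1 / real (Suc n)) \<and> r i \<le> T r i \<and> T s i \<le> s i"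
      if i: "i < N" for i
    proof -
      obtain r s where r: "\<forall>j<N. q j \<le> r j \<and> r j \<le> q j + 1" and s: "\<forall>j<N. q j \<le> s j \<and> s j \<le> q j + 1"
        and ne: "label r i \<noteq> label s i" using rs i by blast
      show ?thesis
      proof (cases "label r i = 0")
        case True
        then show ?thesis using near[OF r] near[OF s] l0[OF le[OF r] i] l1[OF le[OF s] i] ne by metis
      next
        case False
        then have "label s i = 0" using ne by (auto simp: label_def split: if_splits)
        then show ?thesis using False near[OF r] near[OF s] l0[OF le[OF s] i] l1[OF le[OF r] i] by metis
      qed
    qed
    moreover have "\<forall>j<N. 0 \<le> sc q j \<and> sc q j \<le> 1" using q by (intro sc01) auto
    ultimately show ?thesis by blast
  qed
  \<comment> \<open>The pair \<open>r\<close>, \<open>s\<close> depends on the coordinate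
    \<open>i\<close>; \<open>A\<close> hides it, so that a single sequence \<open>Q\<close> can be
    chosen for all coordinates before a subsequence is taken.\<close>
  define A where "A = (\<lambda>n q. (\<forall>j<N. 0 \<le> q j \<and> q j \<le> 1) \<and> (\<forall>i<N. \<exists>r s.
      (\<forall>j<N. 0 \<le> r j \<and> r j \<le> 1 \<and> \<bar>r j - q j\<bar> \<le> 1 / real (Suc n)) \<and>
      (\<forall>j<N. 0 \<le> s j \<and> s j \<le> 1 \<and> \<bar>s j - q j\<bar> \<le> 1 / real (Suc n)) \<and> r i \<le> T r i \<and> T s i \<le> s i))"
  have "\<forall>n. \<exists>q. A n q" using grid unfolding A_def by blast
  then obtain Q where A: "\<And>n. A n (Q n)" by metis
  have Q: "\<forall>j<N. 0 \<le> Q n j \<and> Q n j \<le> 1" for n using A unfolding A_def by blast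
  have Qrs: "\<exists>r s.
      (\<forall>j<N. 0 \<le> r j \<and> r j \<le> 1 \<and> \<bar>r j - Q n j\<bar> \<le> 1 / real (Suc n)) \<and>
      (\<forall>j<N. 0 \<le> s j \<and> s j \<le> 1 \<and> \<bar>s j - Q n j\<bar> \<le> 1 / real (Suc n)) \<and> r i \<le> T r i \<and> T s i \<le> s i"
    if "i < N" for n i using A that unfolding A_def by blast
  have "\<bar>Q n j\<bar> \<le> 1" if "j \<in> {..<N}" for n j using Q[of n] that by (auto simp: abs_le_iff)
  then obtain r y where r: "strict_mono (r :: nat \<Rightarrow> nat)" and y: "\<forall>j\<in>{..<N}. (\<lambda>n. Q (r n) j) \<longlonglongrightarrow> y j"
    using finite_family_convergent_subsequence[of "{..<N}" Q 1] by blast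
  have y01: "\<forall>j<N. 0 \<le> y j \<and> y j \<le> 1"
  proof (intro allI impI)
    fix j assume "j < N"
    then have "(\<lambda>n. Q (r n) j) \<longlonglongrightarrow> y j" "\<And>n. 0 \<le> Q (r n) j" "\<And>n. Q (r n) j \<le> 1" using y Q by auto
    then show "0 \<le> y j \<and> y j \<le> 1" by (meson LIMSEQ_le_const LIMSEQ_le_const2)
  qed
  have inv0: "(\<lambda>n. 1 / real (Suc (r n))) \<longlonglongrightarrow> 0"
    using LIMSEQ_subseq_LIMSEQ[OF lim_inverse_n' r] LIMSEQ_subseq_LIMSEQ[OF LIMSEQ_inverse_real_of_nat r]
    by (simp add: o_def inverse_eq_divide)
  have lim: "\<forall>j<N. (\<lambda>n. Z n j) \<longlonglongrightarrow> y j" if "\<And>n j. j < N \<Longrightarrow> \<bar>Z n j - Q (r n) j\<bar> \<le> 1 / real (Suc (r n))"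
    for Z :: "nat \<Rightarrow> nat \<Rightarrow> real"
  proof (intro allI impI)
    fix j assume j: "j < N"
    have "(\<lambda>n. Z n j - Q (r n) j) \<longlonglongrightarrow> 0"
      by (rule Lim_null_comparison[OF _ inv0]) (use that j in auto)
    from tendsto_add[OF this] show "(\<lambda>n. Z n j) \<longlonglongrightarrow> y j" using y j by fastforce
  qed
  have "T y i = y i" if i: "i < N" for i
  proof -
    \<comment> \<open>Both witnesses stay within the mesh of \<open>Q (r n)\<close> and share its
      limit \<open>y\<close>; their opposite inequalities squeeze \<open>T y i\<close>.\<close>
    have "\<forall>n. \<exists>a b.
      (\<forall>j<N. 0 \<le> a j \<and> a j \<le> 1 \<and> \<bar>a j - Q (r n) j\<bar> \<le> 1 / real (Suc (r n))) \<and>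
      (\<forall>j<N. 0 \<le> b j \<and> b j \<le> 1 \<and> \<bar>b j - Q (r n) j\<bar> \<le> 1 / real (Suc (r n))) \<and> a i \<le> T a i \<and> T b i \<le> (b i :: real)"
      using Qrs[OF i] by blast
    then obtain a b where a: "\<And>n. \<forall>j<N. 0 \<le> a n j \<and> a n j \<le> 1 \<and> \<bar>a n j - Q (r n) j\<bar> \<le> 1 / real (Suc (r n))"
      and b: "\<And>n. \<forall>j<N. 0 \<le> b n j \<and> b n j \<le> 1 \<and> \<bar>b n j - Q (r n) j\<bar> \<le> 1 / real (Suc (r n))"
      and ab: "\<And>n. a n i \<le> T (a n) i" "\<And>n. T (b n) i \<le> b n i"
      by metis
    have la: "\<forall>j<N. (\<lambda>n. a n j) \<longlonglongrightarrow> y j" and lb: "\<forall>j<N. (\<lambda>n. b n j) \<longlonglongrightarrow> y j"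
      using a b by (auto intro!: lim[rule_format])
    have "(\<lambda>n. T (a n) i) \<longlonglongrightarrow> T y i" "(\<lambda>n. T (b n) i) \<longlonglongrightarrow> T y i"
      using a b i by (auto intro!: cont la lb)
    then have "y i \<le> T y i" "T y i \<le> y i"
      using ab la lb i by (auto intro: LIMSEQ_le)
    then show ?thesis by simp
  qed
  then show ?thesis using y01 by blast
qed

text \<open>The index set will be a set of eigenvectors, and the coordinates of starting points are
  bounded in absolute value only. An enumeration of \<open>I\<close> and an affine map reduce this
  to the unit cube.\<close>

lemma brouwer_cube:
  fixes T :: "('i \<Rightarrow> real) \<Rightarrow> 'i \<Rightarrow> real"
  assumes I: "finite I" and R: "R > 0"
    and range: "\<And>y i. (\<forall>j\<in>I. \<bar>y j\<bar> \<le> R) \<Longrightarrow> i \<in> I \<Longrightarrow> \<bar>T y i\<bar> \<le> R"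
    and cont: "\<And>X y i. (\<forall>j\<in>I. (\<lambda>n. X n j) \<longlonglongrightarrow> y j) \<Longrightarrow> i \<in> I \<Longrightarrow> (\<lambda>n. T (X n) i) \<longlonglongrightarrow> T y i"
  shows "\<exists>y. \<forall>i\<in>I. \<bar>y i\<bar> \<le> R \<and> T y i = y i"
proof -
  obtain h where h: "bij_betw h {..<card I} I"
    using ex_bij_betw_nat_finite[OF I] by (auto simp: atLeast0LessThan)
  define k where "k = inv_into {..<card I} h"
  have k: "k i < card I" "h (k i) = i" if "i \<in> I" for i
    using that h bij_betw_inv_into_right[OF h that] bij_betwE[OF bij_betw_inv_into[OF h]] by (auto simp: k_def)
  have hI: "h j \<in> I" "k (h j) = j" if "j < card I" for j
    using that h bij_betwE[OF h] bij_betw_inv_into_left[OF h] by (auto simp: k_def)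
  define sc where "sc = (\<lambda>(t :: nat \<Rightarrow> real) i. R * (2 * t (k i) - 1))"
  have sc: "\<forall>i\<in>I. \<bar>sc t i\<bar> \<le> R" if "\<forall>j<card I. 0 \<le> t j \<and> t j \<le> 1" for t
  proof
    fix i assume "i \<in> I"
    then have "\<bar>2 * t (k i) - 1\<bar> \<le> 1" using that k by (auto simp: abs_le_iff)
    then have "R * \<bar>2 * t (k i) - 1\<bar> \<le> R * 1" using R by (intro mult_left_mono) auto
    then show "\<bar>sc t i\<bar> \<le> R" using R by (simp add: sc_def abs_mult)
  qed
  define T' where "T' = (\<lambda>t j. (T (sc t) (h j) / R + 1) / 2)"
  have "\<exists>t. (\<forall>j<card I. 0 \<le> t j \<and> t j \<le> 1) \<and> (\<forall>j<card I. T' t j = t j)"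
  proof (rule brouwer_unit_cube_nat)
    fix t :: "nat \<Rightarrow> real" and j assume t: "\<forall>j<card I. 0 \<le> t j \<and> t j \<le> 1" and j: "j < card I"
    have "\<bar>T (sc t) (h j)\<bar> \<le> R" using range[OF sc[OF t]] hI j by auto
    then have "\<bar>T (sc t) (h j) / R\<bar> \<le> 1" using R by (simp add: divide_le_eq_1)
    moreover have "0 \<le> (x + 1) / 2 \<and> (x + 1) / 2 \<le> 1" if "\<bar>x\<bar> \<le> 1" for x :: real using that by (auto simp: abs_le_iff)
    ultimately show "0 \<le> T' t j \<and> T' t j \<le> 1" unfolding T'_def by blast
  next
    fix X :: "nat \<Rightarrow> nat \<Rightarrow> real" and t i
    assume lim: "\<forall>j<card I. (\<lambda>n. X n j) \<longlonglongrightarrow> t j" and i: "i < card I"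
    have "(\<lambda>n. T (sc (X n)) (h i)) \<longlonglongrightarrow> T (sc t) (h i)"
    proof (rule cont[OF _ hI(1)[OF i]], intro ballI)
      fix j assume "j \<in> I"
      then have "(\<lambda>n. X n (k j)) \<longlonglongrightarrow> t (k j)" using lim k by auto
      then show "(\<lambda>n. sc (X n) j) \<longlonglongrightarrow> sc t j" unfolding sc_def by (intro tendsto_intros)
    qed
    then show "(\<lambda>n. T' (X n) i) \<longlonglongrightarrow> T' t i" unfolding T'_def by (intro tendsto_intros) (use R in auto)
  qed
  then obtain t where t: "\<forall>j<card I. 0 \<le> t j \<and> t j \<le> 1" "\<forall>j<card I. T' t j = t j" by blast
  have "T (sc t) i = sc t i" if "i \<in> I" for i
  proof -
    have "(T (sc t) i / R + 1) / 2 = t (k i)" using t(2) k[OF that] by (auto simp: T'_def)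
    then show ?thesis using R by (simp add: sc_def field_simps)
  qed
  then show ?thesis using sc[OF t(1)] by blast
qed

section \<open>Compact embeddings of Hilbert spaces\<close>

text \<open>One criterion for three strong convergences: minimising sequences (\<open>d\<close>
  comes from the parallelogram law, \<open>z\<close> is trivial), maximising sequences of a Rayleigh
  quotient (\<open>z\<close> is the convergent image under \<open>P\<close>), and eigenvectors of
  one value (\<open>d\<close> vanishes).\<close>

lemma Cauchy_norm_square_bound:
  fixes x :: "nat \<Rightarrow> 'a::real_normed_vector" and z :: "nat \<Rightarrow> 'b::real_normed_vector"
  assumes bound: "\<And>m n. (norm (x m - x n))\<^sup>2 \<le> d m + d n + c * (norm (z m - z n))\<^sup>2"
    and d: "d \<longlonglongrightarrow> 0" and z: "Cauchy z" and c: "c \<ge> 0"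
  shows "Cauchy x"
proof (rule metric_CauchyI)
  fix e :: real assume e: "e > 0"
  \<comment> \<open>Makes \<open>c * k\<^sup>2\<close> at most half of \<open>e\<^sup>2\<close>; the
    other half is shared by \<open>d m\<close> and \<open>d n\<close>. The summand 1 covers
    \<open>c = 0\<close>.\<close>
  define k where "k = e / sqrt (2 * (c + 1))"
  have k: "k > 0" using e c by (simp add: k_def)
  have k2: "c * k\<^sup>2 \<le> e\<^sup>2 / 2"
  proof -
    have "c * k\<^sup>2 = (e\<^sup>2 / 2) * (c / (c + 1))" using c by (simp add: k_def power_divide)
    also have "\<dots> \<le> (e\<^sup>2 / 2) * 1" using c by (intro mult_left_mono) (auto simp: divide_le_eq_1)
    finally show ?thesis by simp
  qed
  obtain N1 where N1: "\<And>n. n \<ge> N1 \<Longrightarrow> \<bar>d n\<bar> < e\<^sup>2 / 4"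
    using LIMSEQ_D[OF d, of "e\<^sup>2 / 4"] e by auto
  obtain N2 where N2: "\<And>m n. m \<ge> N2 \<Longrightarrow> n \<ge> N2 \<Longrightarrow> dist (z m) (z n) < k"
    using metric_CauchyD[OF z k] by blast
  show "\<exists>M. \<forall>m\<ge>M. \<forall>n\<ge>M. dist (x m) (x n) < e"
  proof (intro exI allI impI)
    fix m n assume mn: "max N1 N2 \<le> m" "max N1 N2 \<le> n"
    have "(norm (z m - z n))\<^sup>2 \<le> k\<^sup>2" using N2[of m n] mn by (intro power_mono) (auto simp: dist_norm)
    then have "c * (norm (z m - z n))\<^sup>2 \<le> e\<^sup>2 / 2" using c k2 by (meson mult_left_mono order_trans)
    moreover have "d m < e\<^sup>2 / 4" "d n < e\<^sup>2 / 4" using N1[of m] N1[of n] mn by auto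
    ultimately have "(norm (x m - x n))\<^sup>2 < e\<^sup>2" using bound[of m n] by linarith
    then show "dist (x m) (x n) < e" using e by (simp add: dist_norm power_less_imp_less_base)
  qed
qed

text \<open>First variation at a minimum: for small \<open>t\<close> of sign opposite to
  \<open>a\<close> the linear term wins, whatever \<open>b\<close> is.\<close>

lemma linear_coefficient_zero:
  fixes a b :: real
  assumes "\<And>t. 0 \<le> t * a + t\<^sup>2 * b"
  shows "a = 0"
proof (rule ccontr)
  assume a: "a \<noteq> 0"
  define t where "t = - a / (\<bar>b\<bar> + 1)"
  have "t * a + t\<^sup>2 * b \<le> t * a + t\<^sup>2 * \<bar>b\<bar>" by (intro add_left_mono mult_left_mono) auto
  also have "\<dots> = - (a\<^sup>2 / (\<bar>b\<bar> + 1)\<^sup>2)" 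
    by (simp add: t_def power2_eq_square divide_simps) (simp add: algebra_simps)
  also have "\<dots> < 0" using a by (simp add: add_pos_nonneg)
  finally show False using assms[of t] by simp
qed

lemma norm_parallelogram:
  fixes x y :: "'a::real_inner"
  shows "(norm (x + y))\<^sup>2 + (norm (x - y))\<^sup>2 = 2 * (norm x)\<^sup>2 + 2 * (norm y)\<^sup>2"
  by (simp add: power2_norm_eq_inner algebra_simps inner_commute)

lemma LIMSEQ_inverse_Suc: "(\<lambda>n. 1 / real (Suc n)) \<longlonglongrightarrow> 0"
  using LIMSEQ_inverse_real_of_nat by (simp add: inverse_eq_divide)

text \<open>\<open>P\<close> models the embedding into L2, of norm at most 1 because the inner
  product of the domain contains that of L2. \<open>friedrichs\<close> states compactness of
  \<open>P\<close> on \<open>S\<close> quantitatively: up to a small multiple of the full norm,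
  finitely many linear functionals control the L2 norm. In this form it passes from test functions
  to their closure.\<close>

locale compact_embedding =
  fixes S :: "'e::{real_inner,complete_space} set"
    and P :: "'e \<Rightarrow> 'f::{real_inner,complete_space}"
  assumes subspace_S: "subspace S" and closed_S: "closed S"
    and linear_P: "bounded_linear P" and norm_P: "norm (P x) \<le> norm x"
    and friedrichs: "0 < \<epsilon> \<Longrightarrow> \<exists>W. finite W \<and>
      (\<forall>x\<in>S. (norm (P x))\<^sup>2 \<le> (\<Sum>w\<in>W. (P x \<bullet> w)\<^sup>2) + \<epsilon> * (norm x)\<^sup>2)"
begin

lemmas P_simps = bounded_linear.linear[OF linear_P, THEN linear_add] bounded_linear.linear[OF linear_P, THEN linear_diff]
  bounded_linear.linear[OF linear_P, THEN linear_scale] bounded_linear.linear[OF linear_P, THEN linear_0]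
  bounded_linear.linear[OF linear_P, THEN linear_neg]

lemmas S_intros = subspace_add[OF subspace_S] subspace_diff[OF subspace_S] subspace_scale[OF subspace_S] subspace_0[OF subspace_S]

lemma P_lim: "X \<longlonglongrightarrow> x \<Longrightarrow> (\<lambda>n. P (X n)) \<longlonglongrightarrow> P x"
  using bounded_linear.tendsto[OF linear_P] .

lemma S_lim: "(\<And>n. X n \<in> S) \<Longrightarrow> X \<longlonglongrightarrow> x \<Longrightarrow> x \<in> S"
  using closed_S closed_sequentially by blast

text \<open>A diagonal sequence makes the finitely many functionals of \<open>friedrichs\<close>
  converge at every accuracy 1/(k+1); the inequality then makes the images a Cauchy
  sequence.\<close>

lemma compact_subsequence:
  assumes X: "\<And>n. X n \<in> S" and B: "\<And>n. norm (X n) \<le> B"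
  shows "\<exists>r l. strict_mono (r :: nat \<Rightarrow> nat) \<and> (\<lambda>n. P (X (r n))) \<longlonglongrightarrow> l"
proof -
  have "\<forall>k::nat. \<exists>W. finite W \<and> (\<forall>x\<in>S. (norm (P x))\<^sup>2 \<le> (\<Sum>w\<in>W. (P x \<bullet> w)\<^sup>2) + 1 / real (Suc k) * (norm x)\<^sup>2)"
    using friedrichs by (meson of_nat_0_less_iff zero_less_Suc zero_less_divide_1_iff)
  then obtain W where W: "\<And>k. finite (W k)"
    and fr: "\<And>k x. x \<in> S \<Longrightarrow> (norm (P x))\<^sup>2 \<le> (\<Sum>w\<in>W k. (P x \<bullet> w)\<^sup>2) + 1 / real (Suc k) * (norm x)\<^sup>2"
    by metis
  \<comment> \<open>Convergence on \<open>W k\<close> is inherited by further subsequences, as the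
    diagonal construction demands.\<close>
  define Q where "Q = (\<lambda>k (s :: nat \<Rightarrow> nat). \<forall>w\<in>W k. convergent (\<lambda>n. P (X (s n)) \<bullet> w))"
  interpret subseqs Q
  proof
    fix k and s :: "nat \<Rightarrow> nat" assume "strict_mono s"
    define D where "D = B * Max (insert 0 (norm ` W k))"
    have "\<bar>P (X (s n)) \<bullet> w\<bar> \<le> D" if "w \<in> W k" for n w
    proof -
      have "\<bar>P (X (s n)) \<bullet> w\<bar> \<le> norm (P (X (s n))) * norm w" by (rule Cauchy_Schwarz_ineq2)
      also have "\<dots> \<le> B * Max (insert 0 (norm ` W k))"
        using that W B[of "s n"] norm_P[of "X (s n)"]
        by (intro mult_mono Max_ge) (auto intro: order_trans[of _ "norm (X (s n))"] order_trans[of _ "norm (P (X (s n)))"])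
      finally show ?thesis by (simp add: D_def)
    qed
    then obtain r y where "strict_mono (r :: nat \<Rightarrow> nat)" "\<forall>w\<in>W k. (\<lambda>n. P (X (s (r n))) \<bullet> w) \<longlonglongrightarrow> y w"
      using finite_family_convergent_subsequence[OF W, where X = "\<lambda>n w. P (X (s n)) \<bullet> w"] by blast
    then show "\<exists>r'. strict_mono r' \<and> Q k (s \<circ> r')"
      by (auto simp: Q_def convergent_def intro!: exI[of _ r])
  qed
  have conv: "convergent (\<lambda>n. P (X (diagseq n)) \<bullet> w)" if "w \<in> W k" for w k
  proof -
    have "Q k (diagseq \<circ> (+) (Suc k))"
    proof (rule diagseq_holds)
      fix r s :: "nat \<Rightarrow> nat" and n assume "strict_mono r" "Q n s"
      then show "Q n (s \<circ> r)" unfolding Q_def convergent_def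
        using LIMSEQ_subseq_LIMSEQ by (fastforce simp: o_def)
    qed
    then have "convergent (\<lambda>n. P (X (diagseq (n + Suc k))) \<bullet> w)"
      using that by (simp add: Q_def o_def add.commute)
    then show ?thesis using convergent_ignore_initial_segment[of "\<lambda>n. P (X (diagseq n)) \<bullet> w" "Suc k"] by simp
  qed
  have "Cauchy (\<lambda>n. P (X (diagseq n)))"
  proof (rule metric_CauchyI)
    fix e :: real assume e: "e > 0"
    \<comment> \<open>Differences of members have norm at most \<open>2 * B\<close>, so this
      \<open>k\<close> keeps the last term of the inequality below
      \<open>e\<^sup>2 / 2\<close>.\<close>
    obtain k where k: "(4 * B\<^sup>2) / (e\<^sup>2 / 2) < real k" using reals_Archimedean2 by blast
    have "4 * B\<^sup>2 < real k * (e\<^sup>2 / 2)" using k e by (simp add: pos_divide_less_eq)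
    also have "\<dots> \<le> real (Suc k) * (e\<^sup>2 / 2)" by (intro mult_right_mono) auto
    finally have k': "1 / real (Suc k) * (4 * B\<^sup>2) < e\<^sup>2 / 2" by (simp add: pos_divide_less_eq mult.commute)
    \<comment> \<open>With this accuracy the \<open>card (W k)\<close> squares sum to at most
      \<open>e\<^sup>2 / 2\<close>; the added 1 covers an empty \<open>W k\<close>.\<close>
    define q where "q = e / sqrt (2 * (real (card (W k)) + 1))"
    have q: "q > 0" using e by (simp add: q_def)
    have "\<exists>N. \<forall>m\<ge>N. \<forall>n\<ge>N. \<bar>P (X (diagseq m)) \<bullet> w - P (X (diagseq n)) \<bullet> w\<bar> < q" if "w \<in> W k" for w
      using conv[OF that] q unfolding Cauchy_convergent_iff[symmetric] Cauchy_def dist_real_def by blast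
    then obtain Nf where Nf: "\<And>w m n. w \<in> W k \<Longrightarrow> m \<ge> Nf w \<Longrightarrow> n \<ge> Nf w \<Longrightarrow> \<bar>P (X (diagseq m)) \<bullet> w - P (X (diagseq n)) \<bullet> w\<bar> < q"
      by metis
    show "\<exists>M. \<forall>m\<ge>M. \<forall>n\<ge>M. dist (P (X (diagseq m))) (P (X (diagseq n))) < e"
    proof (intro exI allI impI)
      fix m n assume mn: "Max (insert 0 (Nf ` W k)) \<le> m" "Max (insert 0 (Nf ` W k)) \<le> n"
      let ?x = "X (diagseq m) - X (diagseq n)"
      have "(P ?x \<bullet> w)\<^sup>2 \<le> q\<^sup>2" if "w \<in> W k" for w
      proof -
        have "Nf w \<le> Max (insert 0 (Nf ` W k))" using that W by (intro Max_ge) auto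
        then have "\<bar>P ?x \<bullet> w\<bar> \<le> q" using Nf[OF that, of m n] mn by (auto simp: P_simps inner_diff_left)
        then show ?thesis using power_mono[of "\<bar>P ?x \<bullet> w\<bar>" q 2] by simp
      qed
      then have "(\<Sum>w\<in>W k. (P ?x \<bullet> w)\<^sup>2) \<le> real (card (W k)) * q\<^sup>2" by (intro sum_bounded_above) auto
      also have "\<dots> \<le> e\<^sup>2 / 2"
      proof -
        have "real (card (W k)) * q\<^sup>2 = (e\<^sup>2 / 2) * (real (card (W k)) / (real (card (W k)) + 1))"
          by (simp add: q_def power_divide)
        also have "\<dots> \<le> (e\<^sup>2 / 2) * 1" by (intro mult_left_mono) (auto simp: divide_le_eq_1)
        finally show ?thesis by simp
      qed
      finally have s1: "(\<Sum>w\<in>W k. (P ?x \<bullet> w)\<^sup>2) \<le> e\<^sup>2 / 2" .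
      have "norm ?x \<le> 2 * B" using norm_triangle_ineq4[of "X (diagseq m)" "X (diagseq n)"] B[of "diagseq m"] B[of "diagseq n"] by simp
      then have "(norm ?x)\<^sup>2 \<le> (2 * B)\<^sup>2" by (intro power_mono) auto
      then have "1 / real (Suc k) * (norm ?x)\<^sup>2 \<le> 1 / real (Suc k) * (4 * B\<^sup>2)" by (intro mult_left_mono) (auto simp: power_mult_distrib)
      then have "(norm (P ?x))\<^sup>2 < e\<^sup>2" using fr[of ?x k] s1 k' X S_intros by fastforce
      then show "dist (P (X (diagseq m))) (P (X (diagseq n))) < e"
        using e by (simp add: dist_norm power_less_imp_less_base P_simps)
    qed
  qed
  then obtain l where "(\<lambda>n. P (X (diagseq n))) \<longlonglongrightarrow> l" using Cauchy_convergent_iff convergent_def by blast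
  then show ?thesis using subseq_diagseq by blast
qed

text \<open>Riesz representation on \<open>S\<close> by the direct method: \<open>Q\<close> is
  bounded below by completing the square, the parallelogram law makes a minimising sequence Cauchy,
  and the first variation at the minimiser is the claimed identity.\<close>

lemma riesz_adjoint: "\<exists>u\<in>S. \<forall>v\<in>S. u \<bullet> v = n \<bullet> P v"
proof -
  define Q where "Q = (\<lambda>u. (norm u)\<^sup>2 - 2 * (n \<bullet> P u))"
  have low: "- (norm n)\<^sup>2 \<le> Q u" for u
  proof -
    have "n \<bullet> P u \<le> norm n * norm u"
      using norm_cauchy_schwarz[of n "P u"] norm_P[of u] by (meson mult_left_mono norm_ge_zero order_trans)
    moreover have "0 \<le> (norm u - norm n)\<^sup>2" by simp
    moreover have "(norm u - norm n)\<^sup>2 = (norm u)\<^sup>2 + (norm n)\<^sup>2 - 2 * (norm n * norm u)" by (simp add: power2_diff)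
    ultimately show ?thesis unfolding Q_def by linarith
  qed
  define d where "d = Inf (Q ` S)"
  have bdd: "bdd_below (Q ` S)" using low by (intro bdd_belowI[of _ "- (norm n)\<^sup>2"]) auto
  have dle: "d \<le> Q u" if "u \<in> S" for u unfolding d_def using that bdd by (intro cInf_lower) auto
  have "\<exists>u\<in>S. Q u < d + 1 / real (Suc k)" for k
  proof -
    have "Q ` S \<noteq> {}" using S_intros(4) by auto
    then have "\<exists>y\<in>Q ` S. y < d + 1 / real (Suc k)" using bdd unfolding d_def by (subst cInf_less_iff[symmetric]) auto
    then show ?thesis by blast
  qed
  then obtain u where u: "\<And>k. u k \<in> S" "\<And>k. Q (u k) < d + 1 / real (Suc k)" by metis
  \<comment> \<open>The vanishing last summand gives the estimate the shape of
    \<open>Cauchy_norm_square_bound\<close> with a constant \<open>z\<close>.\<close>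
  have "(norm (u i - u j))\<^sup>2 \<le> 2 * (1 / real (Suc i)) + 2 * (1 / real (Suc j)) + 0 * (norm ((0::real) - 0))\<^sup>2" for i j
  proof -
    have eq: "(norm (u i - u j))\<^sup>2 = 2 * Q (u i) + 2 * Q (u j) - 4 * Q ((1/2) *\<^sub>R (u i + u j))"
    proof -
      have h1: "(norm ((1/2) *\<^sub>R (u i + u j)))\<^sup>2 = (norm (u i + u j))\<^sup>2 / 4" by (simp add: power_divide)
      have h2: "n \<bullet> P ((1/2) *\<^sub>R (u i + u j)) = (n \<bullet> P (u i) + n \<bullet> P (u j)) / 2" by (simp add: P_simps inner_add_right)
      show ?thesis using norm_parallelogram[of "u i" "u j"] unfolding Q_def h1 h2 by (simp add: field_simps)
    qed
    have "d \<le> Q ((1/2) *\<^sub>R (u i + u j))" using u S_intros by (intro dle) auto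
    then show ?thesis using eq u(2)[of i] u(2)[of j] by simp
  qed
  moreover have "(\<lambda>k. 2 * (1 / real (Suc k))) \<longlonglongrightarrow> 0" using tendsto_mult_right_zero[OF LIMSEQ_inverse_Suc] .
  ultimately have "Cauchy u" by (rule Cauchy_norm_square_bound) (auto simp: Cauchy_def)
  then obtain w where w: "u \<longlonglongrightarrow> w" using Cauchy_convergent_iff convergent_def by blast
  have wS: "w \<in> S" using S_lim u w by blast
  have "(\<lambda>k. Q (u k)) \<longlonglongrightarrow> Q w" unfolding Q_def by (intro tendsto_intros P_lim w)
  moreover have "(\<lambda>k. d + 1 / real (Suc k)) \<longlonglongrightarrow> d + 0" by (intro tendsto_intros LIMSEQ_inverse_Suc)
  ultimately have "Q w \<le> d + 0" using u(2) by (intro LIMSEQ_le) (auto intro: less_imp_le)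
  then have min: "Q w \<le> Q v" if "v \<in> S" for v using dle[OF that] by simp
  have "w \<bullet> v = n \<bullet> P v" if v: "v \<in> S" for v
  proof -
    have "0 \<le> t * (2 * (w \<bullet> v - n \<bullet> P v)) + t\<^sup>2 * (norm v)\<^sup>2" for t
    proof -
      have "Q w \<le> Q (w + t *\<^sub>R v)" using min S_intros wS v by auto
      also have "\<dots> = Q w + (t * (2 * (w \<bullet> v - n \<bullet> P v)) + t\<^sup>2 * (norm v)\<^sup>2)"
        unfolding Q_def power2_norm_eq_inner by (simp add: P_simps algebra_simps power2_eq_square inner_commute)
      finally show ?thesis by simp
    qed
    then show ?thesis using linear_coefficient_zero by fastforce
  qed
  then show ?thesis using wS by blast
qed

text \<open>The adjoint of \<open>P\<close> restricted to \<open>S\<close>. For Sobolev functions it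
  is the solution operator of -\<Delta>u + u = n with zero boundary values, and it converts L2
  gradients of lower order terms into gradients in \<open>S\<close>.\<close>

definition adj :: "'f \<Rightarrow> 'e" where
  "adj n = (SOME u. u \<in> S \<and> (\<forall>v\<in>S. u \<bullet> v = n \<bullet> P v))"

lemma adj: "adj n \<in> S" "v \<in> S \<Longrightarrow> adj n \<bullet> v = n \<bullet> P v"
  using someI_ex[of "\<lambda>u. u \<in> S \<and> (\<forall>v\<in>S. u \<bullet> v = n \<bullet> P v)"] riesz_adjoint[of n] unfolding adj_def by blast+

lemma S_eqI: "x = y" if "x \<in> S" "y \<in> S" "\<And>v. v \<in> S \<Longrightarrow> x \<bullet> v = y \<bullet> v"
proof -
  have "(x - y) \<bullet> (x - y) = 0" using that S_intros by (simp add: inner_diff_left)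
  then show ?thesis by simp
qed

lemma norm_adj: "norm (adj n) \<le> norm n"
proof (cases "adj n = 0")
  case False
  have "norm (adj n) * norm (adj n) = adj n \<bullet> adj n" by (simp add: norm_eq_square power2_norm_eq_inner flip: power2_eq_square)
  also have "\<dots> = n \<bullet> P (adj n)" by (rule adj(2)[OF adj(1)])
  also have "\<dots> \<le> norm n * norm (P (adj n))" by (rule norm_cauchy_schwarz)
  also have "\<dots> \<le> norm n * norm (adj n)" by (intro mult_left_mono norm_P) auto
  finally show ?thesis using False by simp
qed auto

lemma bounded_linear_adj: "bounded_linear adj"
proof (rule bounded_linear_intro[of _ 1])
  show "adj (x + y) = adj x + adj y" for x y
    by (rule S_eqI) (auto simp: adj inner_add_left S_intros)
  show "adj (r *\<^sub>R x) = r *\<^sub>R adj x" for r x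
    by (rule S_eqI) (auto simp: adj S_intros)
  show "norm (adj x) \<le> norm x * 1" for x using norm_adj by simp
qed

text \<open>The weak eigenvalue equation a(x, y) = \<mu> b(x, y) with b(x, y) added on both sides;
  hence \<nu> = 1 + \<mu>.\<close>

definition eig :: "real \<Rightarrow> 'e \<Rightarrow> bool" where
  "eig \<nu> x \<longleftrightarrow> x \<in> S \<and> (\<forall>y\<in>S. x \<bullet> y = \<nu> * (P x \<bullet> P y))"

end

section \<open>Eigenvectors, Rayleigh quotients and almost critical points by gradient
  descent\<close>

context compact_embedding begin

text \<open>Testing with \<open>x\<close> itself and using \<open>norm_P\<close>. This is what makes
  the later divisions by \<nu> legitimate.\<close>

lemma eig_eval_ge_1: "\<nu> \<ge> 1" if "eig \<nu> x" "x \<noteq> 0"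
proof -
  have e: "(norm x)\<^sup>2 = \<nu> * (norm (P x))\<^sup>2" using that by (simp add: eig_def power2_norm_eq_inner)
  have "(norm (P x))\<^sup>2 \<le> (norm x)\<^sup>2" using norm_P by (intro power_mono) auto
  moreover have p: "(norm x)\<^sup>2 > 0" using that by simp
  then have "(norm (P x))\<^sup>2 > 0" using e by (metis less_irrefl mult_zero_right zero_less_power2 zero_power2)
  ultimately have "1 * (norm (P x))\<^sup>2 \<le> \<nu> * (norm (P x))\<^sup>2" "(norm (P x))\<^sup>2 > 0" using e by simp_all
  then show ?thesis by (rule mult_right_le_imp_le)
qed

lemma eig_orth: "P x \<bullet> P y = 0" if "eig \<nu> x" "x \<bullet> y = 0" "y \<in> S"
proof (cases "x = 0")
  case False
  then show ?thesis using that eig_eval_ge_1[OF that(1) False] by (auto simp: eig_def)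
qed (simp add: P_simps)

lemma orth_projection_zero:
  assumes "finite B" "pairwise orthogonal B" "\<And>e. e \<in> B \<Longrightarrow> norm e = 1" "e \<in> B"
  shows "(x - (\<Sum>b\<in>B. (x \<bullet> b) *\<^sub>R b)) \<bullet> e = 0"
proof -
  have "(\<Sum>b\<in>B. (x \<bullet> b) * (b \<bullet> e)) = (\<Sum>b\<in>B. if b = e then x \<bullet> e else 0)"
    using assms by (intro sum.cong) (auto simp: pairwise_def orthogonal_def norm_eq_1)
  also have "\<dots> = x \<bullet> e" using assms by simp
  finally show ?thesis by (simp add: inner_diff_left inner_sum_left)
qed

text \<open>The variational principle on the complement of known eigenvectors. A positive supremum
  of the Rayleigh quotient is attained by compactness, and the maximiser is a new eigenvector of
  value 1 / \<theta>; a supremum 0 means that \<open>P\<close> vanishes there.\<close>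

lemma rayleigh_max:
  assumes B: "finite B" "pairwise orthogonal B" "\<And>e. e \<in> B \<Longrightarrow> norm e = 1" "\<And>e. e \<in> B \<Longrightarrow> eig (\<nu> e) e"
  shows "\<exists>\<theta>\<ge>0. (\<forall>x\<in>S. (\<forall>e\<in>B. x \<bullet> e = 0) \<longrightarrow> (norm (P x))\<^sup>2 \<le> \<theta> * (norm x)\<^sup>2) \<and>
    (\<theta> > 0 \<longrightarrow> (\<exists>x. x \<noteq> 0 \<and> (\<forall>e\<in>B. x \<bullet> e = 0) \<and> eig (1 / \<theta>) x))"
proof -
  define T where "T = {x\<in>S. \<forall>e\<in>B. x \<bullet> e = 0}"
  have T: "x + y \<in> T" "x - y \<in> T" "c *\<^sub>R x \<in> T" "0 \<in> T" if "x \<in> T" "y \<in> T" for x y c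
    using that S_intros by (auto simp: T_def inner_add_left inner_diff_left)
  have T0: "0 \<in> T" using S_intros by (auto simp: T_def)
  \<comment> \<open>The unit ball instead of the sphere keeps the set nonempty even if
    \<open>T\<close> is trivial; \<open>main\<close> restores homogeneity.\<close>
  define D where "D = (\<lambda>x. (norm (P x))\<^sup>2) ` {x\<in>T. norm x \<le> 1}"
  define \<theta> where "\<theta> = Sup D"
  have le1: "(norm (P x))\<^sup>2 \<le> 1" if "norm x \<le> 1" for x
    using norm_P[of x] that by (intro power_le_one) auto
  then have bdd: "bdd_above D" by (auto simp: D_def intro!: bdd_aboveI[of _ 1])
  have D0: "0 \<in> D" using T0 by (auto simp: D_def P_simps intro!: image_eqI[of _ _ 0])
  have \<theta>0: "\<theta> \<ge> 0" unfolding \<theta>_def using D0 bdd by (intro cSup_upper) auto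
  have main: "(norm (P x))\<^sup>2 \<le> \<theta> * (norm x)\<^sup>2" if x: "x \<in> T" for x
  proof (cases "x = 0")
    case False
    have "(norm (P ((1 / norm x) *\<^sub>R x)))\<^sup>2 \<in> D"
      unfolding D_def using x T(3)[OF x x, of "1 / norm x"] False by (intro imageI) auto
    then have "(norm (P ((1 / norm x) *\<^sub>R x)))\<^sup>2 \<le> \<theta>" unfolding \<theta>_def using bdd by (intro cSup_upper) auto
    moreover have "(norm (P ((1 / norm x) *\<^sub>R x)))\<^sup>2 = (norm (P x))\<^sup>2 / (norm x)\<^sup>2" by (simp add: P_simps power_divide)
    ultimately show ?thesis using False by (simp add: pos_divide_le_eq)
  qed (simp add: P_simps)
  have "\<exists>x. x \<noteq> 0 \<and> (\<forall>e\<in>B. x \<bullet> e = 0) \<and> eig (1 / \<theta>) x" if \<theta>p: "\<theta> > 0"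
  proof -
    have "\<exists>x\<in>T. norm x \<le> 1 \<and> \<theta> - 1 / real (Suc k) < (norm (P x))\<^sup>2" for k
    proof -
      have "\<exists>y\<in>D. \<theta> - 1 / real (Suc k) < y" using D0 bdd unfolding \<theta>_def by (subst less_cSup_iff[symmetric]) auto
      then show ?thesis by (auto simp: D_def)
    qed
    then obtain X where X: "\<And>k. X k \<in> T" "\<And>k. norm (X k) \<le> 1" "\<And>k. \<theta> - 1 / real (Suc k) < (norm (P (X k)))\<^sup>2"
      by metis
    obtain r l where r: "strict_mono (r :: nat \<Rightarrow> nat)" and l: "(\<lambda>n. P (X (r n))) \<longlonglongrightarrow> l"
      using compact_subsequence[of X 1] X by (auto simp: T_def)
    define x where "x = (\<lambda>n. X (r n))"
    define d where "d = (\<lambda>n. 1 / real (Suc (r n)))"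
    have d0: "d \<longlonglongrightarrow> 0" using LIMSEQ_subseq_LIMSEQ[OF LIMSEQ_inverse_Suc r] by (simp add: d_def o_def)
    \<comment> \<open>Parallelogram laws before and after \<open>P\<close>, joined by
      \<open>main\<close> at the sum of two members: near-maximality together with Cauchy images
      forces the sequence itself to be Cauchy.\<close>
    have "(norm (x m - x n))\<^sup>2 \<le> 2 / \<theta> * d m + 2 / \<theta> * d n + 1 / \<theta> * (norm (P (x m) - P (x n)))\<^sup>2" for m n
    proof -
      have 1: "(norm (P (x m + x n)))\<^sup>2 \<le> \<theta> * (norm (x m + x n))\<^sup>2" using X(1) T(1) by (intro main) (auto simp: x_def)
      have 2: "(norm (x m + x n))\<^sup>2 + (norm (x m - x n))\<^sup>2 = 2 * (norm (x m))\<^sup>2 + 2 * (norm (x n))\<^sup>2"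
        by (rule norm_parallelogram)
      have 3: "(norm (P (x m + x n)))\<^sup>2 + (norm (P (x m) - P (x n)))\<^sup>2 = 2 * (norm (P (x m)))\<^sup>2 + 2 * (norm (P (x n)))\<^sup>2"
        using norm_parallelogram[of "P (x m)" "P (x n)"] by (simp add: P_simps)
      have 4: "(norm (x m))\<^sup>2 \<le> 1" "(norm (x n))\<^sup>2 \<le> 1" using X(2) by (auto simp: x_def intro!: power_le_one)
      have 5: "\<theta> - d m < (norm (P (x m)))\<^sup>2" "\<theta> - d n < (norm (P (x n)))\<^sup>2" using X(3) by (auto simp: x_def d_def)
      have "\<theta> * (norm (x m - x n))\<^sup>2 = \<theta> * (2 * (norm (x m))\<^sup>2 + 2 * (norm (x n))\<^sup>2) - \<theta> * (norm (x m + x n))\<^sup>2"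
        unfolding 2[symmetric] by (simp add: algebra_simps)
      also have "\<dots> \<le> \<theta> * 4 - (norm (P (x m + x n)))\<^sup>2"
        using 1 4 \<theta>p by (intro diff_mono mult_left_mono) auto
      also have "\<dots> \<le> 2 * d m + 2 * d n + (norm (P (x m) - P (x n)))\<^sup>2" using 3 5 by linarith
      finally show ?thesis using \<theta>p by (simp add: field_simps)
    qed
    moreover have "(\<lambda>n. 2 / \<theta> * d n) \<longlonglongrightarrow> 0" using tendsto_mult_right_zero[OF d0] .
    moreover have "Cauchy (\<lambda>n. P (x n))" using l LIMSEQ_imp_Cauchy by (auto simp: x_def)
    ultimately have "Cauchy x" by (rule Cauchy_norm_square_bound) (use \<theta>p in auto)
    then obtain w where w: "x \<longlonglongrightarrow> w" using Cauchy_convergent_iff convergent_def by blast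
    have wS: "w \<in> S" using S_lim[OF _ w] X by (auto simp: x_def T_def)
    have wB: "w \<bullet> e = 0" if "e \<in> B" for e
    proof -
      have "(\<lambda>n. x n \<bullet> e) \<longlonglongrightarrow> w \<bullet> e" by (intro tendsto_intros w)
      moreover have "(\<lambda>n. x n \<bullet> e) = (\<lambda>n. 0)" using X that by (auto simp: x_def T_def)
      ultimately show ?thesis using LIMSEQ_unique tendsto_const by metis
    qed
    have wT: "w \<in> T" using wS wB by (simp add: T_def)
    have "norm w \<le> 1" by (rule LIMSEQ_le_const2[OF tendsto_norm[OF w]]) (use X in \<open>auto simp: x_def\<close>)
    have lim\<theta>: "(\<lambda>n. \<theta> - d n) \<longlonglongrightarrow> \<theta> - 0" by (intro tendsto_intros d0)
    have "\<theta> - 0 \<le> (norm (P w))\<^sup>2"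
      by (rule LIMSEQ_le[OF lim\<theta> tendsto_power[OF tendsto_norm[OF P_lim[OF w]]]])
         (use X(3) in \<open>auto simp: x_def d_def intro!: less_imp_le\<close>)
    then have ge: "\<theta> * (norm w)\<^sup>2 \<le> (norm (P w))\<^sup>2" 
    proof -
      have "\<theta> * (norm w)\<^sup>2 \<le> \<theta> * 1" using \<open>norm w \<le> 1\<close> \<theta>p by (intro mult_left_mono power_le_one) auto
      then show ?thesis using \<open>\<theta> - 0 \<le> (norm (P w))\<^sup>2\<close> by linarith
    qed
    have "\<theta> > 0 \<Longrightarrow> w \<noteq> 0" using \<open>\<theta> - 0 \<le> (norm (P w))\<^sup>2\<close> by (auto simp: P_simps)
    \<comment> \<open>Equality holds in \<open>main\<close> at \<open>w\<close>, so the nonnegative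
      quadratic in \<open>t\<close> has no linear term.\<close>
    have eqT: "\<theta> * (w \<bullet> y) = P w \<bullet> P y" if y: "y \<in> T" for y
    proof -
      have "0 \<le> t * (2 * (\<theta> * (w \<bullet> y) - P w \<bullet> P y)) + t\<^sup>2 * (\<theta> * (norm y)\<^sup>2 - (norm (P y))\<^sup>2)" for t
      proof -
        have "0 \<le> \<theta> * (norm (w + t *\<^sub>R y))\<^sup>2 - (norm (P (w + t *\<^sub>R y)))\<^sup>2"
          using main[of "w + t *\<^sub>R y"] T wT y by simp
        also have "\<dots> = (\<theta> * (norm w)\<^sup>2 - (norm (P w))\<^sup>2) + (t * (2 * (\<theta> * (w \<bullet> y) - P w \<bullet> P y)) + t\<^sup>2 * (\<theta> * (norm y)\<^sup>2 - (norm (P y))\<^sup>2))"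
          unfolding power2_norm_eq_inner by (simp add: P_simps algebra_simps power2_eq_square inner_commute)
        finally show ?thesis using ge by linarith
      qed
      then show ?thesis using linear_coefficient_zero by fastforce
    qed
    \<comment> \<open>Variations within \<open>T\<close> give the equation on \<open>T\<close> only.
      Both sides vanish on the projection \<open>p\<close> onto the known eigenvectors, which
      extends it to \<open>S\<close>.\<close>
    have "w \<bullet> y = 1 / \<theta> * (P w \<bullet> P y)" if y: "y \<in> S" for y
    proof -
      define p where "p = (\<Sum>b\<in>B. (y \<bullet> b) *\<^sub>R b)"
      have pS: "p \<in> S" unfolding p_def using B(4) by (intro subspace_sum[OF subspace_S] S_intros) (auto simp: eig_def)
      have "y - p \<in> T" using orth_projection_zero[OF B(1-3)] pS y S_intros by (auto simp: T_def p_def)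
      then have 1: "\<theta> * (w \<bullet> (y - p)) = P w \<bullet> P (y - p)" by (rule eqT)
      have "w \<bullet> p = 0" unfolding p_def inner_sum_right using wB by simp
      moreover have "P w \<bullet> P p = 0"
      proof -
        have "P w \<bullet> P b = 0" if "b \<in> B" for b
          using eig_orth[OF B(4)[OF that], of w] wS wB[OF that] by (simp add: inner_commute)
        then show ?thesis unfolding p_def
          by (simp add: linear_sum[OF bounded_linear.linear[OF linear_P]] P_simps inner_sum_right)
      qed
      ultimately show ?thesis using 1 \<theta>p by (simp add: P_simps inner_diff_right field_simps)
    qed
    then show ?thesis using wS wB \<open>\<theta> > 0 \<Longrightarrow> w \<noteq> 0\<close> \<theta>p by (auto simp: eig_def)
  qed
  then show ?thesis using \<theta>0 main by (intro exI[of _ \<theta>]) (auto simp: T_def)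
qed

text \<open>A quantitative saddle point theorem. The one-sided quadratic bound \<open>taylor\<close>
  is all that is asked of \<Phi> and its gradient \<open>M\<close>. The bound \<open>a\<close>
  applies at the end of an orbit and \<open>b\<close> at its start, and monotonicity traps every
  energy in between.\<close>

lemma approximate_critical_point:
  fixes M :: "'f \<Rightarrow> 'f" and \<Phi> :: "'f \<Rightarrow> real" and \<kappa> :: real
  defines "J \<equiv> \<lambda>u. ((norm u)\<^sup>2 - \<kappa> * (norm (P u))\<^sup>2) / 2 + \<Phi> (P u)"
  assumes Mb: "\<And>v. norm (M v) \<le> C" and Lip: "\<And>v w. norm (M v - M w) \<le> L * norm (v - w)"
    and taylor: "\<And>v w. \<Phi> (v + w) \<le> \<Phi> v + M v \<bullet> w + L * (norm w)\<^sup>2" and L: "L \<ge> 0"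
    and \<kappa>: "\<kappa> > 0"
    and B: "finite B" "pairwise orthogonal B" "\<And>e. e \<in> B \<Longrightarrow> norm e = 1" "\<And>e. e \<in> B \<Longrightarrow> eig (\<nu> e) e"
    and \<nu>: "\<And>e. e \<in> B \<Longrightarrow> \<nu> e < \<kappa>"
    and up: "\<And>x. x \<in> span B \<Longrightarrow> J x \<le> b" and low: "\<And>x. x \<in> S \<Longrightarrow> (\<forall>e\<in>B. x \<bullet> e = 0) \<Longrightarrow> a \<le> J x"
    and \<eta>: "\<eta> > 0"
  shows "\<exists>u\<in>S. a \<le> J u \<and> J u \<le> b \<and> norm (u - adj (\<kappa> *\<^sub>R P u - M (P u))) \<le> \<eta>"
proof -
  \<comment> \<open>The gradient of \<open>J\<close> with respect to the inner product of
    \<open>S\<close>, as its pairings in \<open>Gv\<close> show.\<close>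
  define G where "G = (\<lambda>u. u - adj (\<kappa> *\<^sub>R P u - M (P u)))"
  \<comment> \<open>The second order error of a step is at most \<tau>^2 (1/2 + L) times the squared
    gradient norm; this \<tau> makes it exactly half of the first order gain.\<close>
  define \<tau> where "\<tau> = 1 / (1 + 2 * L)"
  have \<tau>: "\<tau> > 0" "\<tau> * (1/2 + L) = 1/2" using L by (auto simp: \<tau>_def field_simps)
  define step where "step = (\<lambda>u. u - \<tau> *\<^sub>R G u)"
  have GS: "G u \<in> S" if "u \<in> S" for u using that adj S_intros by (auto simp: G_def)
  have stepS: "step u \<in> S" if "u \<in> S" for u using that GS S_intros by (auto simp: step_def)
  have iterS: "(step ^^ j) u \<in> S" if "u \<in> S" for u j by (induction j) (use that stepS in auto)
  have Gv: "G u \<bullet> v = u \<bullet> v - \<kappa> * (P u \<bullet> P v) + M (P u) \<bullet> P v" if "v \<in> S" for u v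
    using that by (simp add: G_def inner_diff_left adj)
  have decr: "J (step u) \<le> J u - \<tau> / 2 * (norm (G u))\<^sup>2" if u: "u \<in> S" for u
  proof -
    define g where "g = G u"
    have gS: "g \<in> S" using GS u by (simp add: g_def)
    have gg: "(norm g)\<^sup>2 = u \<bullet> g - \<kappa> * (P u \<bullet> P g) + M (P u) \<bullet> P g"
      using Gv[OF gS, of u] by (simp add: power2_norm_eq_inner g_def)
    have "\<Phi> (P u - \<tau> *\<^sub>R P g) \<le> \<Phi> (P u) - \<tau> * (M (P u) \<bullet> P g) + L * (\<tau>\<^sup>2 * (norm (P g))\<^sup>2)"
      using taylor[of "P u" "- \<tau> *\<^sub>R P g"] by (simp add: power_mult_distrib)
    moreover have "L * (\<tau>\<^sup>2 * (norm (P g))\<^sup>2) \<le> L * (\<tau>\<^sup>2 * (norm g)\<^sup>2)"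
      using L norm_P by (intro mult_left_mono power_mono) auto
    moreover have e1: "(norm (u - \<tau> *\<^sub>R g))\<^sup>2 = (norm u)\<^sup>2 - 2 * \<tau> * (u \<bullet> g) + \<tau>\<^sup>2 * (norm g)\<^sup>2"
      unfolding power2_norm_eq_inner by (simp add: algebra_simps power2_eq_square inner_commute)
    moreover have e2: "(norm (P u - \<tau> *\<^sub>R P g))\<^sup>2 = (norm (P u))\<^sup>2 - 2 * \<tau> * (P u \<bullet> P g) + \<tau>\<^sup>2 * (norm (P g))\<^sup>2"
      unfolding power2_norm_eq_inner by (simp add: algebra_simps power2_eq_square inner_commute)
    \<comment> \<open>The second order part of \<open>- \<kappa> * (norm (P u))\<^sup>2 / 2\<close>
      has the favourable sign and is dropped, so \<tau> does not depend on \<kappa>.\<close>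
    moreover have "\<kappa> * (\<tau>\<^sup>2 * (norm (P g))\<^sup>2) \<ge> 0" using \<kappa> by simp
    ultimately have "J (u - \<tau> *\<^sub>R g) \<le> J u - \<tau> * (u \<bullet> g - \<kappa> * (P u \<bullet> P g) + M (P u) \<bullet> P g) + (\<tau>\<^sup>2 * (norm g)\<^sup>2) / 2 + L * (\<tau>\<^sup>2 * (norm g)\<^sup>2)"
      unfolding J_def P_simps e1 e2 by (simp add: field_simps)
    also have "\<dots> = J u - \<tau> * (norm g)\<^sup>2 + \<tau> * (\<tau> * (1/2 + L)) * (norm g)\<^sup>2"
      unfolding gg[symmetric] by (simp add: algebra_simps power2_eq_square)
    also have "\<dots> = J u - \<tau> / 2 * (norm g)\<^sup>2" unfolding \<tau>(2) by (simp add: algebra_simps)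
    finally show ?thesis by (simp add: step_def g_def)
  qed
  \<comment> \<open>So many steps that an energy loss of \<open>\<tau> / 2 * \<eta>\<^sup>2\<close>
    in each would exceed \<open>b - a\<close>.\<close>
  define n where "n = Suc (nat \<lceil>(b - a) / (\<tau> / 2 * \<eta>\<^sup>2)\<rceil>)"
  have n: "b - a < real n * (\<tau> / 2 * \<eta>\<^sup>2)"
  proof -
    have "(b - a) / (\<tau> / 2 * \<eta>\<^sup>2) < real n" unfolding n_def by linarith
    then show ?thesis using \<tau> \<eta> by (simp add: pos_divide_less_eq)
  qed
  \<comment> \<open>Along an eigenvector the quadratic part of the gradient multiplies by 1 -
    \<kappa>/\<nu> = -\<alpha>, so one step multiplies the coordinate by \<rho> = 1 + \<tau>\<alpha>
    > 1, up to the bounded contribution \<beta> of \<open>M\<close>.\<close>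
  define \<alpha> where "\<alpha> = (\<lambda>e. \<kappa> / \<nu> e - 1)"
  have \<nu>1: "\<nu> e \<ge> 1" if "e \<in> B" for e using eig_eval_ge_1[OF B(4)[OF that]] B(3)[OF that] by fastforce
  have \<alpha>: "\<alpha> e > 0" if "e \<in> B" for e using \<nu>[OF that] \<nu>1[OF that] by (simp add: \<alpha>_def)
  define \<rho> where "\<rho> = (\<lambda>e. 1 + \<tau> * \<alpha> e)"
  have \<rho>: "\<rho> e > 1" if "e \<in> B" for e using \<alpha>[OF that] \<tau> by (simp add: \<rho>_def)
  define \<beta> where "\<beta> = (\<lambda>e u. M (P u) \<bullet> P e)"
  have C0: "C \<ge> 0" using Mb[of 0] norm_ge_zero order_trans by blast
  have \<beta>: "\<bar>\<beta> e u\<bar> \<le> C" if "e \<in> B" for e u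
  proof -
    have "\<bar>\<beta> e u\<bar> \<le> norm (M (P u)) * norm (P e)" unfolding \<beta>_def by (rule Cauchy_Schwarz_ineq2)
    also have "\<dots> \<le> C * 1" using Mb norm_P[of e] B(3)[OF that] C0 by (intro mult_mono) auto
    finally show ?thesis by simp
  qed
  have step_e: "step u \<bullet> e = \<rho> e * (u \<bullet> e) - \<tau> * \<beta> e u" if e: "e \<in> B" and u: "u \<in> S" for e u
  proof -
    have eS: "e \<in> S" and "e \<bullet> u = \<nu> e * (P e \<bullet> P u)" using B(4)[OF e] u by (auto simp: eig_def)
    then have "P u \<bullet> P e = (u \<bullet> e) / \<nu> e" using \<nu>1[OF e] by (simp add: inner_commute)
    then show ?thesis using \<nu>1[OF e] by (simp add: step_def inner_diff_left Gv[OF eS] \<rho>_def \<alpha>_def \<beta>_def algebra_simps)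
  qed
  \<comment> \<open>Discrete variation of constants: with the growth factor pulled out, vanishing of
    the coordinate becomes an equation for the starting value, and later perturbations are
    discounted geometrically.\<close>
  have iter_e: "(step ^^ j) u \<bullet> e = \<rho> e ^ j * (u \<bullet> e - (\<Sum>i<j. \<tau> / \<rho> e ^ Suc i * \<beta> e ((step ^^ i) u)))"
    if e: "e \<in> B" and u: "u \<in> S" for e u j
  proof (induction j)
    case (Suc j)
    have "(step ^^ Suc j) u \<bullet> e = \<rho> e * ((step ^^ j) u \<bullet> e) - \<tau> * \<beta> e ((step ^^ j) u)"
      using step_e[OF e iterS[OF u]] by simp
    also have "\<dots> = \<rho> e ^ Suc j * (u \<bullet> e - (\<Sum>i<j. \<tau> / \<rho> e ^ Suc i * \<beta> e ((step ^^ i) u))) - \<rho> e ^ Suc j * (\<tau> / \<rho> e ^ Suc j * \<beta> e ((step ^^ j) u))"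
      unfolding Suc using \<rho>[OF e] by simp
    finally show ?case by (simp add: algebra_simps)
  qed simp
  \<comment> \<open>The discounts sum to less than 1 / \<alpha> for any number of steps; this bounds
    the Brouwer map independently of \<open>n\<close>.\<close>
  have geom: "\<alpha> e * (\<Sum>i<j. \<tau> / \<rho> e ^ Suc i) = 1 - 1 / \<rho> e ^ j" if e: "e \<in> B" for e j
  proof (induction j)
    case (Suc j)
    have "\<alpha> e * (\<Sum>i<Suc j. \<tau> / \<rho> e ^ Suc i) = 1 - 1 / \<rho> e ^ j + \<alpha> e * \<tau> / \<rho> e ^ Suc j"
      using Suc by (simp add: algebra_simps)
    also have "1 / \<rho> e ^ j = \<rho> e / \<rho> e ^ Suc j" using \<rho>[OF e] by simp
    also have "1 - \<rho> e / \<rho> e ^ Suc j + \<alpha> e * \<tau> / \<rho> e ^ Suc j = 1 - (\<rho> e - \<alpha> e * \<tau>) / \<rho> e ^ Suc j"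
      by (simp add: diff_divide_distrib)
    also have "\<rho> e - \<alpha> e * \<tau> = 1" by (simp add: \<rho>_def)
    finally show ?case .
  qed simp
  define U where "U = (\<lambda>y :: 'e \<Rightarrow> real. \<Sum>e\<in>B. y e *\<^sub>R e)"
  have Uspan: "U y \<in> span B" for y unfolding U_def by (intro span_sum span_scale span_base)
  have BS: "B \<subseteq> S" using B(4) by (auto simp: eig_def)
  have US: "U y \<in> S" for y using Uspan span_minimal[OF BS subspace_S] by blast
  have Ue: "U y \<bullet> e = y e" if "e \<in> B" for y e
  proof -
    have "(\<Sum>b\<in>B. y b * (b \<bullet> e)) = (\<Sum>b\<in>B. if b = e then y e else 0)"
      using B that by (intro sum.cong) (auto simp: pairwise_def orthogonal_def norm_eq_1)
    then show ?thesis using B(1) that by (simp add: U_def inner_sum_left)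
  qed
  \<comment> \<open>A fixed point of \<open>T\<close> makes the bracket in \<open>iter_e\<close>
    vanish at step \<open>n\<close>: the orbit started at \<open>U y\<close> ends orthogonal to
    \<open>B\<close>.\<close>
  define T where "T = (\<lambda>y e. \<Sum>i<n. \<tau> / \<rho> e ^ Suc i * \<beta> e ((step ^^ i) (U y)))"
  \<comment> \<open>Dominates every \<open>C / \<alpha> e\<close>; the added 1 keeps the cube
    nondegenerate when \<open>B\<close> is empty.\<close>
  define R where "R = (\<Sum>e\<in>B. C / \<alpha> e) + 1"
  have nn: "0 \<le> C / \<alpha> e" if "e \<in> B" for e using C0 \<alpha>[OF that] by simp
  have R: "C / \<alpha> e \<le> R" if "e \<in> B" for e
  proof -
    have "C / \<alpha> e \<le> (\<Sum>e\<in>B. C / \<alpha> e)" using that B(1) nn by (intro member_le_sum) auto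
    then show ?thesis by (simp add: R_def)
  qed
  have R0: "R > 0" unfolding R_def using nn by (intro add_nonneg_pos sum_nonneg) auto
  have contM: "continuous_on UNIV M"
    by (rule lipschitz_on_continuous_on[of L]) (use Lip L in \<open>auto simp: lipschitz_on_def dist_norm\<close>)
  have contP: "continuous_on UNIV P" using linear_P by (rule linear_continuous_on)
  have conta: "continuous_on UNIV adj" using bounded_linear_adj by (rule linear_continuous_on)
  have contMP: "continuous_on UNIV (\<lambda>u. M (P u))" by (rule continuous_on_compose2[OF contM contP]) auto
  have contstep: "continuous_on UNIV step" unfolding step_def G_def
    by (intro continuous_intros continuous_on_compose2[OF conta] contP contMP) auto
  have contiter: "continuous_on UNIV (step ^^ i)" for i
  proof (induction i)
    case (Suc i)
    show ?case using continuous_on_compose2[OF contstep Suc] by (simp add: o_def)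
  qed (simp add: id_def)
  have cont\<beta>: "continuous_on UNIV (\<lambda>u. \<beta> e ((step ^^ i) u))" for e i
    unfolding \<beta>_def by (intro continuous_intros continuous_on_compose2[OF contMP contiter]) auto
  have "\<exists>y. \<forall>e\<in>B. \<bar>y e\<bar> \<le> R \<and> T y e = y e"
  proof (rule brouwer_cube[OF B(1) R0])
    fix y e assume e: "e \<in> B"
    have "\<bar>T y e\<bar> \<le> (\<Sum>i<n. \<bar>\<tau> / \<rho> e ^ Suc i * \<beta> e ((step ^^ i) (U y))\<bar>)" unfolding T_def by (rule sum_abs)
    also have "\<dots> \<le> (\<Sum>i<n. \<tau> / \<rho> e ^ Suc i * C)"
      using \<beta>[OF e] \<tau> \<rho>[OF e] by (intro sum_mono) (auto simp: abs_mult intro!: divide_right_mono mult_left_mono)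
    also have "\<dots> = (1 - 1 / \<rho> e ^ n) / \<alpha> e * C"
      unfolding sum_distrib_right[symmetric] geom[OF e, of n, symmetric] using \<alpha>[OF e] by simp
    also have "\<dots> \<le> 1 / \<alpha> e * C" using \<rho>[OF e] \<alpha>[OF e] C0 by (intro mult_right_mono divide_right_mono) auto
    also have "\<dots> \<le> R" using R[OF e] by simp
    finally show "\<bar>T y e\<bar> \<le> R" .
  next
    fix X :: "nat \<Rightarrow> 'e \<Rightarrow> real" and y e assume lim: "\<forall>e\<in>B. (\<lambda>n. X n e) \<longlonglongrightarrow> y e" and "e \<in> B"
    have "(\<lambda>n. U (X n)) \<longlonglongrightarrow> U y" unfolding U_def using lim by (intro tendsto_intros) auto
    then have "(\<lambda>n. \<beta> e ((step ^^ i) (U (X n)))) \<longlonglongrightarrow> \<beta> e ((step ^^ i) (U y))" for i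
      using cont\<beta>[of e i] by (intro continuous_on_tendsto_compose[OF cont\<beta>]) auto
    then show "(\<lambda>n. T (X n) e) \<longlonglongrightarrow> T y e" unfolding T_def by (intro tendsto_intros) auto
  qed
  then obtain y where y: "\<And>e. e \<in> B \<Longrightarrow> T y e = y e" by blast
  define u where "u = (\<lambda>j. (step ^^ j) (U y))"
  have uS: "u j \<in> S" for j unfolding u_def using iterS US by blast
  have "u n \<bullet> e = 0" if "e \<in> B" for e
    using iter_e[OF that US, of n y] y[OF that] Ue[OF that, of y] by (simp add: u_def T_def)
  then have Jn: "a \<le> J (u n)" using low uS by blast
  have J0: "J (u 0) \<le> b" using up Uspan by (simp add: u_def)
  have Jdec: "J (u (Suc j)) \<le> J (u j) - \<tau> / 2 * (norm (G (u j)))\<^sup>2" for j using decr[OF uS] by (simp add: u_def)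
  have "J (u (Suc j)) \<le> J (u j)" for j
  proof -
    have "0 \<le> \<tau> / 2 * (norm (G (u j)))\<^sup>2" using \<tau>(1) by simp
    then show ?thesis using Jdec[of j] by linarith
  qed
  then have anti: "antimono (\<lambda>j. J (u j))" by (rule decseq_SucI)
  have "\<exists>j<n. norm (G (u j)) \<le> \<eta>"
  proof (rule ccontr)
    assume "\<not> (\<exists>j<n. norm (G (u j)) \<le> \<eta>)"
    then have big: "\<eta> < norm (G (u j))" if "j < n" for j using that by auto
    have "J (u j) \<le> J (u 0) - real j * (\<tau> / 2 * \<eta>\<^sup>2)" if "j \<le> n" for j
      using that
    proof (induction j)
      case (Suc j)
      have "\<eta>\<^sup>2 \<le> (norm (G (u j)))\<^sup>2" using big[of j] Suc.prems \<eta> by (intro power_mono) auto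
      then have "\<tau> / 2 * \<eta>\<^sup>2 \<le> \<tau> / 2 * (norm (G (u j)))\<^sup>2" using \<tau> by (intro mult_left_mono) auto
      then show ?case using Jdec[of j] Suc by (simp add: distrib_right add_divide_distrib)
    qed simp
    from this[of n] show False using n Jn J0 by simp
  qed
  then obtain j where j: "j < n" "norm (G (u j)) \<le> \<eta>" by blast
  have "J (u n) \<le> J (u j)" "J (u j) \<le> J (u 0)" using anti j(1) by (auto simp: antimono_def)
  then show ?thesis using j uS Jn J0 by (intro bexI[of _ "u j"]) (auto simp: G_def)
qed

end

lemma finite_positive_lower_bound:
  fixes h :: "'a \<Rightarrow> real"
  assumes "finite A" "\<And>a. a \<in> A \<Longrightarrow> h a > 0"
  shows "\<exists>\<delta>>0. \<forall>a\<in>A. \<delta> \<le> h a"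
proof -
  have "Min (insert 1 (h ` A)) > 0" using assms by (subst Min_gr_iff) auto
  moreover have "Min (insert 1 (h ` A)) \<le> h a" if "a \<in> A" for a using assms that by (intro Min_le) auto
  ultimately show ?thesis by blast
qed

text \<open>Completing the square. It trades linear growth of a potential against a quadratic gap
  \<open>d\<close>, at the price of a constant of order 1 / d.\<close>

lemma quadratic_upper_bound:
  fixes d b r :: real
  assumes "d > 0"
  shows "b * r - d / 2 * r\<^sup>2 \<le> b\<^sup>2 / (2 * d)"
proof -
  have "0 \<le> (d * r - b)\<^sup>2 / (2 * d)" using assms by simp
  also have "\<dots> = b\<^sup>2 / (2 * d) - (b * r - d / 2 * r\<^sup>2)"
    using assms by (simp add: power2_eq_square field_simps)
  finally show ?thesis by simp
qed

section \<open>Spectral gaps around the resonant value\<close>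

context compact_embedding begin

text \<open>Expansion in the basis; the eigenvalue equation replaces each product under
  \<open>P\<close> by the coordinate divided by \<nu>.\<close>

lemma span_eig_norms:
  assumes B: "finite B" "pairwise orthogonal B" "\<And>e. e \<in> B \<Longrightarrow> norm e = 1" "\<And>e. e \<in> B \<Longrightarrow> eig (\<nu> e) e"
    and x: "x \<in> span B"
  shows "(norm x)\<^sup>2 = (\<Sum>e\<in>B. (x \<bullet> e)\<^sup>2)" "(norm (P x))\<^sup>2 = (\<Sum>e\<in>B. (x \<bullet> e)\<^sup>2 / \<nu> e)" "x \<in> S"
proof -
  have BS: "B \<subseteq> S" using B(4) by (auto simp: eig_def)
  show xS: "x \<in> S" using x span_minimal[OF BS subspace_S] by blast
  have ex: "(\<Sum>e\<in>B. (x \<bullet> e) *\<^sub>R e) = x" using B x by (intro orthonormal_basis_expand) auto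
  have "(norm x)\<^sup>2 = x \<bullet> (\<Sum>e\<in>B. (x \<bullet> e) *\<^sub>R e)" using ex by (simp add: power2_norm_eq_inner)
  then show "(norm x)\<^sup>2 = (\<Sum>e\<in>B. (x \<bullet> e)\<^sup>2)" by (simp add: inner_sum_right power2_eq_square)
  have "(norm (P x))\<^sup>2 = P x \<bullet> P (\<Sum>e\<in>B. (x \<bullet> e) *\<^sub>R e)" using ex by (simp add: power2_norm_eq_inner)
  also have "\<dots> = (\<Sum>e\<in>B. (x \<bullet> e) * (P x \<bullet> P e))"
    by (simp add: linear_sum[OF bounded_linear.linear[OF linear_P]] P_simps inner_sum_right)
  also have "\<dots> = (\<Sum>e\<in>B. (x \<bullet> e)\<^sup>2 / \<nu> e)"
  proof (rule sum.cong)
    fix e assume e: "e \<in> B"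
    then have "e \<bullet> x = \<nu> e * (P e \<bullet> P x)" "\<nu> e \<ge> 1"
      using B(3)[OF e] B(4)[OF e] xS eig_eval_ge_1[OF B(4)[OF e]] by (fastforce simp: eig_def)+
    then show "(x \<bullet> e) * (P x \<bullet> P e) = (x \<bullet> e)\<^sup>2 / \<nu> e"
      by (simp add: inner_commute power2_eq_square)
  qed simp
  finally show "(norm (P x))\<^sup>2 = (\<Sum>e\<in>B. (x \<bullet> e)\<^sup>2 / \<nu> e)" .
qed

text \<open>\<open>complete\<close> says that \<open>B\<close> catches every eigenvector of value up
  to \<kappa>. The strict estimates leave out the value \<kappa> itself and have a margin \<delta>;
  the two weak ones include it and serve the side to which a shift of \<kappa> assigns the resonant
  eigenspace. The bound of \<delta> by \<kappa> keeps shifted values positive.\<close>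

lemma spectral_gap:
  assumes B: "finite B" "pairwise orthogonal B" "\<And>e. e \<in> B \<Longrightarrow> norm e = 1" "\<And>e. e \<in> B \<Longrightarrow> eig (\<nu> e) e"
    and \<kappa>: "\<kappa> > 0" "\<And>e. e \<in> B \<Longrightarrow> \<nu> e \<le> \<kappa>"
    and complete: "\<And>\<mu> x. \<mu> \<le> \<kappa> \<Longrightarrow> eig \<mu> x \<Longrightarrow> (\<forall>e\<in>B. x \<bullet> e = 0) \<Longrightarrow> x = 0"
  shows "\<exists>\<delta>>0. \<delta> \<le> \<kappa> \<and> (\<forall>x\<in>span {e\<in>B. \<nu> e < \<kappa>}. (1 + \<delta>) * (norm x)\<^sup>2 \<le> \<kappa> * (norm (P x))\<^sup>2) \<and>
      (\<forall>x\<in>S. (\<forall>e\<in>B. x \<bullet> e = 0) \<longrightarrow> \<kappa> * (norm (P x))\<^sup>2 \<le> (1 - \<delta>) * (norm x)\<^sup>2)"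
    and "\<And>x. x \<in> S \<Longrightarrow> (\<forall>e\<in>{e\<in>B. \<nu> e < \<kappa>}. x \<bullet> e = 0) \<Longrightarrow> \<kappa> * (norm (P x))\<^sup>2 \<le> (norm x)\<^sup>2"
    and "\<And>x. x \<in> span B \<Longrightarrow> (norm x)\<^sup>2 \<le> \<kappa> * (norm (P x))\<^sup>2"
proof -
  have \<nu>1: "\<nu> e \<ge> 1" if "e \<in> B" for e using eig_eval_ge_1[OF B(4)[OF that]] B(3)[OF that] by fastforce
  define B' where "B' = {e\<in>B. \<nu> e < \<kappa>}"
  have B': "finite B'" "pairwise orthogonal B'" "\<And>e. e \<in> B' \<Longrightarrow> norm e = 1" "\<And>e. e \<in> B' \<Longrightarrow> eig (\<nu> e) e"
    using B by (auto simp: B'_def pairwise_def)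
  have "\<exists>\<delta>>0. \<forall>e\<in>B'. \<delta> \<le> \<kappa> / \<nu> e - 1"
    using B'(1) \<nu>1 by (intro finite_positive_lower_bound) (fastforce simp: B'_def)+
  then obtain \<delta>1 where \<delta>1: "\<delta>1 > 0" "\<And>e. e \<in> B' \<Longrightarrow> 1 + \<delta>1 \<le> \<kappa> / \<nu> e" by fastforce
  have gap1: "(1 + \<delta>1) * (norm x)\<^sup>2 \<le> \<kappa> * (norm (P x))\<^sup>2" if "x \<in> span B'" for x
  proof -
    have "(1 + \<delta>1) * (x \<bullet> e)\<^sup>2 \<le> \<kappa> * ((x \<bullet> e)\<^sup>2 / \<nu> e)" if "e \<in> B'" for e
      using mult_right_mono[OF \<delta>1(2)[OF that], of "(x \<bullet> e)\<^sup>2"] by simp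
    moreover have "(norm x)\<^sup>2 = (\<Sum>e\<in>B'. (x \<bullet> e)\<^sup>2)" "(norm (P x))\<^sup>2 = (\<Sum>e\<in>B'. (x \<bullet> e)\<^sup>2 / \<nu> e)"
      using span_eig_norms(1,2)[where \<nu> = \<nu>, OF B' that] by blast+
    ultimately show ?thesis by (simp only: sum_distrib_left) (intro sum_mono, simp)
  qed
  show "(norm x)\<^sup>2 \<le> \<kappa> * (norm (P x))\<^sup>2" if "x \<in> span B" for x
  proof -
    have "(x \<bullet> e)\<^sup>2 \<le> \<kappa> * ((x \<bullet> e)\<^sup>2 / \<nu> e)" if "e \<in> B" for e
    proof -
      have "1 \<le> \<kappa> / \<nu> e" using \<nu>1[OF that] \<kappa>(2)[OF that] by simp
      from mult_right_mono[OF this, of "(x \<bullet> e)\<^sup>2"] show ?thesis by simp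
    qed
    moreover have "(norm x)\<^sup>2 = (\<Sum>e\<in>B. (x \<bullet> e)\<^sup>2)" "(norm (P x))\<^sup>2 = (\<Sum>e\<in>B. (x \<bullet> e)\<^sup>2 / \<nu> e)"
      using span_eig_norms(1,2)[where \<nu> = \<nu>, OF B that] by blast+
    ultimately show ?thesis by (simp only: sum_distrib_left) (intro sum_mono, simp)
  qed
  obtain \<theta> where \<theta>: "\<theta> \<ge> 0" "\<And>x. x \<in> S \<Longrightarrow> (\<forall>e\<in>B. x \<bullet> e = 0) \<Longrightarrow> (norm (P x))\<^sup>2 \<le> \<theta> * (norm x)\<^sup>2"
    "\<theta> > 0 \<Longrightarrow> (\<exists>x. x \<noteq> 0 \<and> (\<forall>e\<in>B. x \<bullet> e = 0) \<and> eig (1 / \<theta>) x)"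
    using rayleigh_max[OF B] by blast
  have lt: "\<kappa> * \<theta> < 1"
  proof (cases "\<theta> > 0")
    case True
    \<comment> \<open>Otherwise \<open>rayleigh_max\<close> would yield a nonzero eigenvector of
      value at most \<kappa> orthogonal to \<open>B\<close>.\<close>
    then have "\<kappa> < 1 / \<theta>" using \<theta>(3) complete[of "1 / \<theta>"] by force
    then show ?thesis using True by (simp add: pos_less_divide_eq)
  qed (use \<theta>(1) in auto)
  obtain \<theta>' where \<theta>': "\<theta>' \<ge> 0" "\<And>x. x \<in> S \<Longrightarrow> (\<forall>e\<in>B'. x \<bullet> e = 0) \<Longrightarrow> (norm (P x))\<^sup>2 \<le> \<theta>' * (norm x)\<^sup>2"
    "\<theta>' > 0 \<Longrightarrow> (\<exists>x. x \<noteq> 0 \<and> (\<forall>e\<in>B'. x \<bullet> e = 0) \<and> eig (1 / \<theta>') x)"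
    using rayleigh_max[OF B'] by blast
  have le: "\<kappa> * \<theta>' \<le> 1"
  proof (rule ccontr)
    assume ass: "\<not> \<kappa> * \<theta>' \<le> 1"
    then have \<theta>p: "\<theta>' > 0" using \<theta>'(1) \<kappa>(1) by (cases "\<theta>' = 0") auto
    then have \<mu>: "1 / \<theta>' < \<kappa>" using ass by (simp add: pos_divide_less_eq)
    obtain x where x: "x \<noteq> 0" "\<forall>e\<in>B'. x \<bullet> e = 0" "eig (1 / \<theta>') x" using \<theta>'(3) \<theta>p by blast
    \<comment> \<open>The members of \<open>B\<close> outside \<open>B'\<close> have value at least
      \<kappa>, which differs from 1 / \<theta>'. Distinct values give orthogonality, so
      \<open>x\<close> would be an eigenvector that \<open>B\<close> misses.\<close>
    have "x \<bullet> e = 0" if e: "e \<in> B" for e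
    proof (cases "e \<in> B'")
      case False
      then have ne: "\<nu> e \<noteq> 1 / \<theta>'" using e \<mu> by (auto simp: B'_def)
      have "x \<bullet> e = 1 / \<theta>' * (P x \<bullet> P e)" "e \<bullet> x = \<nu> e * (P e \<bullet> P x)"
        using x(3) B(4)[OF e] unfolding eig_def by blast+
      then have "(\<nu> e - 1 / \<theta>') * (P x \<bullet> P e) = 0" by (simp add: inner_commute algebra_simps)
      then have "P x \<bullet> P e = 0" using ne by simp
      then show ?thesis using \<open>x \<bullet> e = 1 / \<theta>' * (P x \<bullet> P e)\<close> by simp
    qed (use x in auto)
    then show False using complete[of "1 / \<theta>'" x] x \<mu> by auto
  qed
  show "\<kappa> * (norm (P x))\<^sup>2 \<le> (norm x)\<^sup>2" if "x \<in> S" "\<forall>e\<in>{e\<in>B. \<nu> e < \<kappa>}. x \<bullet> e = 0" for x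
  proof -
    have "\<kappa> * (norm (P x))\<^sup>2 \<le> \<kappa> * (\<theta>' * (norm x)\<^sup>2)" using \<theta>'(2)[of x] that \<kappa> by (intro mult_left_mono) (auto simp: B'_def)
    also have "\<dots> \<le> 1 * (norm x)\<^sup>2" using le by (subst mult.assoc[symmetric]) (intro mult_right_mono, auto)
    finally show ?thesis by simp
  qed
  define \<delta> where "\<delta> = min \<kappa> (min \<delta>1 (1 - \<kappa> * \<theta>))"
  have \<delta>: "\<delta> > 0" "\<delta> \<le> \<kappa>" "\<delta> \<le> \<delta>1" "\<delta> \<le> 1 - \<kappa> * \<theta>" using \<kappa> \<delta>1 lt by (auto simp: \<delta>_def)
  have "\<kappa> * (norm (P x))\<^sup>2 \<le> (1 - \<delta>) * (norm x)\<^sup>2" if "x \<in> S" "\<forall>e\<in>B. x \<bullet> e = 0" for x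
  proof -
    have "\<kappa> * (norm (P x))\<^sup>2 \<le> \<kappa> * (\<theta> * (norm x)\<^sup>2)" using \<theta>(2)[of x] that \<kappa> by (intro mult_left_mono) auto
    also have "\<dots> \<le> (1 - \<delta>) * (norm x)\<^sup>2" using \<delta> by (subst mult.assoc[symmetric]) (intro mult_right_mono, auto)
    finally show ?thesis .
  qed
  moreover have "(1 + \<delta>) * (norm x)\<^sup>2 \<le> \<kappa> * (norm (P x))\<^sup>2" if "x \<in> span B'" for x
  proof -
    have "(1 + \<delta>) * (norm x)\<^sup>2 \<le> (1 + \<delta>1) * (norm x)\<^sup>2" using \<delta>(3) by (intro mult_right_mono) auto
    then show ?thesis using gap1[OF that] by (rule order_trans)
  qed
  ultimately show "\<exists>\<delta>>0. \<delta> \<le> \<kappa> \<and> (\<forall>x\<in>span {e\<in>B. \<nu> e < \<kappa>}. (1 + \<delta>) * (norm x)\<^sup>2 \<le> \<kappa> * (norm (P x))\<^sup>2) \<and>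
      (\<forall>x\<in>S. (\<forall>e\<in>B. x \<bullet> e = 0) \<longrightarrow> \<kappa> * (norm (P x))\<^sup>2 \<le> (1 - \<delta>) * (norm x)\<^sup>2)"
    using \<delta> by (auto simp: B'_def)
qed

end

section \<open>Splitting along the resonant eigenspace and the abstract existence theorem\<close>

context compact_embedding begin

lemma subspace_eig: "subspace {x. eig \<kappa> x}"
  using S_intros by (auto simp: subspace_def eig_def inner_add_left P_simps algebra_simps)

lemma eig_norm: "eig \<kappa> x \<Longrightarrow> (norm x)\<^sup>2 = \<kappa> * (norm (P x))\<^sup>2"
  by (simp add: eig_def power2_norm_eq_inner)

lemma eig_lim:
  assumes eX: "\<And>n. eig \<kappa> (X n)" and lim: "X \<longlonglongrightarrow> x"
  shows "eig \<kappa> x"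
proof -
  have "x \<bullet> y = \<kappa> * (P x \<bullet> P y)" if y: "y \<in> S" for y
  proof (rule LIMSEQ_unique)
    show "(\<lambda>n. X n \<bullet> y) \<longlonglongrightarrow> x \<bullet> y" by (intro tendsto_intros lim)
    have "(\<lambda>n. X n \<bullet> y) = (\<lambda>n. \<kappa> * (P (X n) \<bullet> P y))" using eX y by (auto simp: eig_def)
    then show "(\<lambda>n. X n \<bullet> y) \<longlonglongrightarrow> \<kappa> * (P x \<bullet> P y)" by (simp only:) (intro tendsto_intros P_lim lim)
  qed
  moreover have "x \<in> S" using S_lim[OF _ lim] eX by (auto simp: eig_def)
  ultimately show ?thesis by (simp add: eig_def)
qed

lemma span_eig_orth:
  assumes "\<And>e. e \<in> B \<Longrightarrow> eig (\<nu> e) e" "x \<in> span B" "y \<in> S" "\<And>e. e \<in> B \<Longrightarrow> y \<bullet> e = 0"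
  shows "x \<bullet> y = 0 \<and> P x \<bullet> P y = 0"
proof -
  have "subspace {x. x \<bullet> y = 0 \<and> P x \<bullet> P y = 0}"
    by (auto simp: subspace_def inner_add_left P_simps)
  moreover have "B \<subseteq> {x. x \<bullet> y = 0 \<and> P x \<bullet> P y = 0}"
    using eig_orth[OF assms(1) _ assms(3)] assms(4) by (auto simp: inner_commute)
  ultimately show ?thesis using span_minimal assms(2) by blast
qed

text \<open>The pieces are orthogonal for both inner products, so every quadratic form built from
  the two decouples; under the gap estimates the form at \<kappa> is negative on \<open>a\<close>,
  zero on \<open>z\<close> and positive on \<open>c\<close>.\<close>

lemma eigen_splitting:
  assumes B: "finite B" "pairwise orthogonal B" "\<And>e. e \<in> B \<Longrightarrow> norm e = 1" "\<And>e. e \<in> B \<Longrightarrow> eig (\<nu> e) e"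
    and \<kappa>: "\<And>e. e \<in> B \<Longrightarrow> \<nu> e \<le> \<kappa>" and u: "u \<in> S"
  obtains a z c where "u = a + z + c" "a \<in> S" "a \<in> span {e\<in>B. \<nu> e < \<kappa>}" "eig \<kappa> z" "c \<in> S" "\<forall>e\<in>B. c \<bullet> e = 0"
    "a \<bullet> z = 0" "P a \<bullet> P z = 0" "a \<bullet> c = 0" "P a \<bullet> P c = 0" "z \<bullet> c = 0" "P z \<bullet> P c = 0"
proof -
  define B1 where "B1 = {e\<in>B. \<nu> e < \<kappa>}"
  define B2 where "B2 = {e\<in>B. \<nu> e = \<kappa>}"
  have BB: "B = B1 \<union> B2" "B1 \<inter> B2 = {}" "finite B1" "finite B2" using B(1) \<kappa> by (auto simp: B1_def B2_def order_le_less)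
  define a where "a = (\<Sum>e\<in>B1. (u \<bullet> e) *\<^sub>R e)"
  define z where "z = (\<Sum>e\<in>B2. (u \<bullet> e) *\<^sub>R e)"
  define c where "c = u - (\<Sum>e\<in>B. (u \<bullet> e) *\<^sub>R e)"
  have BS: "B \<subseteq> S" using B(4) by (auto simp: eig_def)
  have sum: "(\<Sum>e\<in>B. (u \<bullet> e) *\<^sub>R e) = a + z" unfolding a_def z_def BB(1) by (rule sum.union_disjoint) (use BB in auto)
  have aspan: "a \<in> span B1" and zspan: "z \<in> span B2" unfolding a_def z_def by (intro span_sum span_scale span_base; simp)+
  have aS: "a \<in> S" and zS: "z \<in> S" unfolding a_def z_def using BS BB(1) by (auto intro!: subspace_sum[OF subspace_S] S_intros)
  have cS: "c \<in> S" unfolding c_def sum using u aS zS S_intros by auto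
  have c0: "c \<bullet> e = 0" if "e \<in> B" for e unfolding c_def using orth_projection_zero[OF B(1-3) that] by blast
  have e1: "eig (\<nu> e) e" if "e \<in> B1" for e using B(4) that by (auto simp: B1_def)
  have e2: "eig (\<nu> e) e" if "e \<in> B2" for e using B(4) that by (auto simp: B2_def)
  have "z \<bullet> e = 0" if "e \<in> B1" for e
  proof -
    have "b \<bullet> e = 0" if "b \<in> B2" for b
    proof -
      have "b \<in> B" "e \<in> B" "b \<noteq> e" using that \<open>e \<in> B1\<close> by (auto simp: B1_def B2_def)
      then show ?thesis using B(2) by (simp add: pairwise_def orthogonal_def)
    qed
    then show ?thesis by (simp add: z_def inner_sum_left)
  qed
  then have az: "a \<bullet> z = 0 \<and> P a \<bullet> P z = 0" using e1 aspan zS by (intro span_eig_orth[of B1 \<nu>])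
  have ac: "a \<bullet> c = 0 \<and> P a \<bullet> P c = 0" using e1 aspan cS c0 by (intro span_eig_orth[of B1 \<nu>]) (auto simp: B1_def)
  have zc: "z \<bullet> c = 0 \<and> P z \<bullet> P c = 0" using e2 zspan cS c0 by (intro span_eig_orth[of B2 \<nu>]) (auto simp: B2_def)
  have "B2 \<subseteq> {x. eig \<kappa> x}" using B(4) by (auto simp: B2_def)
  then have ez: "eig \<kappa> z" using span_minimal[OF _ subspace_eig] zspan by blast
  have uu: "u = a + z + c" by (simp add: c_def sum)
  show thesis
    by (rule that[OF uu aS aspan[unfolded B1_def] ez cS]) (simp_all add: az ac zc c0)
qed

text \<open>\<open>Nj j\<close> and \<open>\<Gamma>j j\<close> are the regularised nonlinearity and
  its potential. The bounds \<open>C\<close> are uniform in \<open>j\<close>, while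
  \<open>L j\<close> may grow, as it enters only the descent at fixed \<open>j\<close>.
  \<open>conv\<close> grants a subsequence only, because L2 convergence yields pointwise convergence
  almost everywhere only along one. The sign \<open>s\<close> merges the two solvability
  conditions.\<close>

theorem resonance_solvable:
  fixes N :: "'f \<Rightarrow> 'f" and Nj :: "nat \<Rightarrow> 'f \<Rightarrow> 'f" and \<Gamma> :: "'f \<Rightarrow> real" and \<Gamma>j :: "nat \<Rightarrow> 'f \<Rightarrow> real" and s :: real
  assumes B: "finite B" "pairwise orthogonal B" "\<And>e. e \<in> B \<Longrightarrow> norm e = 1" "\<And>e. e \<in> B \<Longrightarrow> eig (\<nu> e) e"
    and \<kappa>: "\<kappa> > 0" "\<And>e. e \<in> B \<Longrightarrow> \<nu> e \<le> \<kappa>"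
    and complete: "\<And>\<mu> x. \<mu> \<le> \<kappa> \<Longrightarrow> eig \<mu> x \<Longrightarrow> (\<forall>e\<in>B. x \<bullet> e = 0) \<Longrightarrow> x = 0"
    and Nb: "\<And>j v. norm (Nj j v) \<le> C"
    and Lip: "\<And>j v w. norm (Nj j v - Nj j w) \<le> L j * norm (v - w)" and L: "\<And>j. L j \<ge> 0"
    and taylor: "\<And>j v w. \<Gamma>j j (v + w) \<le> \<Gamma>j j v + Nj j v \<bullet> w + L j * (norm w)\<^sup>2"
    and close: "\<And>j v. \<bar>\<Gamma>j j v - \<Gamma> v\<bar> \<le> C" and growth: "\<And>v. \<bar>\<Gamma> v\<bar> \<le> C * norm v"
    and conv: "\<And>X v r. strict_mono (r :: nat \<Rightarrow> nat) \<Longrightarrow> X \<longlonglongrightarrow> v \<Longrightarrow>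
      \<exists>q. strict_mono (q :: nat \<Rightarrow> nat) \<and> (\<lambda>j. Nj (r (q j)) (X (q j))) \<longlonglongrightarrow> N v"
    and Fbar: "\<And>z. eig \<kappa> z \<Longrightarrow> (F - Fbar) \<bullet> P z = 0"
    and s: "s = 1 \<or> s = -1"
    and SC: "\<And>X z. (\<And>n. X n \<in> S) \<Longrightarrow> filterlim (\<lambda>n. norm (P (X n))) at_top sequentially \<Longrightarrow> eig \<kappa> z \<Longrightarrow>
      (\<lambda>n. (1 / norm (P (X n))) *\<^sub>R P (X n)) \<longlonglongrightarrow> P z \<Longrightarrow>
      filterlim (\<lambda>n. s * (\<Gamma> (P (X n)) - Fbar \<bullet> P (X n))) at_top sequentially"
  shows "\<exists>u\<in>S. \<forall>v\<in>S. u \<bullet> v - \<kappa> * (P u \<bullet> P v) + N (P u) \<bullet> P v = F \<bullet> P v"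
proof -
  obtain \<delta> where \<delta>: "\<delta> > 0" "\<delta> \<le> \<kappa>"
    and gapm: "\<And>x. x \<in> span {e\<in>B. \<nu> e < \<kappa>} \<Longrightarrow> (1 + \<delta>) * (norm x)\<^sup>2 \<le> \<kappa> * (norm (P x))\<^sup>2"
    and gapp: "\<And>x. x \<in> S \<Longrightarrow> (\<forall>e\<in>B. x \<bullet> e = 0) \<Longrightarrow> \<kappa> * (norm (P x))\<^sup>2 \<le> (1 - \<delta>) * (norm x)\<^sup>2"
  proof -
    have "\<exists>\<delta>>0. \<delta> \<le> \<kappa> \<and> (\<forall>x\<in>span {e\<in>B. \<nu> e < \<kappa>}. (1 + \<delta>) * (norm x)\<^sup>2 \<le> \<kappa> * (norm (P x))\<^sup>2) \<and>
      (\<forall>x\<in>S. (\<forall>e\<in>B. x \<bullet> e = 0) \<longrightarrow> \<kappa> * (norm (P x))\<^sup>2 \<le> (1 - \<delta>) * (norm x)\<^sup>2)"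
      by (rule spectral_gap(1)) (fact B \<kappa> complete)+
    then show thesis using that by blast
  qed
  have gap0p: "\<kappa> * (norm (P x))\<^sup>2 \<le> (norm x)\<^sup>2" if "x \<in> S" "\<forall>e\<in>{e\<in>B. \<nu> e < \<kappa>}. x \<bullet> e = 0" for x
    by (rule spectral_gap(2)[where B = B and \<nu> = \<nu>]) (fact B \<kappa> complete that)+
  have gap0m: "(norm x)\<^sup>2 \<le> \<kappa> * (norm (P x))\<^sup>2" if "x \<in> span B" for x
    by (rule spectral_gap(3)[where B = B and \<nu> = \<nu>]) (fact B \<kappa> complete that)+
  \<comment> \<open>At most \<delta> / 2, so that half of each strict gap survives the shift;
    positive, so that the resonant eigenspace acquires a small gap of its own.\<close>
  define t where "t = (\<lambda>j. \<delta> / 2 * (1 / real (Suc j)))"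
  have t: "t j > 0" "t j \<le> \<delta> / 2" for j
    using \<delta> mult_left_mono[of "1 / real (Suc j)" 1 "\<delta> / 2"] by (auto simp: t_def)
  have t0: "t \<longlonglongrightarrow> 0" unfolding t_def using tendsto_mult_right_zero[OF LIMSEQ_inverse_Suc] .
  \<comment> \<open>For \<open>s = 1\<close> the value is lowered and the resonant eigenspace joins
    the part where the form is positive; for \<open>s = -1\<close> it is raised and the eigenspace
    joins the negative part.\<close>
  define k where "k = (\<lambda>j. \<kappa> - s * t j)"
  have kk: "\<bar>k j - \<kappa>\<bar> \<le> \<delta> / 2" for j using t[of j] s by (auto simp: k_def)
  have kpos: "k j > 0" "k j \<le> 2 * \<kappa>" for j using kk[of j] \<delta> by linarith+
  have kP: "\<bar>k j * (norm (P x))\<^sup>2 - \<kappa> * (norm (P x))\<^sup>2\<bar> \<le> \<delta> / 2 * (norm x)\<^sup>2" for j x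
  proof -
    have "\<bar>k j * (norm (P x))\<^sup>2 - \<kappa> * (norm (P x))\<^sup>2\<bar> = \<bar>k j - \<kappa>\<bar> * (norm (P x))\<^sup>2"
      by (simp add: abs_mult flip: left_diff_distrib)
    also have "\<dots> \<le> \<delta> / 2 * (norm x)\<^sup>2" using kk[of j] \<delta> norm_P[of x] by (intro mult_mono power_mono) auto
    finally show ?thesis .
  qed
  define M where "M = (\<lambda>j v. Nj j v - F)"
  define \<Phi> where "\<Phi> = (\<lambda>j v. \<Gamma>j j v - F \<bullet> v)"
  define C' where "C' = C + norm F"
  have C0: "C \<ge> 0" using Nb[of 0 0] norm_ge_zero order_trans by blast
  have C'0: "C' \<ge> 0" "C \<le> C'" using C0 by (auto simp: C'_def)
  have Mb: "norm (M j v) \<le> C'" for j v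
    using norm_triangle_ineq4[of "Nj j v" F] Nb[of j v] by (simp add: M_def C'_def)
  have MLip: "norm (M j v - M j w) \<le> L j * norm (v - w)" for j v w using Lip by (simp add: M_def)
  have Mtay: "\<Phi> j (v + w) \<le> \<Phi> j v + M j v \<bullet> w + L j * (norm w)\<^sup>2" for j v w
    using taylor[of j v w] by (simp add: M_def \<Phi>_def algebra_simps)
  have \<Phi>b: "\<bar>\<Phi> j v\<bar> \<le> C' + C' * norm v" for j v
  proof -
    have "\<bar>F \<bullet> v\<bar> \<le> norm F * norm v" by (rule Cauchy_Schwarz_ineq2)
    then show ?thesis using close[of j v] growth[of v] norm_ge_zero[of F] unfolding \<Phi>_def C'_def distrib_right by linarith
  qed
  define J where "J = (\<lambda>j u. ((norm u)\<^sup>2 - k j * (norm (P u))\<^sup>2) / 2 + \<Phi> j (P u))"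
  define G where "G = (\<lambda>j u. u - adj (k j *\<^sub>R P u - M j (P u)))"
  have \<Phi>bx: "\<bar>\<Phi> j (P x)\<bar> \<le> C' + C' * norm x" for j x
    using \<Phi>b[of j "P x"] mult_left_mono[OF norm_P[of x] C'0(1)] by linarith
  have Jup: "J j x \<le> C' + C'\<^sup>2 / (2 * d)" if "d > 0" "(1 + d) * (norm x)\<^sup>2 \<le> k j * (norm (P x))\<^sup>2" for j x d
    using that(2) \<Phi>bx[of j x] quadratic_upper_bound[OF that(1), of C' "norm x"] unfolding J_def distrib_right by (simp only: abs_le_iff) argo
  have Jlow: "- (C' + C'\<^sup>2 / (2 * d)) \<le> J j x" if "d > 0" "k j * (norm (P x))\<^sup>2 \<le> (1 - d) * (norm x)\<^sup>2" for j x d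
    using that(2) \<Phi>bx[of j x] quadratic_upper_bound[OF that(1), of C' "norm x"] unfolding J_def left_diff_distrib by (simp only: abs_le_iff) argo
  \<comment> \<open>Built from the surviving gap \<delta> / 2, hence the same for all
    \<open>j\<close>.\<close>
  define b where "b = C' + C'\<^sup>2 / (2 * (\<delta> / 2))"
  \<comment> \<open>Of the two energy bounds only this one is kept: the other is taken on the side
    of the resonant eigenspace, where the gap shrinks with \<open>t j\<close>.\<close>
  have crit: "\<exists>u\<in>S. s * J j u \<le> b \<and> norm (G j u) \<le> 1 / real (Suc j)" for j
  proof -
    \<comment> \<open>The relative gap that the shift leaves on the resonant side; \<open>dd\<close>
      brings the factors into the form to which the weak estimates \<open>gap0p\<close> and
      \<open>gap0m\<close> apply.\<close>
    define d where "d = t j / \<kappa>"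
    have d: "d > 0" using t[of j] \<kappa> by (simp add: d_def)
    have dd: "(1 + d) * x = (\<kappa> + t j) * (x / \<kappa>)" "(1 - d) * x = (\<kappa> - t j) * (x / \<kappa>)" for x
      using \<kappa> by (auto simp: d_def field_simps)
    have eta: "1 / real (Suc j) > 0" by simp
    show ?thesis
    proof (cases "s = 1")
      case True
      define B1 where "B1 = {e\<in>B. \<nu> e < \<kappa>}"
      have B1: "finite B1" "pairwise orthogonal B1" "\<And>e. e \<in> B1 \<Longrightarrow> norm e = 1" "\<And>e. e \<in> B1 \<Longrightarrow> eig (\<nu> e) e"
        using B by (auto simp: B1_def pairwise_def)
      \<comment> \<open>The gap estimate at a unit eigenvector reads (1 + \<delta>) \<nu> \<le>
        \<kappa>, and \<nu> \<ge> 1 turns this into \<nu> \<le> \<kappa> - \<delta>, below the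
        shifted value.\<close>
      have lt: "\<nu> e < k j" if e: "e \<in> B1" for e
      proof -
        have eb: "e \<in> span {e\<in>B. \<nu> e < \<kappa>}" using e by (intro span_base) (auto simp: B1_def)
        have e1: "norm e = 1" "(norm e)\<^sup>2 = \<nu> e * (norm (P e))\<^sup>2" using B1(3)[OF e] eig_norm[OF B1(4)[OF e]] by auto
        have "(1 + \<delta>) \<le> \<kappa> * (norm (P e))\<^sup>2" using gapm[OF eb] e1 by simp
        moreover have \<nu>1: "\<nu> e \<ge> 1" using eig_eval_ge_1[OF B1(4)[OF e]] e1 by fastforce
        moreover have "(norm (P e))\<^sup>2 = 1 / \<nu> e" using e1 \<nu>1 by (simp add: eq_divide_eq mult.commute)
        ultimately have "(1 + \<delta>) * \<nu> e \<le> \<kappa>" by (simp add: pos_le_divide_eq)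
        moreover have "\<delta> * 1 \<le> \<delta> * \<nu> e" using \<delta> \<nu>1 by (intro mult_left_mono) auto
        ultimately show ?thesis using kk[of j] \<delta> unfolding distrib_right by linarith
      qed
      have up: "J j x \<le> b" if "x \<in> span B1" for x
      proof -
        have "(1 + \<delta> / 2) * (norm x)\<^sup>2 \<le> k j * (norm (P x))\<^sup>2"
          using gapm[OF that[unfolded B1_def]] kP[of j x] unfolding distrib_right by linarith
        then show ?thesis unfolding b_def using \<delta> by (intro Jup) auto
      qed
      have low: "- (C' + C'\<^sup>2 / (2 * d)) \<le> J j x" if "x \<in> S" "\<forall>e\<in>B1. x \<bullet> e = 0" for x
      proof (rule Jlow[OF d])
        have "(norm (P x))\<^sup>2 \<le> (norm x)\<^sup>2 / \<kappa>" using gap0p[of x] that \<kappa> by (simp add: B1_def pos_le_divide_eq mult.commute)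
        then show "k j * (norm (P x))\<^sup>2 \<le> (1 - d) * (norm x)\<^sup>2"
          unfolding dd(2) using kpos(1)[of j] True by (simp only: k_def mult_1) (rule mult_left_mono; simp)
      qed
      have "\<exists>u\<in>S. - (C' + C'\<^sup>2 / (2 * d)) \<le> J j u \<and> J j u \<le> b \<and> norm (G j u) \<le> 1 / real (Suc j)"
        unfolding J_def G_def
        by (rule approximate_critical_point[where B = B1 and \<nu> = \<nu> and L = "L j" and C = C'])
           (use Mb MLip Mtay L kpos B1 lt up low eta in \<open>auto simp: J_def\<close>)
      then show ?thesis using True by auto
    next
      case False
      then have s: "s = -1" using s by simp
      have kj: "k j = \<kappa> + t j" by (simp add: k_def s)
      \<comment> \<open>Raising the value puts all of \<open>B\<close>, resonant vectors included,
        strictly below it.\<close>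
      have lt: "\<nu> e < k j" if e: "e \<in> B" for e using \<kappa>(2)[OF e] t[of j] kj by simp
      have up: "J j x \<le> C' + C'\<^sup>2 / (2 * d)" if "x \<in> span B" for x
      proof (rule Jup[OF d])
        have "(norm x)\<^sup>2 / \<kappa> \<le> (norm (P x))\<^sup>2" using gap0m[OF that] \<kappa> by (simp add: pos_divide_le_eq mult.commute)
        then show "(1 + d) * (norm x)\<^sup>2 \<le> k j * (norm (P x))\<^sup>2"
          unfolding dd(1) kj using \<kappa> t[of j] by (intro mult_left_mono) auto
      qed
      have low: "- b \<le> J j x" if "x \<in> S" "\<forall>e\<in>B. x \<bullet> e = 0" for x
      proof -
        have "k j * (norm (P x))\<^sup>2 \<le> (1 - \<delta> / 2) * (norm x)\<^sup>2"
          using gapp[OF that] kP[of j x] unfolding left_diff_distrib by linarith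
        then show ?thesis unfolding b_def using \<delta> by (intro Jlow) auto
      qed
      have "\<exists>u\<in>S. - b \<le> J j u \<and> J j u \<le> C' + C'\<^sup>2 / (2 * d) \<and> norm (G j u) \<le> 1 / real (Suc j)"
        unfolding J_def G_def
        by (rule approximate_critical_point[where B = B and \<nu> = \<nu> and L = "L j" and C = C'])
           (use Mb MLip Mtay L kpos B lt up low eta in \<open>auto simp: J_def\<close>)
      then obtain u where "u \<in> S" "- b \<le> J j u" "norm (G j u) \<le> 1 / real (Suc j)" by blast
      then show ?thesis using s by (intro bexI[of _ u]) auto
    qed
  qed
  \<comment> \<open>The gap \<delta> / 2 against a gradient of norm at most 1 and a nonlinearity
    bounded by \<open>C'\<close>: a bound, uniform in \<open>j\<close>, for the component outside
    the resonant eigenspace.\<close>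
  define K where "K = 2 * (1 + C') / \<delta>"
  have K0: "K \<ge> 0" using C'0 \<delta> by (simp add: K_def)
  define M' where "M' = b + (1 + 2 * \<kappa>) * K\<^sup>2 / 2 + C + norm (F - Fbar) * K"
  have est: "\<exists>z v. u = z + v \<and> eig \<kappa> z \<and> v \<in> S \<and> norm v \<le> K \<and> P z \<bullet> P v = 0 \<and> s * (\<Gamma> (P u) - Fbar \<bullet> P u) \<le> M'"
    if u: "u \<in> S" "s * J j u \<le> b" "norm (G j u) \<le> 1 / real (Suc j)" for u j
  proof -
    obtain a z c where split: "u = a + z + c" "a \<in> S" "a \<in> span {e\<in>B. \<nu> e < \<kappa>}" "eig \<kappa> z" "c \<in> S" "\<forall>e\<in>B. c \<bullet> e = 0"
      "a \<bullet> z = 0" "P a \<bullet> P z = 0" "a \<bullet> c = 0" "P a \<bullet> P c = 0" "z \<bullet> c = 0" "P z \<bullet> P c = 0"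
      by (rule eigen_splitting[of B \<nu> \<kappa> u]) (rule B \<kappa>(2) u(1) that | assumption)+
    have sym: "z \<bullet> a = 0" "P z \<bullet> P a = 0" "c \<bullet> a = 0" "P c \<bullet> P a = 0" "c \<bullet> z = 0" "P c \<bullet> P z = 0"
      using split by (simp_all add: inner_commute)
    define v where "v = a + c"
    \<comment> \<open>Testing the gradient with \<open>c - a\<close> reverses the negative part, so
      both gaps contribute with the same sign.\<close>
    define w where "w = c - a"
    have vw: "v \<in> S" "w \<in> S" using split S_intros by (auto simp: v_def w_def)
    have nv: "(norm v)\<^sup>2 = (norm a)\<^sup>2 + (norm c)\<^sup>2" and nw: "(norm w)\<^sup>2 = (norm a)\<^sup>2 + (norm c)\<^sup>2"
      using split sym by (auto simp: v_def w_def power2_norm_eq_inner inner_add_left inner_add_right inner_diff_left inner_diff_right)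
    have "G j u \<bullet> w = u \<bullet> w - k j * (P u \<bullet> P w) + M j (P u) \<bullet> P w"
      using vw by (simp add: G_def inner_diff_left adj)
    moreover have "u \<bullet> w = (norm c)\<^sup>2 - (norm a)\<^sup>2" "P u \<bullet> P w = (norm (P c))\<^sup>2 - (norm (P a))\<^sup>2"
      using split sym by (auto simp: w_def power2_norm_eq_inner P_simps inner_add_left inner_add_right inner_diff_right)
    ultimately have Gw: "G j u \<bullet> w = ((norm c)\<^sup>2 - k j * (norm (P c))\<^sup>2) + (k j * (norm (P a))\<^sup>2 - (norm a)\<^sup>2) + M j (P u) \<bullet> P w"
      by (simp add: algebra_simps)
    have "\<delta> / 2 * (norm c)\<^sup>2 \<le> (norm c)\<^sup>2 - k j * (norm (P c))\<^sup>2"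
      using gapp[OF split(5,6)] kP[of j c] unfolding left_diff_distrib by linarith
    moreover have "\<delta> / 2 * (norm a)\<^sup>2 \<le> k j * (norm (P a))\<^sup>2 - (norm a)\<^sup>2"
      using gapm[OF split(3)] kP[of j a] unfolding distrib_right by linarith
    ultimately have lo: "\<delta> / 2 * (norm w)\<^sup>2 \<le> G j u \<bullet> w - M j (P u) \<bullet> P w" unfolding Gw nw by (simp add: distrib_left)
    have "G j u \<bullet> w \<le> norm (G j u) * norm w" by (rule norm_cauchy_schwarz)
    also have "\<dots> \<le> 1 * norm w" using u(3) by (intro mult_right_mono) (auto intro: order_trans)
    finally have g1: "G j u \<bullet> w \<le> norm w" by simp
    have "\<bar>M j (P u) \<bullet> P w\<bar> \<le> norm (M j (P u)) * norm (P w)" by (rule Cauchy_Schwarz_ineq2)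
    also have "\<dots> \<le> C' * norm w" using Mb norm_P C'0 by (intro mult_mono) auto
    finally have "\<delta> / 2 * (norm w)\<^sup>2 \<le> (1 + C') * norm w" using lo g1 by (simp add: distrib_right)
    then have "norm w \<le> K"
    proof (cases "norm w = 0")
      case False
      then have "\<delta> / 2 * norm w \<le> 1 + C'" using \<open>\<delta> / 2 * (norm w)\<^sup>2 \<le> (1 + C') * norm w\<close>
        by (simp add: power2_eq_square flip: mult.assoc)
      then show ?thesis using \<delta> by (simp add: K_def field_simps)
    qed (use K0 in simp)
    moreover have "norm v = norm w" using nv nw by (metis norm_ge_zero power2_eq_imp_eq)
    ultimately have vK: "norm v \<le> K" by simp
    have v2: "(norm v)\<^sup>2 \<le> K\<^sup>2" using vK by (intro power_mono) auto
    have Pzv: "P z \<bullet> P v = 0" "z \<bullet> v = 0" using split sym by (simp_all add: v_def P_simps inner_add_right)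
    have uzv: "u = z + v" using split by (simp add: v_def)
    have "(norm u)\<^sup>2 = (norm z)\<^sup>2 + (norm v)\<^sup>2" "(norm (P u))\<^sup>2 = (norm (P z))\<^sup>2 + (norm (P v))\<^sup>2"
      using Pzv by (auto simp: uzv power2_norm_eq_inner P_simps inner_add_left inner_add_right inner_commute)
    \<comment> \<open>The unshifted form does not see the resonant component, which enters the
      quadratic part only through \<open>s * t j\<close>. After multiplication by \<open>s\<close>
      this term is nonnegative and can be discarded from an upper bound for the potential.\<close>
    then have Ju: "J j u = ((norm v)\<^sup>2 - k j * (norm (P v))\<^sup>2) / 2 + s * t j * (norm (P z))\<^sup>2 / 2 + \<Phi> j (P u)"
      unfolding J_def using eig_norm[OF split(4)] by (simp add: k_def field_simps)
    have kv: "\<bar>(norm v)\<^sup>2 - k j * (norm (P v))\<^sup>2\<bar> \<le> (1 + 2 * \<kappa>) * K\<^sup>2"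
    proof -
      have "k j * (norm (P v))\<^sup>2 \<le> 2 * \<kappa> * K\<^sup>2"
        using kpos[of j] norm_P[of v] vK \<kappa> by (intro mult_mono power_mono) auto
      moreover have "k j * (norm (P v))\<^sup>2 \<ge> 0" using kpos[of j] by simp
      ultimately show ?thesis using v2 zero_le_power2[of "norm v"] zero_le_power2[of K] unfolding distrib_right by linarith
    qed
    have "\<bar>(F - Fbar) \<bullet> P v\<bar> \<le> norm (F - Fbar) * norm (P v)" by (rule Cauchy_Schwarz_ineq2)
    also have "\<dots> \<le> norm (F - Fbar) * K" using norm_P[of v] vK by (intro mult_left_mono) auto
    finally have Fv: "\<bar>(F - Fbar) \<bullet> P v\<bar> \<le> norm (F - Fbar) * K" .
    \<comment> \<open>On the resonant component the right-hand side acts through \<open>Fbar\<close>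
      alone; the difference meets only the bounded part \<open>v\<close>.\<close>
    have Fu: "F \<bullet> P u = Fbar \<bullet> P u + (F - Fbar) \<bullet> P v"
      using Fbar[OF split(4)] by (simp add: uzv P_simps inner_add_right inner_diff_left)
    have tz: "t j * (norm (P z))\<^sup>2 \<ge> 0" using t[of j] by simp
    have "s * (\<Gamma> (P u) - Fbar \<bullet> P u) \<le> M'"
    proof -
      have s1: "- (s * x) \<le> \<bar>x\<bar>" "s * x \<le> \<bar>x\<bar>" "s * (s * x) = x" for x using s by auto
      have "s * (\<Gamma> (P u) - Fbar \<bullet> P u) = s * J j u - s * ((norm v)\<^sup>2 - k j * (norm (P v))\<^sup>2) / 2
          - s * (s * (t j * (norm (P z))\<^sup>2)) / 2 - s * (\<Gamma>j j (P u) - \<Gamma> (P u)) + s * ((F - Fbar) \<bullet> P v)"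
        unfolding Ju \<Phi>_def Fu by (simp add: field_simps)
      then show ?thesis
        using u(2) kv Fv tz close[of j "P u"] s1(1)[of "(norm v)\<^sup>2 - k j * (norm (P v))\<^sup>2"] s1(1)[of "\<Gamma>j j (P u) - \<Gamma> (P u)"]
          s1(2)[of "(F - Fbar) \<bullet> P v"] unfolding M'_def s1(3) by linarith
    qed
    then show ?thesis using uzv split(4) vw vK Pzv by blast
  qed
  obtain u where u: "\<And>j. u j \<in> S" "\<And>j. s * J j (u j) \<le> b" "\<And>j. norm (G j (u j)) \<le> 1 / real (Suc j)"
    using crit by metis
  obtain z v where zv: "\<And>j. u j = z j + v j" "\<And>j. eig \<kappa> (z j)" "\<And>j. v j \<in> S" "\<And>j. norm (v j) \<le> K" "\<And>j. P (z j) \<bullet> P (v j) = 0"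
    and \<Gamma>M: "\<And>j. s * (\<Gamma> (P (u j)) - Fbar \<bullet> P (u j)) \<le> M'"
    using est[OF u] by metis
  have Pz: "(norm (P (z j)))\<^sup>2 \<le> (norm (P (u j)))\<^sup>2" for j
    using zv(5)[of j] by (simp add: zv(1) power2_norm_eq_inner P_simps inner_add_left inner_add_right inner_commute)
  \<comment> \<open>On the eigenspace the two norms are proportional, and \<open>P z\<close> is an
    orthogonal part of \<open>P u\<close>.\<close>
  have nz: "norm (z j) \<le> sqrt \<kappa> * norm (P (u j))" for j
  proof -
    have "(norm (z j))\<^sup>2 \<le> \<kappa> * (norm (P (u j)))\<^sup>2" using eig_norm[OF zv(2)[of j]] Pz[of j] \<kappa> by simp
    then have "sqrt ((norm (z j))\<^sup>2) \<le> sqrt (\<kappa> * (norm (P (u j)))\<^sup>2)" by (rule real_sqrt_le_mono)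
    then show ?thesis by (simp add: real_sqrt_mult)
  qed
  \<comment> \<open>An unbounded sequence would, along a subsequence, satisfy the premises of
    \<open>SC\<close>, while \<open>\<Gamma>M\<close> bounds the functional from above.\<close>
  have "\<exists>D. \<forall>j. norm (P (u j)) \<le> D"
  proof (rule ccontr)
    assume "\<nexists>D. \<forall>j. norm (P (u j)) \<le> D"
    then have "\<forall>n::nat. \<exists>j. real (Suc n) < norm (P (u j))" by (metis not_le)
    then obtain r where r: "\<And>n. real (Suc n) < norm (P (u (r n)))" by metis
    define \<rho> where "\<rho> = (\<lambda>n. norm (P (u (r n))))"
    have \<rho>0: "\<rho> n > 0" for n unfolding \<rho>_def using r[of n] by (meson le_less_trans of_nat_0_le_iff)
    have "filterlim \<rho> at_top sequentially"
    proof (rule filterlim_at_top_mono[OF filterlim_real_sequentially])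
      have "real n \<le> \<rho> n" for n using r[of n] unfolding \<rho>_def of_nat_Suc by linarith
      then show "\<forall>\<^sub>F n in sequentially. real n \<le> \<rho> n" by (intro always_eventually allI)
    qed
    define Z where "Z = (\<lambda>n. (1 / \<rho> n) *\<^sub>R z (r n))"
    have Zeig: "eig \<kappa> (Z n)" for n using subspace_scale[OF subspace_eig] zv(2) by (auto simp: Z_def)
    have "norm (Z n) \<le> sqrt \<kappa>" for n
    proof -
      have "norm (z (r n)) \<le> sqrt \<kappa> * \<rho> n" using nz[of "r n"] by (simp add: \<rho>_def)
      then show ?thesis using \<rho>0[of n] by (simp add: Z_def pos_divide_le_eq)
    qed
    then obtain q l where q: "strict_mono (q :: nat \<Rightarrow> nat)" and l: "(\<lambda>n. P (Z (q n))) \<longlonglongrightarrow> l"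
      using compact_subsequence[of Z "sqrt \<kappa>"] Zeig by (auto simp: eig_def)
    \<comment> \<open>For eigenvectors of one value convergence of the images lifts to convergence
      in \<open>S\<close>.\<close>
    have "(norm (Z (q m) - Z (q n)))\<^sup>2 \<le> 0 + 0 + \<kappa> * (norm (P (Z (q m)) - P (Z (q n))))\<^sup>2" for m n
      using eig_norm[of \<kappa> "Z (q m) - Z (q n)"] subspace_diff[OF subspace_eig] Zeig by (auto simp: P_simps)
    then have "Cauchy (\<lambda>n. Z (q n))"
      by (rule Cauchy_norm_square_bound[of _ "\<lambda>n. 0"]) (use \<kappa> l LIMSEQ_imp_Cauchy in auto)
    then obtain z0 where z0: "(\<lambda>n. Z (q n)) \<longlonglongrightarrow> z0" using Cauchy_convergent_iff convergent_def by blast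
    have z0e: "eig \<kappa> z0" using eig_lim[OF _ z0] Zeig by blast
    have \<rho>q: "filterlim (\<lambda>n. \<rho> (q n)) at_top sequentially"
      using filterlim_compose[OF \<open>filterlim \<rho> at_top sequentially\<close> filterlim_subseq[OF q]] .
    have inv: "(\<lambda>n. inverse (\<rho> (q n))) \<longlonglongrightarrow> 0" using tendsto_inverse_0_at_top[OF \<rho>q] .
    have small: "(\<lambda>n. (1 / \<rho> (q n)) *\<^sub>R P (v (r (q n)))) \<longlonglongrightarrow> 0"
    proof (rule Lim_null_comparison)
      show "(\<lambda>n. K * inverse (\<rho> (q n))) \<longlonglongrightarrow> 0" using tendsto_mult_right_zero[OF inv] .
      have "norm (P (v i)) \<le> K" for i using norm_P[of "v i"] zv(4)[of i] by linarith
      then show "\<forall>\<^sub>F n in sequentially. norm ((1 / \<rho> (q n)) *\<^sub>R P (v (r (q n)))) \<le> K * inverse (\<rho> (q n))"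
        using \<rho>0 by (intro always_eventually allI) (auto simp: divide_inverse mult.commute less_imp_le intro!: mult_right_mono)
    qed
    have "(\<lambda>n. P (Z (q n)) + (1 / \<rho> (q n)) *\<^sub>R P (v (r (q n)))) \<longlonglongrightarrow> P z0 + 0"
      by (intro tendsto_add P_lim z0 small)
    moreover have "P (Z (q n)) + (1 / \<rho> (q n)) *\<^sub>R P (v (r (q n))) = (1 / norm (P (u (r (q n))))) *\<^sub>R P (u (r (q n)))" for n
      by (simp add: Z_def P_simps zv(1) scaleR_add_right \<rho>_def)
    ultimately have "(\<lambda>n. (1 / norm (P (u (r (q n))))) *\<^sub>R P (u (r (q n)))) \<longlonglongrightarrow> P z0" by simp
    then have "filterlim (\<lambda>n. s * (\<Gamma> (P (u (r (q n)))) - Fbar \<bullet> P (u (r (q n))))) at_top sequentially"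
      using SC[of "\<lambda>n. u (r (q n))" z0] u(1) \<rho>q z0e by (simp add: \<rho>_def)
    then have "\<forall>\<^sub>F n in sequentially. M' + 1 \<le> s * (\<Gamma> (P (u (r (q n)))) - Fbar \<bullet> P (u (r (q n))))"
      unfolding filterlim_at_top by blast
    then obtain n where "M' + 1 \<le> s * (\<Gamma> (P (u (r (q n)))) - Fbar \<bullet> P (u (r (q n))))"
      using eventually_happens trivial_limit_sequentially by blast
    then show False using \<Gamma>M[of "r (q n)"] by linarith
  qed
  then obtain D where D: "\<And>j. norm (P (u j)) \<le> D" by blast
  have "norm (u j) \<le> sqrt \<kappa> * D + K" for j
  proof -
    have "norm (u j) \<le> norm (z j) + norm (v j)" unfolding zv(1) by (rule norm_triangle_ineq)
    moreover have "sqrt \<kappa> * norm (P (u j)) \<le> sqrt \<kappa> * D" using D \<kappa> by (intro mult_left_mono) auto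
    ultimately show ?thesis using nz[of j] zv(4)[of j] by linarith
  qed
  then obtain r l where r: "strict_mono (r :: nat \<Rightarrow> nat)" and l: "(\<lambda>n. P (u (r n))) \<longlonglongrightarrow> l"
    using compact_subsequence[of u] u(1) by blast
  obtain q where q: "strict_mono (q :: nat \<Rightarrow> nat)" and Nq: "(\<lambda>j. Nj (r (q j)) (P (u (r (q j))))) \<longlonglongrightarrow> N l"
    using conv[OF r l] by blast
  define p where "p = (\<lambda>j. r (q j))"
  have p: "strict_mono p" using strict_mono_o[OF r q] by (simp add: p_def o_def)
  have lp: "(\<lambda>j. P (u (p j))) \<longlonglongrightarrow> l" using LIMSEQ_subseq_LIMSEQ[OF l q] by (simp add: p_def o_def)
  have kp: "(\<lambda>j. k (p j)) \<longlonglongrightarrow> \<kappa> - s * 0"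
    unfolding k_def using LIMSEQ_subseq_LIMSEQ[OF t0 p] by (intro tendsto_intros) (simp add: o_def)
  have Gp: "(\<lambda>j. G (p j) (u (p j))) \<longlonglongrightarrow> 0"
    by (rule Lim_null_comparison[where g = "\<lambda>j. 1 / real (Suc (p j))"])
       (use u(3) LIMSEQ_subseq_LIMSEQ[OF LIMSEQ_inverse_Suc p] in \<open>auto simp: o_def\<close>)
  define w where "w = adj (\<kappa> *\<^sub>R l - (N l - F))"
  have wS: "w \<in> S" by (simp add: w_def adj)
  \<comment> \<open>Each \<open>u\<close> is its gradient plus \<open>adj\<close> of a quantity that
    converges in L2, so convergence of the images already forces strong convergence in
    \<open>S\<close>.\<close>
  have "(\<lambda>j. G (p j) (u (p j)) + adj (k (p j) *\<^sub>R P (u (p j)) - M (p j) (P (u (p j))))) \<longlonglongrightarrow> 0 + adj ((\<kappa> - s * 0) *\<^sub>R l - (N l - F))"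
    unfolding M_def using Nq
    by (intro tendsto_add Gp bounded_linear.tendsto[OF bounded_linear_adj] tendsto_diff tendsto_scaleR kp lp tendsto_const) (simp add: p_def)
  then have uw: "(\<lambda>j. u (p j)) \<longlonglongrightarrow> w" by (simp add: G_def w_def)
  have Pw: "P w = l" using LIMSEQ_unique[OF P_lim[OF uw] lp] .
  have "w \<bullet> y - \<kappa> * (P w \<bullet> P y) + N (P w) \<bullet> P y = F \<bullet> P y" if "y \<in> S" for y
    unfolding Pw using adj(2)[OF that, of "\<kappa> *\<^sub>R l - (N l - F)"] by (simp add: w_def inner_diff_left)
  then show ?thesis using wS by blast
qed

end

section \<open>The Hilbert space of square-integrable functions\<close>

definition square_integrable :: "('a::euclidean_space \<Rightarrow> 'b::euclidean_space) \<Rightarrow> bool" where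
  "square_integrable u \<longleftrightarrow> u \<in> borel_measurable lebesgue \<and> integrable lebesgue (\<lambda>x. (norm (u x))\<^sup>2)"

lemma square_integrable_measurable [measurable_dest]:
  "square_integrable u \<Longrightarrow> u \<in> borel_measurable lebesgue"
  by (simp add: square_integrable_def)

lemma square_integrable_integrable: "square_integrable u \<Longrightarrow> integrable lebesgue (\<lambda>x. (norm (u x))\<^sup>2)"
  by (simp add: square_integrable_def)

lemma square_integrable_bound:
  assumes "u \<in> borel_measurable lebesgue" "integrable lebesgue h" "\<And>x. (norm (u x))\<^sup>2 \<le> h x"
  shows "square_integrable u"
  unfolding square_integrable_def
proof
  show "integrable lebesgue (\<lambda>x. (norm (u x))\<^sup>2)"
    by (rule Bochner_Integration.integrable_bound[OF assms(2)]) (use assms in \<open>auto intro: order_trans[OF _ abs_ge_self]\<close>)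
qed fact

lemma norm_add_power2_le: "(norm (a + b))\<^sup>2 \<le> 2 * (norm a)\<^sup>2 + 2 * (norm (b :: 'a::real_inner))\<^sup>2"
  using norm_parallelogram[of a b] zero_le_power2[of "norm (a - b)"] by linarith

lemma square_integrable_0 [simp]: "square_integrable (\<lambda>x. 0)"
  by (simp add: square_integrable_def)

lemma square_integrable_add: "square_integrable u \<Longrightarrow> square_integrable v \<Longrightarrow> square_integrable (\<lambda>x. u x + v x)"
  by (rule square_integrable_bound[of _ "\<lambda>x. 2 * (norm (u x))\<^sup>2 + 2 * (norm (v x))\<^sup>2"])
     (auto intro!: norm_add_power2_le Bochner_Integration.integrable_add integrable_mult_right square_integrable_integrable)

lemma square_integrable_scaleR: "square_integrable u \<Longrightarrow> square_integrable (\<lambda>x. c *\<^sub>R u x)"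
  by (rule square_integrable_bound[of _ "\<lambda>x. c\<^sup>2 * (norm (u x))\<^sup>2"])
     (auto intro: square_integrable_integrable simp: power_mult_distrib)

lemma square_integrable_uminus: "square_integrable u \<Longrightarrow> square_integrable (\<lambda>x. - u x)"
  using square_integrable_scaleR[of u "-1"] by simp

lemma square_integrable_diff: "square_integrable u \<Longrightarrow> square_integrable v \<Longrightarrow> square_integrable (\<lambda>x. u x - v x)"
  using square_integrable_add[of u "\<lambda>x. - v x"] square_integrable_uminus[of v] by simp

lemma square_integrable_AE:
  assumes "square_integrable u" "AE x in lebesgue. u x = v x" "v \<in> borel_measurable lebesgue"
  shows "square_integrable v"
  unfolding square_integrable_def
proof
  have [measurable]: "u \<in> borel_measurable lebesgue" using assms by measurable
  show "integrable lebesgue (\<lambda>x. (norm (v x))\<^sup>2)"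
    using square_integrable_integrable[OF assms(1)] assms
    by (subst integrable_cong_AE[of _ _ "\<lambda>x. (norm (u x))\<^sup>2"]) auto
qed fact

lemma square_integrable_inner: 
  assumes "square_integrable u" "square_integrable v" 
  shows "integrable lebesgue (\<lambda>x. u x \<bullet> v x)"
proof (rule Bochner_Integration.integrable_bound[of _ "\<lambda>x. (norm (u x))\<^sup>2 + (norm (v x))\<^sup>2"])
  have "norm (a \<bullet> b) \<le> norm ((norm a)\<^sup>2 + (norm b)\<^sup>2)" for a b :: 'b
  proof -
    have "\<bar>a \<bullet> b\<bar> \<le> norm a * norm b" by (rule Cauchy_Schwarz_ineq2)
    moreover have "0 \<le> (norm a - norm b)\<^sup>2 + (norm a)\<^sup>2 + (norm b)\<^sup>2" by simp
    ultimately show ?thesis by (simp add: power2_diff)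
  qed
  then show "AE x in lebesgue. norm (u x \<bullet> v x) \<le> norm ((norm (u x))\<^sup>2 + (norm (v x))\<^sup>2)" by simp
qed (use assms in \<open>auto intro: square_integrable_integrable\<close>)

\<comment> \<open>A partial quotient, since only square integrable functions represent elements. The
  domain is the whole space, so the type does not depend on \<Omega>; the general codomain covers
  both u and the pair (u, grad u).\<close>
quotient_type (overloaded) ('a, 'b) Lsq = "'a::euclidean_space \<Rightarrow> 'b::euclidean_space" /
  partial: "\<lambda>u v. square_integrable u \<and> square_integrable v \<and> (AE x in lebesgue. u x = v x)"
proof (rule part_equivpI)
  show "\<exists>x :: 'a \<Rightarrow> 'b. square_integrable x \<and> square_integrable x \<and> (AE y in lebesgue. x y = x y)"
    by (intro exI[of _ "\<lambda>x. 0"]) simp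
  show "symp (\<lambda>(u :: 'a \<Rightarrow> 'b) v. square_integrable u \<and> square_integrable v \<and> (AE x in lebesgue. u x = v x))"
    by (auto simp: symp_def)
  show "transp (\<lambda>(u :: 'a \<Rightarrow> 'b) v. square_integrable u \<and> square_integrable v \<and> (AE x in lebesgue. u x = v x))"
    by (auto simp: transp_def)
qed

instantiation Lsq :: (euclidean_space, euclidean_space) real_vector
begin
lift_definition zero_Lsq :: "('a, 'b) Lsq" is "\<lambda>x. 0" by simp
lift_definition plus_Lsq :: "('a, 'b) Lsq \<Rightarrow> ('a, 'b) Lsq \<Rightarrow> ('a, 'b) Lsq" is "\<lambda>u v x. u x + v x"
  by (auto intro: square_integrable_add)
lift_definition minus_Lsq :: "('a, 'b) Lsq \<Rightarrow> ('a, 'b) Lsq \<Rightarrow> ('a, 'b) Lsq" is "\<lambda>u v x. u x - v x"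
  by (auto intro: square_integrable_diff)
lift_definition uminus_Lsq :: "('a, 'b) Lsq \<Rightarrow> ('a, 'b) Lsq" is "\<lambda>u x. - u x"
  by (auto intro: square_integrable_uminus)
lift_definition scaleR_Lsq :: "real \<Rightarrow> ('a, 'b) Lsq \<Rightarrow> ('a, 'b) Lsq" is "\<lambda>c u x. c *\<^sub>R u x"
  by (auto intro: square_integrable_scaleR)
instance
  by standard (transfer; simp add: algebra_simps square_integrable_add square_integrable_diff square_integrable_scaleR square_integrable_uminus)+
end

instantiation Lsq :: (euclidean_space, euclidean_space) real_inner
begin
lift_definition inner_Lsq :: "('a, 'b) Lsq \<Rightarrow> ('a, 'b) Lsq \<Rightarrow> real" is "\<lambda>u v. LINT x|lebesgue. u x \<bullet> v x"
  by (rule integral_cong_AE) auto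
definition norm_Lsq :: "('a, 'b) Lsq \<Rightarrow> real" where "norm_Lsq x = sqrt (inner x x)"
definition dist_Lsq :: "('a, 'b) Lsq \<Rightarrow> ('a, 'b) Lsq \<Rightarrow> real" where "dist_Lsq x y = norm (x - y)"
definition sgn_Lsq :: "('a, 'b) Lsq \<Rightarrow> ('a, 'b) Lsq" where "sgn_Lsq x = x /\<^sub>R norm x"
definition uniformity_Lsq :: "(('a, 'b) Lsq \<times> ('a, 'b) Lsq) filter" where
  "uniformity_Lsq = (INF e\<in>{0<..}. principal {(x, y). dist x y < e})"
definition open_Lsq :: "('a, 'b) Lsq set \<Rightarrow> bool" where
  "open_Lsq U = (\<forall>x\<in>U. eventually (\<lambda>(x', y). x' = x \<longrightarrow> y \<in> U) uniformity)"
instance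
proof
  fix x y z :: "('a, 'b) Lsq" and r :: real
  show "inner x y = inner y x" by transfer (simp add: inner_commute)
  show "inner (x + y) z = inner x z + inner y z"
    by transfer (auto simp: inner_add_left square_integrable_inner)
  show "inner (r *\<^sub>R x) y = r * inner x y" by transfer simp
  show "0 \<le> inner x x" by transfer (auto intro!: integral_nonneg_AE)
  show "inner x x = 0 \<longleftrightarrow> x = 0"
    by transfer (auto simp: integral_nonneg_eq_0_iff_AE square_integrable_inner)
qed (simp_all add: norm_Lsq_def dist_Lsq_def sgn_Lsq_def uniformity_Lsq_def open_Lsq_def)
end

definition toL :: "('a::euclidean_space \<Rightarrow> 'b::euclidean_space) \<Rightarrow> ('a, 'b) Lsq" where "toL = abs_Lsq"

lemma Lsq_cases: obtains u where "square_integrable u" "X = toL u"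
  using Quotient_abs_rep[OF Quotient_Lsq, of X] Quotient_rep_reflp[OF Quotient_Lsq, of X] unfolding toL_def by metis

lemma toL_simps:
  assumes "square_integrable u" "square_integrable v"
  shows "toL (\<lambda>x. u x + v x) = toL u + toL v" "toL (\<lambda>x. u x - v x) = toL u - toL v"
    "inner (toL u) (toL v) = (LINT x|lebesgue. u x \<bullet> v x)"
    "toL u = toL v \<longleftrightarrow> (AE x in lebesgue. u x = v x)"
  using assms Quotient_rel[OF Quotient_Lsq, of u v]
  by (auto simp: toL_def plus_Lsq.abs_eq minus_Lsq.abs_eq inner_Lsq.abs_eq)

lemma toL_scaleR: "square_integrable u \<Longrightarrow> toL (\<lambda>x. c *\<^sub>R u x) = c *\<^sub>R toL u"
  by (simp add: toL_def scaleR_Lsq.abs_eq)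

lemma toL_0: "toL (\<lambda>x. 0) = 0"
  by (simp add: toL_def zero_Lsq_def)

lemma norm_toL:
  assumes "square_integrable u"
  shows "(norm (toL u))\<^sup>2 = (LINT x|lebesgue. (norm (u x))\<^sup>2)"
    "(\<integral>\<^sup>+x. ennreal ((norm (u x))\<^sup>2) \<partial>lebesgue) = ennreal ((norm (toL u))\<^sup>2)"
proof -
  show e: "(norm (toL u))\<^sup>2 = (LINT x|lebesgue. (norm (u x))\<^sup>2)"
    using toL_simps(3)[OF assms assms] by (simp add: power2_norm_eq_inner)
  show "(\<integral>\<^sup>+x. ennreal ((norm (u x))\<^sup>2) \<partial>lebesgue) = ennreal ((norm (toL u))\<^sup>2)"
    unfolding e by (rule nn_integral_eq_integral) (use square_integrable_integrable[OF assms] in auto)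
qed

text \<open>Squared norms are at most 16^(-n), so the sum of the squares with weights 4^n has finite
  integral and is finite almost everywhere.\<close>

lemma AE_summable_norm:
  fixes y :: "nat \<Rightarrow> 'a::euclidean_space \<Rightarrow> 'b::euclidean_space"
  assumes y: "\<And>n. square_integrable (y n)" and small: "\<And>n. norm (toL (y n)) \<le> (1/4) ^ n"
  shows "AE x in lebesgue. summable (\<lambda>n. norm (y n x))"
proof -
  have [measurable]: "y n \<in> borel_measurable lebesgue" for n using y by measurable
  have "(\<integral>\<^sup>+x. (\<Sum>n. ennreal (4 ^ n * (norm (y n x))\<^sup>2)) \<partial>lebesgue) = (\<Sum>n. \<integral>\<^sup>+x. ennreal (4 ^ n * (norm (y n x))\<^sup>2) \<partial>lebesgue)"
    by (rule nn_integral_suminf) simp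
  also have "\<dots> = (\<Sum>n. ennreal (4 ^ n * (norm (toL (y n)))\<^sup>2))"
    using norm_toL(2)[OF y] by (simp add: ennreal_mult nn_integral_cmult)
  also have "\<dots> \<le> (\<Sum>n. ennreal ((1/4) ^ n))"
  proof (rule suminf_le)
    fix n
    have "4 ^ n * (norm (toL (y n)))\<^sup>2 \<le> 4 ^ n * ((1/4) ^ n)\<^sup>2"
      using small[of n] by (intro mult_left_mono power_mono) auto
    also have "\<dots> = (1/4) ^ n" by (simp add: power2_eq_square power_divide)
    finally show "ennreal (4 ^ n * (norm (toL (y n)))\<^sup>2) \<le> ennreal ((1/4) ^ n)" by (rule ennreal_leI)
  qed auto
  also have "\<dots> = ennreal (\<Sum>n. (1/4) ^ n)" by (rule suminf_ennreal2) (auto intro: summable_geometric)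
  finally have "(\<integral>\<^sup>+x. (\<Sum>n. ennreal (4 ^ n * (norm (y n x))\<^sup>2)) \<partial>lebesgue) \<noteq> \<infinity>"
    by (metis ennreal_neq_top infinity_ennreal_def top.extremum_unique)
  then have "AE x in lebesgue. (\<Sum>n. ennreal (4 ^ n * (norm (y n x))\<^sup>2)) \<noteq> \<infinity>"
    by (intro nn_integral_PInf_AE) auto
  then show ?thesis
  proof eventually_elim
    case (elim x)
    then have s: "summable (\<lambda>n. 4 ^ n * (norm (y n x))\<^sup>2)" by (intro summable_suminf_not_top) auto
    \<comment> \<open>Either the value is at most 2^(-n), or 2^n times the value is at least 1 and
      the value is at most 2^n times its square.\<close>
    have b1: "norm (norm (y n x)) \<le> (1/2) ^ n + 4 ^ n * (norm (y n x))\<^sup>2" for n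
    proof -
      define a where "a = norm (y n x)"
      have a0: "a \<ge> 0" by (simp add: a_def)
      have "a \<le> (1/2) ^ n + 4 ^ n * a\<^sup>2"
      proof (cases "a \<le> (1/2) ^ n")
        case True
        then show ?thesis by (simp add: add_increasing2)
      next
        case False
        then have "1 \<le> 2 ^ n * a" by (simp add: power_divide field_simps)
        then have "a * 1 \<le> a * (2 ^ n * a)" using a0 by (rule mult_left_mono)
        also have "\<dots> = 2 ^ n * a\<^sup>2" by (simp add: power2_eq_square)
        also have "\<dots> \<le> 4 ^ n * a\<^sup>2" by (intro mult_right_mono power_mono) auto
        finally show ?thesis by (simp add: add_increasing)
      qed
      then show ?thesis by (simp add: a_def)
    qed
    have b2: "summable (\<lambda>n. (1/2) ^ n + 4 ^ n * (norm (y n x))\<^sup>2)"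
      by (intro summable_add s summable_geometric) simp
    show ?case by (rule summable_comparison_test'[OF b2, of 0]) (rule b1)
  qed
qed

lemma Lsq_limit_AE_subsequence:
  assumes X: "\<And>n. square_integrable (u n)" "square_integrable v" "(\<lambda>n. toL (u n)) \<longlonglongrightarrow> toL v"
  shows "\<exists>r. strict_mono (r :: nat \<Rightarrow> nat) \<and> (AE x in lebesgue. (\<lambda>n. u (r n) x) \<longlonglongrightarrow> v x)"
proof -
  have "\<exists>N. \<forall>m\<ge>N. norm (toL (u m) - toL v) < (1/4) ^ n" for n
    using LIMSEQ_D[OF X(3), of "(1/4) ^ n"] by simp
  then obtain N where N: "\<And>n m. m \<ge> N n \<Longrightarrow> norm (toL (u m) - toL v) < (1/4) ^ n" by metis
  \<comment> \<open>Adding up the thresholds gives a strictly increasing sequence that dominates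
    each \<open>N n\<close>.\<close>
  define r where "r = (\<lambda>n. (\<Sum>i\<le>n. N i) + n)"
  have r: "strict_mono r" unfolding strict_mono_Suc_iff by (simp add: r_def)
  have rN: "N n \<le> r n" for n using member_le_sum[of n "{..n}" N] by (simp add: r_def)
  have "AE x in lebesgue. summable (\<lambda>n. norm (u (r n) x - v x))"
    using X N[OF rN] by (intro AE_summable_norm) (auto simp: toL_simps less_imp_le intro: square_integrable_diff)
  then have "AE x in lebesgue. (\<lambda>n. u (r n) x) \<longlonglongrightarrow> v x"
  proof eventually_elim
    case (elim x)
    then show ?case by (intro LIM_zero_cancel[OF tendsto_norm_zero_cancel[OF summable_LIMSEQ_zero]])
  qed
  then show ?thesis using r by blast
qed

text \<open>Riesz-Fischer: a rapidly converging subsequence has a limit almost everywhere, and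
  Fatou's lemma bounds the distance of that limit to every late member, which also shows that the
  limit is square integrable.\<close>

instance Lsq :: (euclidean_space, euclidean_space) complete_space
proof
  fix X :: "nat \<Rightarrow> ('a, 'b) Lsq" assume C: "Cauchy X"
  have "\<forall>n. \<exists>u. square_integrable u \<and> X n = toL u" using Lsq_cases by metis
  then obtain u where u: "\<And>n. square_integrable (u n)" and X: "\<And>n. X n = toL (u n)" by metis
  have [measurable]: "u n \<in> borel_measurable lebesgue" for n using u by measurable
  have "\<exists>N. \<forall>m\<ge>N. \<forall>k\<ge>N. norm (X m - X k) < (1/4) ^ n" for n
    using C unfolding Cauchy_iff by (metis zero_less_divide_1_iff zero_less_numeral zero_less_power)
  then obtain N where N: "\<And>n m k. m \<ge> N n \<Longrightarrow> k \<ge> N n \<Longrightarrow> norm (X m - X k) < (1/4) ^ n" by metis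
  define r where "r = (\<lambda>n. (\<Sum>i\<le>n. N i) + n)"
  have r: "strict_mono r" unfolding strict_mono_Suc_iff by (simp add: r_def)
  have rN: "N n \<le> r n" for n using member_le_sum[of n "{..n}" N] by (simp add: r_def)
  have rN': "N n \<le> r (Suc n)" for n using rN[of n] r by (meson le_trans less_imp_le strict_mono_Suc_iff)
  have "AE x in lebesgue. summable (\<lambda>n. norm (u (r (Suc n)) x - u (r n) x))"
    using u N[OF rN' rN] by (intro AE_summable_norm) (auto simp: toL_simps X less_imp_le intro: square_integrable_diff)
  then have conv: "AE x in lebesgue. convergent (\<lambda>n. u (r n) x)"
  proof eventually_elim
    case (elim x)
    then have "summable (\<lambda>n. u (r (Suc n)) x - u (r n) x)" by (rule summable_norm_cancel)
    then have "convergent (\<lambda>n. \<Sum>i<n. u (r (Suc i)) x - u (r i) x)" by (simp add: summable_iff_convergent)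
    then have "convergent (\<lambda>n. u (r n) x - u (r 0) x)" by (simp only: sum_lessThan_telescope[of "\<lambda>i. u (r i) x"])
    then have "convergent (\<lambda>n. (u (r n) x - u (r 0) x) + u (r 0) x)" by (intro convergent_add convergent_const)
    then show ?case by simp
  qed
  \<comment> \<open>Values on the null set without convergence are immaterial; measurability holds
    regardless.\<close>
  define w where "w = (\<lambda>x. lim (\<lambda>n. u (r n) x))"
  have [measurable]: "w \<in> borel_measurable lebesgue" unfolding w_def by (intro borel_measurable_lim_metric) simp
  have wlim: "AE x in lebesgue. (\<lambda>n. u (r n) x) \<longlonglongrightarrow> w x"
    using conv by eventually_elim (simp add: w_def convergent_LIMSEQ_iff)
  have fatou: "(\<integral>\<^sup>+x. ennreal ((norm (w x - u k x))\<^sup>2) \<partial>lebesgue) \<le> ennreal (((1/4) ^ n)\<^sup>2)" if k: "k \<ge> N n" for k n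
  proof -
    have "(\<integral>\<^sup>+x. ennreal ((norm (w x - u k x))\<^sup>2) \<partial>lebesgue) = (\<integral>\<^sup>+x. liminf (\<lambda>m. ennreal ((norm (u (r m) x - u k x))\<^sup>2)) \<partial>lebesgue)"
    proof (rule nn_integral_cong_AE)
      show "AE x in lebesgue. ennreal ((norm (w x - u k x))\<^sup>2) = liminf (\<lambda>m. ennreal ((norm (u (r m) x - u k x))\<^sup>2))"
        using wlim
      proof eventually_elim
        case (elim x)
        have "(\<lambda>m. ennreal ((norm (u (r m) x - u k x))\<^sup>2)) \<longlonglongrightarrow> ennreal ((norm (w x - u k x))\<^sup>2)"
          by (intro tendsto_ennrealI tendsto_intros elim)
        then show ?case by (intro lim_imp_Liminf[symmetric]) auto
      qed
    qed
    also have "\<dots> \<le> liminf (\<lambda>m. \<integral>\<^sup>+x. ennreal ((norm (u (r m) x - u k x))\<^sup>2) \<partial>lebesgue)"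
      by (rule nn_integral_liminf) simp
    also have "\<dots> = liminf (\<lambda>m. ennreal ((norm (X (r m) - X k))\<^sup>2))"
      using norm_toL(2)[OF square_integrable_diff[OF u u]] by (simp add: X toL_simps u)
    also have "\<dots> \<le> ennreal (((1/4) ^ n)\<^sup>2)"
    proof (rule Liminf_le)
      show "\<forall>\<^sub>F m in sequentially. ennreal ((norm (X (r m) - X k))\<^sup>2) \<le> ennreal (((1/4) ^ n)\<^sup>2)"
        unfolding eventually_sequentially
      proof (intro exI allI impI)
        fix m assume "N n \<le> m"
        then have "N n \<le> r m" using r seq_suble le_trans by blast
        then show "ennreal ((norm (X (r m) - X k))\<^sup>2) \<le> ennreal (((1/4) ^ n)\<^sup>2)"
          using N[of n "r m" k] k by (intro ennreal_leI power_mono) auto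
      qed
    qed simp
    finally show ?thesis .
  qed
  have wu: "square_integrable (\<lambda>x. w x - u k x)" if "k \<ge> N 0" for k
    unfolding square_integrable_def using fatou[OF that]
    by (auto intro!: integrableI_nonneg elim: order.strict_trans1 simp: ennreal_less_top)
  have w: "square_integrable w" using square_integrable_add[OF wu[of "N 0"] u[of "N 0"]] by simp
  have bnd: "norm (toL w - X k) \<le> (1/4) ^ n" if "k \<ge> N n" for k n
  proof -
    have e: "toL (\<lambda>x. w x - u k x) = toL w - X k" using toL_simps(2)[OF w u] X by simp
    have "ennreal ((norm (toL w - X k))\<^sup>2) \<le> ennreal (((1/4) ^ n)\<^sup>2)"
      using fatou[OF that] unfolding norm_toL(2)[OF square_integrable_diff[OF w u[of k]]] e .
    then have "(norm (toL w - X k))\<^sup>2 \<le> ((1/4) ^ n)\<^sup>2" by (subst (asm) ennreal_le_iff) auto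
    then show ?thesis by (rule power2_le_imp_le) simp
  qed
  have "X \<longlonglongrightarrow> toL w"
  proof (rule LIMSEQ_I)
    fix e :: real assume "e > 0"
    then obtain n where "(1/4) ^ n < e" using real_arch_pow_inv[of e "1/4"] by auto
    then have "norm (X k - toL w) < e" if "N n \<le> k" for k
      using bnd[OF that] norm_minus_commute[of "X k" "toL w"] by linarith
    then show "\<exists>no. \<forall>k\<ge>no. norm (X k - toL w) < e" by blast
  qed
  then show "convergent X" by (auto simp: convergent_def)
qed

section \<open>Test functions\<close>

lemma C_k_Suc_imp: "C_k (Suc k) \<phi> \<Longrightarrow> C_k k \<phi>"
proof (induction k arbitrary: \<phi>)
  case 0
  then show ?case by (auto intro!: differentiable_imp_continuous_on simp: differentiable_on_def differentiable_at_withinI)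
next
  case (Suc k)
  then show ?case by (metis C_k.simps(2))
qed

lemma frechet_derivative_eqI: "(f has_derivative f') (at x) \<Longrightarrow> frechet_derivative f (at x) = f'"
  using frechet_derivative_at by metis

lemma C_k_0: "C_k k (\<lambda>x. 0)"
proof (induction k)
  case (Suc k)
  have "frechet_derivative (\<lambda>x. 0 :: real) (at x) = (\<lambda>h. 0)" for x :: 'a by (rule frechet_derivative_eqI) auto
  then show ?case using Suc by simp
qed simp

lemma C_k_add: "C_k k \<phi> \<Longrightarrow> C_k k \<psi> \<Longrightarrow> C_k k (\<lambda>x. \<phi> x + \<psi> x)"
proof (induction k arbitrary: \<phi> \<psi>)
  case 0
  then show ?case by (auto intro: continuous_intros)
next
  case (Suc k)
  then have d: "\<phi> differentiable at x" "\<psi> differentiable at x" for x by auto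
  have "frechet_derivative (\<lambda>x. \<phi> x + \<psi> x) (at x) = (\<lambda>h. frechet_derivative \<phi> (at x) h + frechet_derivative \<psi> (at x) h)" for x
    using d[of x] by (intro frechet_derivative_eqI has_derivative_add) (auto simp: frechet_derivative_works)
  then show ?case using Suc d by auto
qed

lemma C_k_cmult: "C_k k \<phi> \<Longrightarrow> C_k k (\<lambda>x. c * \<phi> x)"
proof (induction k arbitrary: \<phi>)
  case 0
  then show ?case by (auto intro: continuous_intros)
next
  case (Suc k)
  then have d: "\<phi> differentiable at x" for x by auto
  have "frechet_derivative (\<lambda>x. c * \<phi> x) (at x) = (\<lambda>h. c * frechet_derivative \<phi> (at x) h)" for x
    using d[of x] by (intro frechet_derivative_eqI has_derivative_mult_right) (auto simp: frechet_derivative_works)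
  then show ?case using Suc d by auto
qed

lemma frechet_derivative_mult:
  fixes \<phi> \<psi> :: "'a::real_normed_vector \<Rightarrow> real"
  assumes "\<phi> differentiable at x" "\<psi> differentiable at x"
  shows "frechet_derivative (\<lambda>x. \<phi> x * \<psi> x) (at x) = (\<lambda>h. \<phi> x * frechet_derivative \<psi> (at x) h + frechet_derivative \<phi> (at x) h * \<psi> x)"
  using assms by (intro frechet_derivative_eqI has_derivative_mult) (auto simp: frechet_derivative_works)

lemma C_k_mult: "C_k k \<phi> \<Longrightarrow> C_k k \<psi> \<Longrightarrow> C_k k (\<lambda>x. \<phi> x * \<psi> x)"
proof (induction k arbitrary: \<phi> \<psi>)
  case 0
  then show ?case by (auto intro: continuous_intros)
next
  case (Suc k)
  then have d: "\<phi> differentiable at x" "\<psi> differentiable at x" for x by auto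
  have "C_k k \<phi>" "C_k k \<psi>" using Suc.prems C_k_Suc_imp by blast+
  then have "C_k k (\<lambda>x. \<phi> x * frechet_derivative \<psi> (at x) b + frechet_derivative \<phi> (at x) b * \<psi> x)" if "b \<in> Basis" for b
    using Suc that by (intro C_k_add) auto
  then show ?case using d by (simp add: frechet_derivative_mult)
qed

lemma C_k_const: "C_k k (\<lambda>x. c)"
proof (cases k)
  case (Suc k')
  have "frechet_derivative (\<lambda>x. c :: real) (at x) = (\<lambda>h. 0)" for x :: 'a by (rule frechet_derivative_eqI) auto
  then show ?thesis by (simp add: C_k_0 Suc)
qed simp

lemma C_k_prod: "finite I \<Longrightarrow> (\<And>i. i \<in> I \<Longrightarrow> C_k k (\<phi> i)) \<Longrightarrow> C_k k (\<lambda>x. \<Prod>i\<in>I. \<phi> i x)"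
  by (induction I rule: finite_induct) (auto intro: C_k_const C_k_mult)

text \<open>The classical smooth function exp(-1/t), divided by powers of t. With the powers the
  family is closed under differentiation up to linear combinations, so smoothness of every order
  follows by one induction.\<close>

definition flat :: "nat \<Rightarrow> real \<Rightarrow> real" where
  "flat k t = (if t > 0 then exp (- 1 / t) / t ^ k else 0)"

lemma flat_tendsto_0: "(flat k \<longlongrightarrow> 0) (at 0)"
proof -
  have "((\<lambda>t::real. inverse t ^ k / exp (inverse t)) \<longlongrightarrow> 0) (at_right 0)"
    by (rule filterlim_compose[OF tendsto_power_div_exp_0 filterlim_inverse_at_top_right])
  moreover have "\<forall>\<^sub>F t in at_right 0. inverse t ^ k / exp (inverse t) = flat k t"
    unfolding eventually_at_right_field by (intro exI[of _ 1]) (auto simp: flat_def exp_minus field_simps)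
  ultimately have r: "(flat k \<longlongrightarrow> 0) (at_right 0)" by (rule Lim_transform_eventually)
  have "\<forall>\<^sub>F t in at_left (0::real). 0 = flat k t"
    unfolding eventually_at_left_field by (intro exI[of _ "-1"]) (auto simp: flat_def)
  then have "(flat k \<longlongrightarrow> 0) (at_left 0)" using Lim_transform_eventually tendsto_const by blast
  then show ?thesis using r by (simp add: filterlim_split_at)
qed

lemma flat_has_derivative: "(flat k has_real_derivative (flat (k + 2) t - real k * flat (k + 1) t)) (at t)"
proof -
  consider "t > 0" | "t < 0" | "t = 0" by linarith
  then show ?thesis
  proof cases
    case 1
    have "((\<lambda>t. exp (- 1 / t) / t ^ k) has_real_derivative (flat (k + 2) t - real k * flat (k + 1) t)) (at t)"
    proof (rule DERIV_cong)
      show "((\<lambda>t. exp (- 1 / t) / t ^ k) has_real_derivative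
          ((exp (- 1 / t) * (1 / t\<^sup>2)) * t ^ k - exp (- 1 / t) * (real k * t ^ (k - 1))) / (t ^ k * t ^ k)) (at t)"
        using 1 by (auto intro!: derivative_eq_intros simp: power2_eq_square)
      show "((exp (- 1 / t) * (1 / t\<^sup>2)) * t ^ k - exp (- 1 / t) * (real k * t ^ (k - 1))) / (t ^ k * t ^ k) = flat (k + 2) t - real k * flat (k + 1) t"
        using 1 by (cases k) (auto simp: flat_def field_simps power2_eq_square)
    qed
    then show ?thesis
      by (rule DERIV_cong_ev[THEN iffD1, rotated -1])
         (use 1 in \<open>auto simp: flat_def eventually_nhds intro!: exI[of _ "{0<..}"]\<close>)
  next
    case 2
    have "((\<lambda>t. 0) has_real_derivative (flat (k + 2) t - real k * flat (k + 1) t)) (at t)"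
      using 2 by (simp add: flat_def)
    then show ?thesis
      by (rule DERIV_cong_ev[THEN iffD1, rotated -1])
         (use 2 in \<open>auto simp: flat_def eventually_nhds intro!: exI[of _ "{..<0}"]\<close>)
  next
    case 3
    \<comment> \<open>At 0 the difference quotient of one member of the family is the next member,
      which tends to 0.\<close>
    have "(\<lambda>h. (flat k (0 + h) - flat k 0) / h) = flat (k + 1)" by (auto simp: flat_def)
    then have "((\<lambda>h. (flat k (0 + h) - flat k 0) / h) \<longlongrightarrow> 0) (at 0)" using flat_tendsto_0[of "k + 1"] by (simp only:)
    then show ?thesis using 3 by (simp add: DERIV_def flat_def)
  qed
qed

text \<open>The induction on the order must run over all exponents at once, as a derivative raises
  \<open>k\<close> by 1 and by 2.\<close>

lemma C_k_flat_affine: "C_k n (\<lambda>x::'a::euclidean_space. flat k (c * (x \<bullet> i) + d))"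
proof (induction n arbitrary: k)
  case 0
  have "continuous_on UNIV (flat k)"
    by (rule DERIV_continuous_on) (rule has_field_derivative_at_within[OF flat_has_derivative])
  then have "continuous_on UNIV (\<lambda>x::'a. flat k (c * (x \<bullet> i) + d))"
    by (rule continuous_on_compose2) (auto intro!: continuous_intros)
  then show ?case by simp
next
  case (Suc n)
  have d: "((\<lambda>x::'a. flat k (c * (x \<bullet> i) + d)) has_derivative
      (\<lambda>h. (c * (h \<bullet> i)) * (flat (k + 2) (c * (x \<bullet> i) + d) + (- real k) * flat (k + 1) (c * (x \<bullet> i) + d)))) (at x)" for x
  proof -
    have "((\<lambda>x::'a. c * (x \<bullet> i) + d) has_derivative (\<lambda>h. c * (h \<bullet> i))) (at x)"
      by (auto intro!: derivative_eq_intros)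
    from has_derivative_compose[OF this flat_has_derivative[of k, unfolded has_field_derivative_def]]
    show ?thesis by (simp add: mult.commute)
  qed
  have "(\<lambda>x::'a. flat k (c * (x \<bullet> i) + d)) differentiable at x" for x using d[of x] differentiable_def by blast
  moreover have "C_k n (\<lambda>x::'a. (c * (b \<bullet> i)) * (flat (k + 2) (c * (x \<bullet> i) + d) + (- real k) * flat (k + 1) (c * (x \<bullet> i) + d)))" for b
    by (intro C_k_cmult C_k_add Suc)
  ultimately show ?case by (simp add: frechet_derivative_eqI[OF d])
qed

text \<open>A smooth substitute for the indicator of an open box: positive exactly inside, and the
  factor n + 1 lets exp(-1/((n+1)t)) rise to 1.\<close>

definition bump :: "nat \<Rightarrow> 'a::euclidean_space \<Rightarrow> 'a \<Rightarrow> 'a \<Rightarrow> real" where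
  "bump n a b x = (\<Prod>i\<in>Basis. flat 0 (real (Suc n) * (x \<bullet> i) + (- real (Suc n) * (a \<bullet> i))) *
      flat 0 (- real (Suc n) * (x \<bullet> i) + real (Suc n) * (b \<bullet> i)))"

lemma flat0_bounds: "0 \<le> flat 0 t" "flat 0 t \<le> 1" "flat 0 t \<noteq> 0 \<longleftrightarrow> t > 0"
  by (auto simp: flat_def)

lemma flat0_scaled_limit: "(\<lambda>n. flat 0 (real (Suc n) * t)) \<longlonglongrightarrow> (if t > 0 then 1 else 0)"
proof (cases "t > 0")
  case True
  have "(\<lambda>n. exp (- (1 / t) * (1 / real (Suc n)))) \<longlonglongrightarrow> exp (- (1 / t) * 0)"
    by (intro tendsto_intros LIMSEQ_inverse_Suc)
  moreover have "flat 0 (real (Suc n) * t) = exp (- (1 / t) * (1 / real (Suc n)))" for n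
  proof -
    have "real (Suc n) * t > 0" using True by simp
    then show ?thesis unfolding flat_def by (simp add: mult.commute)
  qed
  ultimately show ?thesis using True by simp
next
  case False
  then have "flat 0 (real (Suc n) * t) = 0" for n by (simp add: flat_def mult_less_0_iff not_less zero_less_mult_iff)
  then show ?thesis using False by simp
qed

lemma bump_props:
  shows "0 \<le> bump n a b x" "bump n a b x \<le> 1" "bump n a b x \<noteq> 0 \<Longrightarrow> x \<in> box a b"
    "(\<lambda>n. bump n a b x) \<longlonglongrightarrow> indicator (box a b) x" "C_k k (bump n a b)"
proof -
  have s1: "real (Suc n) * (x \<bullet> i) + (- real (Suc n) * (a \<bullet> i)) = real (Suc n) * (x \<bullet> i - a \<bullet> i)" for n i
    by (simp add: algebra_simps)
  have s2: "- real (Suc n) * (x \<bullet> i) + real (Suc n) * (b \<bullet> i) = real (Suc n) * (b \<bullet> i - x \<bullet> i)" for n i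
    by (simp add: algebra_simps)
  show "0 \<le> bump n a b x" unfolding bump_def by (intro prod_nonneg ballI mult_nonneg_nonneg flat0_bounds)
  show "bump n a b x \<le> 1" unfolding bump_def
    by (intro prod_le_1 conjI mult_nonneg_nonneg mult_le_one flat0_bounds)
  show "x \<in> box a b" if "bump n a b x \<noteq> 0"
  proof -
    have "flat 0 (real (Suc n) * (x \<bullet> i - a \<bullet> i)) \<noteq> 0 \<and> flat 0 (real (Suc n) * (b \<bullet> i - x \<bullet> i)) \<noteq> 0" if "i \<in> Basis" for i
      using \<open>bump n a b x \<noteq> 0\<close> that unfolding bump_def s1 s2 by simp
    then show ?thesis unfolding flat0_bounds(3) by (auto simp: mem_box zero_less_mult_iff)
  qed
  show "C_k k (bump n a b)" unfolding bump_def by (intro C_k_prod C_k_mult C_k_flat_affine finite_Basis)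
  have "(\<lambda>n. bump n a b x) \<longlonglongrightarrow> (\<Prod>i\<in>Basis. (if x \<bullet> i - a \<bullet> i > 0 then 1 else 0) * (if b \<bullet> i - x \<bullet> i > 0 then 1 else 0))"
    unfolding bump_def s1 s2 by (intro tendsto_prod tendsto_mult flat0_scaled_limit)
  also have "(\<Prod>i\<in>Basis. (if x \<bullet> i - a \<bullet> i > 0 then 1 else 0) * (if b \<bullet> i - x \<bullet> i > 0 then 1 else 0)) = (indicator (box a b) x :: real)"
  proof (cases "x \<in> box a b")
    case True
    then show ?thesis by (auto simp: mem_box intro!: prod.neutral)
  next
    case False
    then obtain i where "i \<in> Basis" "\<not> (a \<bullet> i < x \<bullet> i \<and> x \<bullet> i < b \<bullet> i)" by (auto simp: mem_box)
    then show ?thesis using False by (auto intro!: prod_zero bexI[of _ i])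
  qed
  finally show "(\<lambda>n. bump n a b x) \<longlonglongrightarrow> indicator (box a b) x" .
qed

lemma bump_test_function: "bump n a b \<in> test_functions \<Omega>" if "cbox a b \<subseteq> \<Omega>"
proof -
  have "closure {x. bump n a b x \<noteq> 0} \<subseteq> cbox a b"
    using bump_props(3)[of n a b] box_subset_cbox by (intro closure_minimal) auto
  then have "compact (closure {x. bump n a b x \<noteq> 0})"
    by (simp add: compact_eq_bounded_closed bounded_subset[OF bounded_cbox])
  then show ?thesis
    using that bump_props(5) \<open>closure {x. bump n a b x \<noteq> 0} \<subseteq> cbox a b\<close> by (auto simp: test_functions_def)
qed

lemma test_functionD:
  assumes "\<phi> \<in> test_functions \<Omega>"
  shows "\<phi> differentiable at x" "continuous_on UNIV \<phi>" "b \<in> Basis \<Longrightarrow> continuous_on UNIV (\<lambda>x. frechet_derivative \<phi> (at x) b)"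
    "compact (closure {x. \<phi> x \<noteq> 0})" "closure {x. \<phi> x \<noteq> 0} \<subseteq> \<Omega>"
    "x \<notin> closure {x. \<phi> x \<noteq> 0} \<Longrightarrow> \<phi> x = 0" "x \<notin> closure {x. \<phi> x \<noteq> 0} \<Longrightarrow> frechet_derivative \<phi> (at x) = (\<lambda>h. 0)"
proof -
  have c: "C_k 1 \<phi>" "C_k 0 \<phi>" using assms unfolding test_functions_def by blast+
  then show "\<phi> differentiable at x" "continuous_on UNIV \<phi>" "b \<in> Basis \<Longrightarrow> continuous_on UNIV (\<lambda>x. frechet_derivative \<phi> (at x) b)"
    by auto
  show "compact (closure {x. \<phi> x \<noteq> 0})" "closure {x. \<phi> x \<noteq> 0} \<subseteq> \<Omega>" using assms by (auto simp: test_functions_def)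
  have z: "\<phi> x = 0" if "x \<notin> closure {x. \<phi> x \<noteq> 0}" for x
    using that subsetD[OF closure_subset[of "{x. \<phi> x \<noteq> 0}"], of x] by blast
  then show "x \<notin> closure {x. \<phi> x \<noteq> 0} \<Longrightarrow> \<phi> x = 0" .
  show "frechet_derivative \<phi> (at x) = (\<lambda>h. 0)" if "x \<notin> closure {x. \<phi> x \<noteq> 0}"
  proof (rule frechet_derivative_eqI)
    have xC: "x \<in> - closure {x. \<phi> x \<noteq> 0}" using that by (simp only: Compl_iff not_False_eq_True)
    have "((\<lambda>x. 0 :: real) has_derivative (\<lambda>h. 0)) (at x)" by auto
    then show "(\<phi> has_derivative (\<lambda>h. 0)) (at x)"
      by (rule has_derivative_transform_within_open[OF _ open_Compl[OF closed_closure] xC])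
         (unfold Compl_iff, erule z[symmetric])
  qed
qed

lemma borel_imp_lebesgue_measurable: "f \<in> borel_measurable borel \<Longrightarrow> f \<in> borel_measurable lebesgue"
  by (rule measurable_completion) simp

lemmas continuous_lebesgue_measurable = borel_imp_lebesgue_measurable[OF borel_measurable_continuous_onI]

lemma integrable_lmeasurable_indicator: "K \<in> lmeasurable \<Longrightarrow> integrable lebesgue (indicator K :: 'a::euclidean_space \<Rightarrow> real)"
  by (rule integrable_real_indicator) (auto simp: fmeasurable_def)

lemma compact_support_bounded:
  fixes \<phi> :: "'a::euclidean_space \<Rightarrow> real"
  assumes c: "continuous_on UNIV \<phi>" and K: "compact K" and 0: "\<And>x. x \<notin> K \<Longrightarrow> \<phi> x = 0"
  shows "\<exists>B\<ge>0. \<forall>x. \<bar>\<phi> x\<bar> \<le> B"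
proof -
  have "bounded (\<phi> ` K)"
    by (rule compact_imp_bounded[OF compact_continuous_image[OF continuous_on_subset[OF c] K]]) simp
  then obtain B where B: "\<forall>x\<in>K. \<bar>\<phi> x\<bar> \<le> B" by (auto simp: bounded_iff)
  have bb: "\<bar>\<phi> x\<bar> \<le> max B 0" for x
  proof (cases "x \<in> K")
    case True
    then show ?thesis using B by force
  next
    case False
    then show ?thesis using 0[of x] by simp
  qed
  show ?thesis by (intro exI[of _ "max B 0"] conjI allI max.cobounded2 bb)
qed

lemma compact_support_integrable:
  fixes \<phi> :: "'a::euclidean_space \<Rightarrow> real"
  assumes "continuous_on UNIV \<phi>" "compact K" "\<And>x. x \<notin> K \<Longrightarrow> \<phi> x = 0"
  shows "integrable lebesgue \<phi>" "square_integrable \<phi>"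
proof -
  have m[measurable]: "\<phi> \<in> borel_measurable lebesgue"
    by (rule continuous_lebesgue_measurable[OF assms(1)])
  have K: "K \<in> lmeasurable" using assms(2) by (rule lmeasurable_compact)
  have *: "integrable lebesgue \<psi>" if c: "continuous_on UNIV \<psi>" and 0: "\<And>x. x \<notin> K \<Longrightarrow> \<psi> x = 0" for \<psi> :: "'a \<Rightarrow> real"
  proof -
    have "\<exists>B\<ge>0. \<forall>x. \<bar>\<psi> x\<bar> \<le> B" by (rule compact_support_bounded[OF c assms(2) 0])
    then obtain B where B: "B \<ge> 0" "\<And>x. \<bar>\<psi> x\<bar> \<le> B" by blast
    show ?thesis
    proof (rule Bochner_Integration.integrable_bound[of _ "\<lambda>x. B * indicator K x"])
      show "integrable lebesgue (\<lambda>x. B * indicator K x)" by (intro integrable_mult_right integrable_lmeasurable_indicator K)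
      show "\<psi> \<in> borel_measurable lebesgue" by (rule continuous_lebesgue_measurable[OF c])
      have "norm (\<psi> x) \<le> norm (B * indicator K x)" for x
        using B(1) B(2)[of x] 0[of x] by (cases "x \<in> K") auto
      then show "AE x in lebesgue. norm (\<psi> x) \<le> norm (B * indicator K x)" by simp
    qed
  qed
  show "integrable lebesgue \<phi>" by (rule *[OF assms(1,3)])
  have "integrable lebesgue (\<lambda>x. (norm (\<phi> x))\<^sup>2)"
    by (rule *) (auto intro!: continuous_intros assms(1) assms(3))
  then show "square_integrable \<phi>" unfolding square_integrable_def using m by blast
qed

text \<open>Bumps converge to indicators of boxes, so the integral of \<open>w\<close> over every
  closed box inside \<Omega> vanishes; Lebesgue differentiation along cubes recovers
  \<open>w\<close> at almost every point.\<close>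

lemma fundamental_lemma:
  fixes w :: "'a::euclidean_space \<Rightarrow> real"
  assumes w: "square_integrable w" and \<Omega>: "open \<Omega>"
    and zero: "\<And>\<phi>. \<phi> \<in> test_functions \<Omega> \<Longrightarrow> (LINT x|lebesgue. w x * \<phi> x) = 0"
  shows "AE x in lebesgue. x \<in> \<Omega> \<longrightarrow> w x = 0"
proof -
  have [measurable]: "w \<in> borel_measurable lebesgue" using w by measurable
  have [measurable]: "cbox a b \<in> sets lebesgue" "box a b \<in> sets lebesgue" for a b :: 'a
    by (auto intro: fmeasurableD)
  have int: "integrable lebesgue (\<lambda>x. indicator (cbox a b) x * w x)" for a b
  proof (rule Bochner_Integration.integrable_bound[of _ "\<lambda>x. indicator (cbox a b) x + (norm (w x))\<^sup>2"])
    show "integrable lebesgue (\<lambda>x. indicator (cbox a b) x + (norm (w x))\<^sup>2 :: real)"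
      by (intro Bochner_Integration.integrable_add square_integrable_integrable[OF w] integrable_lmeasurable_indicator lmeasurable_cbox)
    have "\<bar>t\<bar> \<le> 1 + t\<^sup>2" for t :: real
      using zero_le_power2[of "\<bar>t\<bar> - 1"] zero_le_power2[of t] by (simp add: power2_diff)
    then show "AE x in lebesgue. norm (indicator (cbox a b) x * w x) \<le> norm (indicator (cbox a b) x + (norm (w x))\<^sup>2)"
      by (intro AE_I2) (auto simp: indicator_def)
  qed simp
  have HK: "w absolutely_integrable_on cbox a b" for a b
    using int[of a b] by (simp add: set_integrable_def)
  have box0: "integral (cbox a b) w = 0" if "cbox a b \<subseteq> \<Omega>" for a b
  proof -
    have lim: "(\<lambda>n. LINT x|lebesgue. w x * bump n a b x) \<longlonglongrightarrow> (LINT x|lebesgue. w x * indicator (box a b) x)"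
    proof (rule integral_dominated_convergence[where w = "\<lambda>x. norm (indicator (cbox a b) x * w x)"])
      show "(\<lambda>x. w x * bump n a b x) \<in> borel_measurable lebesgue" for n
      proof -
        have "continuous_on UNIV (bump n a b)" using bump_props(5)[of 0] by auto
        then have [measurable]: "bump n a b \<in> borel_measurable lebesgue"
          by (rule continuous_lebesgue_measurable)
        show ?thesis by simp
      qed
      show "AE x in lebesgue. (\<lambda>n. w x * bump n a b x) \<longlonglongrightarrow> w x * indicator (box a b) x"
        by (intro AE_I2 tendsto_mult tendsto_const bump_props)
      show "AE x in lebesgue. norm (w x * bump n a b x) \<le> norm (indicator (cbox a b) x * w x)" for n
      proof (intro AE_I2)
        fix x
        show "norm (w x * bump n a b x) \<le> norm (indicator (cbox a b) x * w x)"
        proof (cases "bump n a b x = 0")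
          case False
          then have "x \<in> cbox a b" using bump_props(3) box_subset_cbox by blast
          then show ?thesis using bump_props(1,2)[of n a b x] by (simp add: abs_mult mult_left_le)
        qed simp
      qed
    qed (use int in auto)
    have z0: "(LINT x|lebesgue. w x * bump n a b x) = 0" for n by (rule zero[OF bump_test_function[OF that]])
    have "(LINT x|lebesgue. w x * indicator (box a b) x) = 0" using lim unfolding z0 by (simp only: LIMSEQ_const_iff)
    moreover have "(LINT x|lebesgue. w x * indicator (box a b) x) = (LINT x|lebesgue. indicator (cbox a b) x *\<^sub>R w x)"
    proof (rule integral_cong_AE)
      have "negligible (cbox a b - box a b)" using negligible_frontier_interval by blast
      then have "AE x in lebesgue. x \<notin> cbox a b - box a b"
        unfolding negligible_iff_null_sets by (rule AE_not_in)
      then show "AE x in lebesgue. w x * indicator (box a b) x = indicator (cbox a b) x *\<^sub>R w x"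
        by eventually_elim (use box_subset_cbox in \<open>auto simp: indicator_def\<close>)
    qed auto
    ultimately show ?thesis using set_lebesgue_integral_eq_integral(2)[OF HK[of a b]]
      by (simp add: set_lebesgue_integral_def)
  qed
  obtain N where N: "negligible N" and lim: "\<And>x e. \<lbrakk>x \<notin> N; 0 < e\<rbrakk> \<Longrightarrow>
      \<exists>d>0. \<forall>h. 0 < h \<and> h < d \<longrightarrow> norm (integral (cbox x (x + h *\<^sub>R One)) w /\<^sub>R h ^ DIM('a) - w x) < e"
    by (rule integrable_ccontinuous_explicit[OF set_lebesgue_integral_eq_integral(1)[OF HK]]) (rule that, assumption, blast)
  have "w x = 0" if x: "x \<in> \<Omega>" "x \<notin> N" for x
  proof (rule ccontr)
    assume "w x \<noteq> 0"
    then obtain d where d: "d > 0" "\<And>h. 0 < h \<Longrightarrow> h < d \<Longrightarrow> norm (integral (cbox x (x + h *\<^sub>R One)) w /\<^sub>R h ^ DIM('a) - w x) < \<bar>w x\<bar>"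
      using lim[OF x(2), of "\<bar>w x\<bar>"] by auto
    obtain \<rho> where \<rho>: "\<rho> > 0" "cball x \<rho> \<subseteq> \<Omega>" using \<Omega> x open_contains_cball by blast
    \<comment> \<open>Points of the cube of side \<open>h\<close> are within
      \<open>h * DIM('a)\<close> of its corner \<open>x\<close>, so the cube stays inside the
      ball.\<close>
    define h where "h = min (d / 2) (\<rho> / DIM('a))"
    have h: "h > 0" "h < d" "h * DIM('a) \<le> \<rho>" using d(1) \<rho>(1) by (auto simp: h_def min_def field_simps)
    have "cbox x (x + h *\<^sub>R One) \<subseteq> cball x \<rho>"
    proof
      fix y assume y: "y \<in> cbox x (x + h *\<^sub>R One)"
      have "norm (y - x) \<le> (\<Sum>i\<in>Basis. \<bar>(y - x) \<bullet> i\<bar>)" by (rule norm_le_l1)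
      also have "\<dots> \<le> (\<Sum>i\<in>(Basis::'a set). h)"
        using y by (intro sum_mono) (auto simp: mem_box inner_add_left inner_diff_left abs_le_iff)
      also have "\<dots> \<le> \<rho>" using h by (simp add: mult.commute)
      finally show "y \<in> cball x \<rho>" by (simp add: dist_norm norm_minus_commute)
    qed
    then have "integral (cbox x (x + h *\<^sub>R One)) w = 0" using \<rho> by (intro box0) auto
    then show False using d(2)[OF h(1,2)] by simp
  qed
  then show ?thesis using N
    by (intro AE_I'[of N]) (auto simp: negligible_iff_null_sets)
qed

lemma lebesgue_integral_translation:
  fixes f :: "'a::euclidean_space \<Rightarrow> real"
  assumes "f \<in> borel_measurable borel"
  shows "(LINT x|lebesgue. f (x + c)) = (LINT x|lebesgue. f x)"
proof -
  have "(LINT x|lborel. f x) = (LINT x|distr lborel borel ((+) c). f x)" by (simp add: lborel_distr_plus)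
  also have "\<dots> = (LINT x|lborel. f (c + x))" using assms by (intro integral_distr) auto
  finally show ?thesis using assms by (simp add: integral_completion add.commute)
qed

text \<open>By translation invariance every difference quotient has integral 0, and dominated
  convergence passes to the derivative. This is the integration by parts behind weak gradients of
  test functions.\<close>

lemma integral_partial_derivative_zero:
  fixes \<phi> :: "'a::euclidean_space \<Rightarrow> real"
  assumes d: "\<And>x. \<phi> differentiable at x" and c: "continuous_on UNIV (\<lambda>x. frechet_derivative \<phi> (at x) b)"
    and K: "compact K" "\<And>x. x \<notin> K \<Longrightarrow> \<phi> x = 0" "\<And>x. x \<notin> K \<Longrightarrow> frechet_derivative \<phi> (at x) b = 0"
    and b: "norm b \<le> 1"
  shows "(LINT x|lebesgue. frechet_derivative \<phi> (at x) b) = 0"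
proof -
  have cont: "continuous_on UNIV \<phi>"
    using d by (auto intro!: differentiable_imp_continuous_on simp: differentiable_on_def differentiable_at_withinI)
  then have [measurable]: "\<phi> \<in> borel_measurable borel" by (rule borel_measurable_continuous_onI)
  have "\<exists>B\<ge>0. \<forall>x. \<bar>frechet_derivative \<phi> (at x) b\<bar> \<le> B" by (rule compact_support_bounded[OF c K(1,3)])
  then obtain B where B: "B \<ge> 0" "\<And>x. \<bar>frechet_derivative \<phi> (at x) b\<bar> \<le> B" by blast
  have line: "((\<lambda>t. \<phi> (x + t *\<^sub>R b)) has_real_derivative frechet_derivative \<phi> (at (x + t *\<^sub>R b)) b) (at t)" for x t
  proof -
    have "((\<lambda>t. x + t *\<^sub>R b) has_derivative (\<lambda>s. s *\<^sub>R b)) (at t)" by (auto intro!: derivative_eq_intros)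
    from has_derivative_compose[OF this d[of "x + t *\<^sub>R b", unfolded frechet_derivative_works]]
    have "((\<lambda>t. \<phi> (x + t *\<^sub>R b)) has_derivative (\<lambda>s. frechet_derivative \<phi> (at (x + t *\<^sub>R b)) (s *\<^sub>R b))) (at t)" .
    moreover have "frechet_derivative \<phi> (at (x + t *\<^sub>R b)) (s *\<^sub>R b) = frechet_derivative \<phi> (at (x + t *\<^sub>R b)) b * s" for s
      using linear_frechet_derivative[OF d] by (simp add: linear_scale)
    ultimately show ?thesis by (simp add: has_field_derivative_def)
  qed
  define D where "D = (\<lambda>n x. real (Suc n) * (\<phi> (x + (1 / real (Suc n)) *\<^sub>R b) - \<phi> x))"
  obtain r where r: "\<And>x. x \<in> K \<Longrightarrow> norm x \<le> r" using compact_imp_bounded[OF K(1)] by (auto simp: bounded_iff)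
  \<comment> \<open>The mean value theorem bounds the quotients by \<open>B\<close>; shifts have
    length at most 1, so enlarging the radius by 1 contains all supports.\<close>
  have Dbound: "\<bar>D n x\<bar> \<le> B * indicator (cball 0 (r + 1)) x" for n x
  proof (cases "x \<in> cball 0 (r + 1)")
    case True
    define s where "s = 1 / real (Suc n)"
    have "\<exists>\<xi>. 0 < \<xi> \<and> \<xi> < s \<and> \<phi> (x + s *\<^sub>R b) - \<phi> (x + 0 *\<^sub>R b) = (s - 0) * frechet_derivative \<phi> (at (x + \<xi> *\<^sub>R b)) b"
      using line by (intro MVT2) (auto simp: s_def)
    then obtain \<xi> where "\<phi> (x + s *\<^sub>R b) - \<phi> x = s * frechet_derivative \<phi> (at (x + \<xi> *\<^sub>R b)) b" by auto
    then have "D n x = frechet_derivative \<phi> (at (x + \<xi> *\<^sub>R b)) b" by (simp add: D_def s_def)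
    then show ?thesis using B True by simp
  next
    case False
    have "x \<notin> K" using False r by fastforce
    moreover have "x + (1 / real (Suc n)) *\<^sub>R b \<notin> K"
    proof
      assume "x + (1 / real (Suc n)) *\<^sub>R b \<in> K"
      then have 1: "norm (x + (1 / real (Suc n)) *\<^sub>R b) \<le> r" by (rule r)
      have "norm ((1 / real (Suc n)) *\<^sub>R b) \<le> 1 * 1" unfolding norm_scaleR using b by (intro mult_mono) auto
      moreover have "norm x \<le> norm (x + (1 / real (Suc n)) *\<^sub>R b) + norm ((1 / real (Suc n)) *\<^sub>R b)"
        using norm_triangle_ineq4[of "x + (1 / real (Suc n)) *\<^sub>R b" "(1 / real (Suc n)) *\<^sub>R b"] by (simp only: add_diff_cancel_right')
      ultimately have "norm x \<le> r + 1" using 1 by linarith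
      then show False using False by simp
    qed
    ultimately show ?thesis using K(2) False by (simp add: D_def)
  qed
  have "(\<lambda>n. LINT x|lebesgue. D n x) \<longlonglongrightarrow> (LINT x|lebesgue. frechet_derivative \<phi> (at x) b)"
  proof (rule integral_dominated_convergence[where w = "\<lambda>x. B * indicator (cball 0 (r + 1)) x"])
    show "integrable lebesgue (\<lambda>x. B * indicator (cball 0 (r + 1)) (x::'a))"
      by (intro integrable_mult_right integrable_lmeasurable_indicator lmeasurable_cball)
    show "(\<lambda>x. frechet_derivative \<phi> (at x) b) \<in> borel_measurable lebesgue"
      by (rule continuous_lebesgue_measurable[OF c])
    have "D n \<in> borel_measurable borel" for n unfolding D_def by measurable
    then show "D n \<in> borel_measurable lebesgue" for n by (rule borel_imp_lebesgue_measurable)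
    show "AE x in lebesgue. norm (D n x) \<le> B * indicator (cball 0 (r + 1)) x" for n using Dbound by simp
    show "AE x in lebesgue. (\<lambda>n. D n x) \<longlonglongrightarrow> frechet_derivative \<phi> (at x) b"
    proof (intro AE_I2)
      fix x
      have "((\<lambda>h. (\<phi> (x + (0 + h) *\<^sub>R b) - \<phi> (x + 0 *\<^sub>R b)) / h) \<longlongrightarrow> frechet_derivative \<phi> (at (x + 0 *\<^sub>R b)) b) (at 0)"
        using line[of x 0] unfolding DERIV_def .
      moreover have "filterlim (\<lambda>n. 1 / real (Suc n)) (at 0) sequentially"
        using LIMSEQ_inverse_Suc by (simp add: filterlim_at)
      ultimately have "(\<lambda>n. (\<phi> (x + (0 + 1 / real (Suc n)) *\<^sub>R b) - \<phi> (x + 0 *\<^sub>R b)) / (1 / real (Suc n))) \<longlonglongrightarrow> frechet_derivative \<phi> (at (x + 0 *\<^sub>R b)) b"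
        by (rule filterlim_compose)
      then show "(\<lambda>n. D n x) \<longlonglongrightarrow> frechet_derivative \<phi> (at x) b" by (simp add: D_def mult.commute)
    qed
  qed
  moreover have "(LINT x|lebesgue. D n x) = 0" for n
  proof -
    have i: "integrable lebesgue \<phi>" by (rule compact_support_integrable(1)[OF cont K(1,2)])
    have "integrable lebesgue (\<lambda>x. \<phi> (x + (1 / real (Suc n)) *\<^sub>R b))"
    proof (rule compact_support_integrable(1)[of _ "(\<lambda>x. x - (1 / real (Suc n)) *\<^sub>R b) ` K"])
      show "continuous_on UNIV (\<lambda>x. \<phi> (x + (1 / real (Suc n)) *\<^sub>R b))"
        by (rule continuous_on_compose2[OF cont]) (auto intro: continuous_intros)
      show "compact ((\<lambda>x. x - (1 / real (Suc n)) *\<^sub>R b) ` K)" using K(1) by (rule compact_translation_subtract)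
      show "\<phi> (x + (1 / real (Suc n)) *\<^sub>R b) = 0" if "x \<notin> (\<lambda>x. x - (1 / real (Suc n)) *\<^sub>R b) ` K" for x
        using that by (intro K(2)) (metis add_diff_cancel_right' image_eqI)
    qed
    then show ?thesis unfolding D_def using i lebesgue_integral_translation[of \<phi> "(1 / real (Suc n)) *\<^sub>R b"] by simp
  qed
  ultimately show ?thesis using LIMSEQ_unique[of "\<lambda>n. 0 :: real"] by simp
qed

section \<open>Friedrichs' inequality\<close>

definition grad :: "('a::euclidean_space \<Rightarrow> real) \<Rightarrow> 'a \<Rightarrow> 'a" where
  "grad \<phi> x = (\<Sum>b\<in>Basis. frechet_derivative \<phi> (at x) b *\<^sub>R b)"

lemma frechet_derivative_grad:
  assumes "\<phi> differentiable at x"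
  shows "frechet_derivative \<phi> (at x) z = grad \<phi> x \<bullet> z"
proof -
  have "frechet_derivative \<phi> (at x) z = frechet_derivative \<phi> (at x) (\<Sum>b\<in>Basis. (z \<bullet> b) *\<^sub>R b)"
    by (simp add: euclidean_representation)
  also have "\<dots> = (\<Sum>b\<in>Basis. (z \<bullet> b) * frechet_derivative \<phi> (at x) b)"
    using linear_frechet_derivative[OF assms] by (simp add: linear_sum linear_scale)
  finally show ?thesis unfolding grad_def inner_sum_left inner_scaleR_left by (simp add: inner_commute mult.commute)
qed

text \<open>Cauchy-Schwarz against the constant 1. The right-hand side is a nonnegative extended
  integral, ready for an exchange of integrations.\<close>

lemma integral_square_le:
  assumes M: "finite_measure M" and [measurable]: "h \<in> borel_measurable M" and B: "\<And>x. \<bar>h x\<bar> \<le> (B :: real)"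
  shows "ennreal ((LINT x|M. h x)\<^sup>2) \<le> ennreal (measure M (space M)) * (\<integral>\<^sup>+x. ennreal ((h x)\<^sup>2) \<partial>M)"
proof -
  interpret finite_measure M by fact
  have i1: "integrable M h" by (rule integrable_const_bound[of _ B]) (use B in auto)
  have "(h x)\<^sup>2 \<le> B\<^sup>2" for x using power_mono[OF B[of x], of 2] by simp
  then have i2: "integrable M (\<lambda>x. (h x)\<^sup>2)" by (intro integrable_const_bound[of _ "B\<^sup>2"]) auto
  define c where "c = (LINT x|M. h x)"
  define V where "V = measure M (space M)"
  define I where "I = (LINT x|M. (h x)\<^sup>2)"
  have I0: "I \<ge> 0" unfolding I_def by (rule integral_nonneg_AE) simp
  \<comment> \<open>The square of \<open>V * h - c\<close> instead of \<open>h - c / V\<close>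
    avoids dividing by a total mass that may be 0.\<close>
  have "0 \<le> (LINT x|M. (V * h x - c)\<^sup>2)" by (rule integral_nonneg_AE) simp
  also have "(\<lambda>x. (V * h x - c)\<^sup>2) = (\<lambda>x. V\<^sup>2 * (h x)\<^sup>2 - (2 * V * c) * h x + c\<^sup>2)"
    by (auto simp: power2_eq_square algebra_simps)
  also have "(LINT x|M. V\<^sup>2 * (h x)\<^sup>2 - (2 * V * c) * h x + c\<^sup>2) = V\<^sup>2 * I - (2 * V * c) * c + c\<^sup>2 * V"
    using i1 i2 by (simp add: c_def V_def I_def)
  finally have *: "0 \<le> V * (V * I - c\<^sup>2)" by (simp add: power2_eq_square algebra_simps)
  have V0: "V \<ge> 0" by (simp add: V_def)
  have "c\<^sup>2 \<le> V * I"
  proof (cases "V = 0")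
    case True
    then have "emeasure M (space M) = 0" by (simp add: V_def emeasure_eq_measure)
    then have "AE x in M. h x = 0" by (intro AE_I[of _ _ "space M"]) auto
    then have "c = 0" unfolding c_def by (rule integral_eq_zero_AE)
    then show ?thesis using V0 I0 by simp
  next
    case False
    then show ?thesis using * V0 by (simp add: zero_le_mult_iff)
  qed
  then have "ennreal (c\<^sup>2) \<le> ennreal (V * I)" by (rule ennreal_leI)
  also have "\<dots> = ennreal V * ennreal I" using V0 I0 by (simp add: ennreal_mult)
  also have "ennreal I = (\<integral>\<^sup>+x. ennreal ((h x)\<^sup>2) \<partial>M)" unfolding I_def by (rule nn_integral_eq_integral[symmetric]) (use i2 in auto)
  finally show ?thesis by (simp add: c_def V_def)
qed

lemma nn_integral_translation:
  fixes f :: "'a::euclidean_space \<Rightarrow> ennreal"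
  assumes [measurable]: "f \<in> borel_measurable borel"
  shows "(\<integral>\<^sup>+x. f (c + x) \<partial>lborel) = (\<integral>\<^sup>+x. f x \<partial>lborel)"
proof -
  have "(\<integral>\<^sup>+x. f x \<partial>lborel) = (\<integral>\<^sup>+x. f x \<partial>distr lborel borel ((+) c))" by (simp add: lborel_distr_plus)
  also have "\<dots> = (\<integral>\<^sup>+x. f (c + x) \<partial>lborel)" by (rule nn_integral_distr) auto
  finally show ?thesis by simp
qed

text \<open>The increment is the integral of the directional derivative along the segment;
  Cauchy-Schwarz in the parameter, an exchange of integrations and translation invariance give the
  bound.\<close>

lemma translation_estimate:
  fixes \<phi> :: "'a::euclidean_space \<Rightarrow> real"
  assumes d: "\<And>x. \<phi> differentiable at x" and c: "continuous_on UNIV (grad \<phi>)" and B: "\<And>x. norm (grad \<phi> x) \<le> B"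
  shows "(\<integral>\<^sup>+x. ennreal ((\<phi> (x + z) - \<phi> x)\<^sup>2) \<partial>lborel) \<le> ennreal ((norm z)\<^sup>2) * (\<integral>\<^sup>+x. ennreal ((norm (grad \<phi> x))\<^sup>2) \<partial>lborel)"
proof -
  have [measurable]: "grad \<phi> \<in> borel_measurable borel" using c by (rule borel_measurable_continuous_onI)
  have line: "((\<lambda>t. \<phi> (x + t *\<^sub>R z)) has_vector_derivative (grad \<phi> (x + t *\<^sub>R z) \<bullet> z)) (at t within T)" for x t T
  proof -
    have "((\<lambda>t. x + t *\<^sub>R z) has_derivative (\<lambda>s. s *\<^sub>R z)) (at t)" by (auto intro!: derivative_eq_intros)
    from has_derivative_compose[OF this d[of "x + t *\<^sub>R z", unfolded frechet_derivative_works]]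
    have "((\<lambda>t. \<phi> (x + t *\<^sub>R z)) has_derivative (\<lambda>s. s *\<^sub>R (grad \<phi> (x + t *\<^sub>R z) \<bullet> z))) (at t)"
      by (simp add: frechet_derivative_grad[OF d])
    then show ?thesis unfolding has_vector_derivative_def by (rule has_derivative_at_withinI)
  qed
  let ?I = "restrict_space lborel {0..1::real}"
  have space: "space ?I = {0..1}" by (simp add: space_restrict_space)
  have meas: "measure ?I (space ?I) = 1" by (simp add: space measure_restrict_space)
  have fin: "finite_measure ?I" by (rule finite_measureI) (simp add: space emeasure_restrict_space)
  have pt: "ennreal ((\<phi> (x + z) - \<phi> x)\<^sup>2) \<le> (\<integral>\<^sup>+t. indicator {0..1} t * ennreal ((grad \<phi> (x + t *\<^sub>R z) \<bullet> z)\<^sup>2) \<partial>lborel)" for x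
  proof -
    have cl: "continuous_on {0..1::real} (\<lambda>t. grad \<phi> (x + t *\<^sub>R z) \<bullet> z)"
      by (intro continuous_intros continuous_on_compose2[OF c]) auto
    have "(LBINT t. indicator {0..1} t *\<^sub>R (grad \<phi> (x + t *\<^sub>R z) \<bullet> z)) = \<phi> (x + 1 *\<^sub>R z) - \<phi> (x + 0 *\<^sub>R z)"
      by (rule integral_FTC_Icc[OF _ line cl]) simp
    then have e: "\<phi> (x + z) - \<phi> x = (LINT t|?I. grad \<phi> (x + t *\<^sub>R z) \<bullet> z)"
      by (simp add: integral_restrict_space)
    have "ennreal ((\<phi> (x + z) - \<phi> x)\<^sup>2) \<le> ennreal (measure ?I (space ?I)) * (\<integral>\<^sup>+t. ennreal ((grad \<phi> (x + t *\<^sub>R z) \<bullet> z)\<^sup>2) \<partial>?I)"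
      unfolding e
    proof (rule integral_square_le[OF fin, of _ "B * norm z"])
      show "(\<lambda>t. grad \<phi> (x + t *\<^sub>R z) \<bullet> z) \<in> borel_measurable ?I" by (rule measurable_restrict_space1) measurable
      show "\<bar>grad \<phi> (x + t *\<^sub>R z) \<bullet> z\<bar> \<le> B * norm z" for t
        using Cauchy_Schwarz_ineq2[of "grad \<phi> (x + t *\<^sub>R z)" z] mult_right_mono[OF B[of "x + t *\<^sub>R z"], of "norm z"] by simp
    qed
    then show ?thesis unfolding meas by (simp add: nn_integral_restrict_space mult.commute)
  qed
  have "(\<integral>\<^sup>+x. ennreal ((\<phi> (x + z) - \<phi> x)\<^sup>2) \<partial>lborel) \<le> (\<integral>\<^sup>+x. (\<integral>\<^sup>+t. indicator {0..1} t * ennreal ((grad \<phi> (x + t *\<^sub>R z) \<bullet> z)\<^sup>2) \<partial>lborel) \<partial>lborel)"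
    by (rule nn_integral_mono) (rule pt)
  also have "\<dots> = (\<integral>\<^sup>+t. (\<integral>\<^sup>+x. indicator {0..1} t * ennreal ((grad \<phi> (x + t *\<^sub>R z) \<bullet> z)\<^sup>2) \<partial>lborel) \<partial>lborel)"
  proof -
    have "(\<lambda>(x::'a, t::real). indicator {0..1} t * ennreal ((grad \<phi> (x + t *\<^sub>R z) \<bullet> z)\<^sup>2)) \<in> borel_measurable (lborel \<Otimes>\<^sub>M lborel)"
      by measurable
    from lborel_pair.Fubini[OF this] show ?thesis by simp
  qed
  also have "\<dots> = (\<integral>\<^sup>+t. indicator {0..1} (t::real) * (\<integral>\<^sup>+x. ennreal ((grad \<phi> x \<bullet> z)\<^sup>2) \<partial>lborel) \<partial>lborel)"
  proof (rule nn_integral_cong)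
    fix t :: real
    have "(\<integral>\<^sup>+x. ennreal ((grad \<phi> (t *\<^sub>R z + x) \<bullet> z)\<^sup>2) \<partial>lborel) = (\<integral>\<^sup>+x. ennreal ((grad \<phi> x \<bullet> z)\<^sup>2) \<partial>lborel)"
      by (rule nn_integral_translation) measurable
    then show "(\<integral>\<^sup>+x. indicator {0..1} t * ennreal ((grad \<phi> (x + t *\<^sub>R z) \<bullet> z)\<^sup>2) \<partial>lborel) = indicator {0..1} t * (\<integral>\<^sup>+x. ennreal ((grad \<phi> x \<bullet> z)\<^sup>2) \<partial>lborel)"
      by (simp add: nn_integral_cmult add.commute)
  qed
  also have "\<dots> = (\<integral>\<^sup>+x. ennreal ((grad \<phi> x \<bullet> z)\<^sup>2) \<partial>lborel)" by (simp add: nn_integral_multc)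
  also have "\<dots> \<le> (\<integral>\<^sup>+x. ennreal ((norm z)\<^sup>2) * ennreal ((norm (grad \<phi> x))\<^sup>2) \<partial>lborel)"
  proof (rule nn_integral_mono)
    fix x
    have "\<bar>grad \<phi> x \<bullet> z\<bar>\<^sup>2 \<le> (norm (grad \<phi> x) * norm z)\<^sup>2" by (intro power_mono Cauchy_Schwarz_ineq2) auto
    then show "ennreal ((grad \<phi> x \<bullet> z)\<^sup>2) \<le> ennreal ((norm z)\<^sup>2) * ennreal ((norm (grad \<phi> x))\<^sup>2)"
      by (simp add: power_mult_distrib mult.commute flip: ennreal_mult)
  qed
  also have "\<dots> = ennreal ((norm z)\<^sup>2) * (\<integral>\<^sup>+x. ennreal ((norm (grad \<phi> x))\<^sup>2) \<partial>lborel)" by (rule nn_integral_cmult) measurable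
  finally show ?thesis .
qed

definition cell :: "real \<Rightarrow> ('a::euclidean_space \<Rightarrow> int) \<Rightarrow> 'a set" where
  "cell \<delta> k = {x. \<forall>i\<in>Basis. real_of_int (k i) * \<delta> \<le> x \<bullet> i \<and> x \<bullet> i < (real_of_int (k i) + 1) * \<delta>}"

text \<open>Restriction to \<open>Basis\<close> makes indices canonical: those that agree on
  \<open>Basis\<close> are equal, and a bounded set meets finitely many.\<close>

definition cell_index :: "real \<Rightarrow> 'a::euclidean_space \<Rightarrow> 'a \<Rightarrow> int" where
  "cell_index \<delta> x = (\<lambda>i\<in>Basis. \<lfloor>(x \<bullet> i) / \<delta>\<rfloor>)"

lemma cell_measurable [measurable]: "cell \<delta> k \<in> sets borel"
proof -
  have "cell \<delta> k = (\<Inter>i\<in>Basis. {x. real_of_int (k i) * \<delta> \<le> x \<bullet> i} \<inter> {x. x \<bullet> i < (real_of_int (k i) + 1) * \<delta>})"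
    by (auto simp: cell_def)
  also have "\<dots> \<in> sets borel" by (intro sets.countable_INT'' sets.finite_INT) (auto intro: borel_closed borel_open closed_halfspace_component_ge open_halfspace_component_lt)
  finally show ?thesis .
qed

lemma cell_index_mem: "\<delta> > 0 \<Longrightarrow> x \<in> cell \<delta> (cell_index \<delta> x)"
proof -
  assume \<delta>: "\<delta> > 0"
  have "real_of_int \<lfloor>t / \<delta>\<rfloor> * \<delta> \<le> t" "t < (real_of_int \<lfloor>t / \<delta>\<rfloor> + 1) * \<delta>" for t
  proof -
    have h: "real_of_int \<lfloor>t / \<delta>\<rfloor> \<le> t / \<delta>" "t / \<delta> < real_of_int \<lfloor>t / \<delta>\<rfloor> + 1" by linarith+
    show "real_of_int \<lfloor>t / \<delta>\<rfloor> * \<delta> \<le> t" using h(1) unfolding pos_le_divide_eq[OF \<delta>] .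
    show "t < (real_of_int \<lfloor>t / \<delta>\<rfloor> + 1) * \<delta>" using h(2) unfolding pos_divide_less_eq[OF \<delta>] .
  qed
  then show ?thesis by (simp add: cell_def cell_index_def)
qed

lemma emeasure_cell:
  fixes k :: "'a::euclidean_space \<Rightarrow> int"
  assumes \<delta>: "\<delta> > 0" shows "emeasure lborel (cell \<delta> k) = ennreal (\<delta> ^ DIM('a))"
proof -
  define a where "a = (\<Sum>i\<in>Basis. (real_of_int (k i) * \<delta>) *\<^sub>R i)"
  define b where "b = a + \<delta> *\<^sub>R One"
  have ab: "a \<bullet> i = real_of_int (k i) * \<delta>" "b \<bullet> i = (real_of_int (k i) + 1) * \<delta>" if "i \<in> Basis" for i
    using that by (simp_all add: a_def b_def inner_add_left algebra_simps)
  have p: "(\<Prod>i\<in>Basis. (b - a) \<bullet> i) = \<delta> ^ DIM('a)" by (simp add: b_def)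
  have le: "a \<bullet> i \<le> b \<bullet> i" if "i \<in> Basis" for i using that ab \<delta> by (simp add: algebra_simps)
  have "box a b \<subseteq> cell \<delta> k" "cell \<delta> k \<subseteq> cbox a b" using ab by (auto simp: cell_def mem_box less_imp_le)
  then have "emeasure lborel (box a b) \<le> emeasure lborel (cell \<delta> k)" "emeasure lborel (cell \<delta> k) \<le> emeasure lborel (cbox a b)"
    by (auto intro!: emeasure_mono)
  then show ?thesis using le p by (simp add: emeasure_lborel_box emeasure_lborel_cbox)
qed

lemma finite_cell_indices:
  fixes \<Omega> :: "'a::euclidean_space set"
  assumes "bounded \<Omega>" "\<delta> > 0"
  shows "finite (cell_index \<delta> ` \<Omega>)"
proof -
  obtain r where r: "\<And>x. x \<in> \<Omega> \<Longrightarrow> norm x \<le> r" using assms(1) by (auto simp: bounded_iff)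
  have "cell_index \<delta> ` \<Omega> \<subseteq> PiE Basis (\<lambda>_. {\<lfloor>- r / \<delta>\<rfloor>..\<lfloor>r / \<delta>\<rfloor>})"
  proof
    fix k assume "k \<in> cell_index \<delta> ` \<Omega>"
    then obtain x where x: "x \<in> \<Omega>" "k = cell_index \<delta> x" by blast
    have "\<bar>x \<bullet> i\<bar> \<le> r" if "i \<in> Basis" for i using Basis_le_norm[OF that, of x] r[OF x(1)] by simp
    then have "\<lfloor>- r / \<delta>\<rfloor> \<le> \<lfloor>(x \<bullet> i) / \<delta>\<rfloor> \<and> \<lfloor>(x \<bullet> i) / \<delta>\<rfloor> \<le> \<lfloor>r / \<delta>\<rfloor>" if "i \<in> Basis" for i
      using that assms(2) by (intro conjI floor_mono divide_right_mono) (auto simp: abs_le_iff minus_le_iff)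
    then show "k \<in> PiE Basis (\<lambda>_. {\<lfloor>- r / \<delta>\<rfloor>..\<lfloor>r / \<delta>\<rfloor>})" unfolding x(2) by (auto simp: cell_index_def)
  qed
  then show ?thesis by (rule finite_subset) (auto intro: finite_PiE)
qed

lemma cell_index_unique:
  assumes "\<delta> > 0" "x \<in> cell \<delta> k" "i \<in> Basis"
  shows "k i = cell_index \<delta> x i"
proof -
  have "real_of_int (k i) * \<delta> \<le> x \<bullet> i" "x \<bullet> i < (real_of_int (k i) + 1) * \<delta>" using assms by (auto simp: cell_def)
  then have "real_of_int (k i) \<le> (x \<bullet> i) / \<delta>" "(x \<bullet> i) / \<delta> < real_of_int (k i) + 1"
    using assms(1) by (auto simp: pos_le_divide_eq pos_divide_less_eq)
  then show ?thesis using assms(3) by (simp add: cell_index_def floor_unique)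
qed

text \<open>On a grid of small cubes \<phi> is compared with its cell means, which are the finitely
  many functionals. The deviation from the mean is an average of increments \<phi>(x + z) -
  \<phi>(x) with z in a small cube, so \<open>translation_estimate\<close> controls it.\<close>

lemma friedrichs_inequality_test:
  fixes \<Omega> :: "'a::euclidean_space set"
  assumes \<Omega>: "bounded \<Omega>" and \<epsilon>: "\<epsilon> > 0"
  shows "\<exists>W :: ('a \<Rightarrow> real) set. finite W \<and> (\<forall>w\<in>W. square_integrable w) \<and> (\<forall>\<phi>\<in>test_functions \<Omega>.
    (LINT x|lebesgue. (\<phi> x)\<^sup>2) \<le> (\<Sum>w\<in>W. (LINT x|lebesgue. \<phi> x * w x)\<^sup>2) + \<epsilon> * (LINT x|lebesgue. (norm (grad \<phi> x))\<^sup>2))"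
proof -
  define n where "n = DIM('a)"
  \<comment> \<open>The factor 2 comes from the square of a sum, \<open>2 ^ n\<close> from the
    volume of the cube \<open>D\<close> of side 2\<delta> relative to a cell, and
    \<open>n\<^sup>2\<close> from |z| \<le> n\<delta> on \<open>D\<close>. The mesh \<delta> then
    solves c\<delta>^2 = \<epsilon>.\<close>
  define c where "c = 2 * 2 ^ n * (real n)\<^sup>2"
  have c: "c > 0" by (simp add: c_def n_def)
  define \<delta> where "\<delta> = sqrt (\<epsilon> / c)"
  have \<delta>: "\<delta> > 0" "c * \<delta>\<^sup>2 = \<epsilon>" using c \<epsilon> by (auto simp: \<delta>_def)
  define V where "V = \<delta> ^ n"
  have V: "V > 0" using \<delta> by (simp add: V_def)
  define C where "C = cell_index \<delta> ` \<Omega>"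
  have C: "finite C" unfolding C_def by (rule finite_cell_indices[OF \<Omega> \<delta>(1)])
  define Q where "Q = (\<lambda>k :: 'a \<Rightarrow> int. cell \<delta> k)"
  have [measurable]: "Q k \<in> sets borel" for k by (simp add: Q_def)
  have Qe: "emeasure lborel (Q k) = ennreal V" for k using emeasure_cell[OF \<delta>(1), of k] by (simp add: Q_def V_def n_def)
  \<comment> \<open>Scaled so that the squared functional is 2V times the squared cell mean, the
    term produced by the final integration.\<close>
  define w where "w = (\<lambda>k x. sqrt (2 / V) * indicator (Q k) x)"
  \<comment> \<open>The functionals are collected in a set, so distinct cells must give distinct
    functions for the sum over \<open>W\<close> to keep every term.\<close>
  have winj: "inj_on w C"
  proof (rule inj_onI)
    fix k l assume k: "k \<in> C" and l: "l \<in> C" and eq: "w k = w l"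
    obtain x y where x: "k = cell_index \<delta> x" and y: "l = cell_index \<delta> y" using k l by (auto simp: C_def)
    have "x \<in> Q k" using cell_index_mem[OF \<delta>(1)] x by (simp add: Q_def)
    moreover have "sqrt (2 / V) \<noteq> 0" using V by simp
    ultimately have "x \<in> Q l" using fun_cong[OF eq, of x] by (auto simp: w_def indicator_def split: if_splits)
    then have "l i = k i" if "i \<in> Basis" for i using cell_index_unique[OF \<delta>(1) _ that, of x l] x by (simp add: Q_def)
    then show "k = l" unfolding x y by (auto simp: cell_index_def fun_eq_iff restrict_def)
  qed
  have wsq: "square_integrable (w k)" for k
  proof (rule square_integrable_bound[of _ "\<lambda>x. 2 / V * indicator (Q k) x"])
    have "Q k \<in> lmeasurable" using Qe by (auto simp: fmeasurable_def emeasure_completion)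
    then show "integrable lebesgue (\<lambda>x. 2 / V * indicator (Q k) x)"
      by (intro integrable_mult_right integrable_lmeasurable_indicator)
    have "w k \<in> borel_measurable borel" unfolding w_def by measurable
    then show "w k \<in> borel_measurable lebesgue" by (rule borel_imp_lebesgue_measurable)
    show "(norm (w k x))\<^sup>2 \<le> 2 / V * indicator (Q k) x" for x
      using V by (auto simp: w_def indicator_def)
  qed
  have main: "(LINT x|lebesgue. (\<phi> x)\<^sup>2) \<le> (\<Sum>k\<in>C. (LINT x|lebesgue. \<phi> x * w k x)\<^sup>2) + \<epsilon> * (LINT x|lebesgue. (norm (grad \<phi> x))\<^sup>2)"
    if \<phi>: "\<phi> \<in> test_functions \<Omega>" for \<phi>
  proof -
    let ?K = "closure {x. \<phi> x \<noteq> 0}"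
    note T = test_functionD[OF \<phi>]
    have [measurable]: "\<phi> \<in> borel_measurable borel" using T(2) by (rule borel_measurable_continuous_onI)
    have gc: "continuous_on UNIV (grad \<phi>)" unfolding grad_def[abs_def] by (intro continuous_intros T(3))
    then have [measurable]: "grad \<phi> \<in> borel_measurable borel" by (rule borel_measurable_continuous_onI)
    have g0: "grad \<phi> x = 0" if "x \<notin> ?K" for x using T(7)[OF that] by (simp add: grad_def)
    have ngc: "continuous_on UNIV (\<lambda>x. norm (grad \<phi> x))" by (intro continuous_intros gc)
    have ng0: "norm (grad \<phi> x) = 0" if "x \<notin> ?K" for x using g0[OF that] by simp
    have "\<exists>B\<ge>0. \<forall>x. \<bar>norm (grad \<phi> x)\<bar> \<le> B" by (rule compact_support_bounded[OF ngc T(4) ng0])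
    then obtain B where B: "\<And>x. norm (grad \<phi> x) \<le> B" by auto
    have "\<exists>A\<ge>0. \<forall>x. \<bar>\<phi> x\<bar> \<le> A" by (rule compact_support_bounded[OF T(2,4,6)])
    then obtain A where A: "A \<ge> 0" "\<And>x. \<bar>\<phi> x\<bar> \<le> A" by auto
    have sq\<phi>: "square_integrable \<phi>" by (rule compact_support_integrable(2)[OF T(2,4,6)])
    have sqg: "square_integrable (\<lambda>x. norm (grad \<phi> x))" by (rule compact_support_integrable(2)[OF ngc T(4) ng0])
    define E where "E = (LINT x|lebesgue. (norm (grad \<phi> x))\<^sup>2)"
    have E: "(\<integral>\<^sup>+x. ennreal ((norm (grad \<phi> x))\<^sup>2) \<partial>lborel) = ennreal E"
      using nn_integral_eq_integral[OF square_integrable_integrable[OF sqg]] by (simp add: E_def nn_integral_completion)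
    have E0: "E \<ge> 0" unfolding E_def by (rule integral_nonneg_AE) simp
    have N: "(\<integral>\<^sup>+x. ennreal ((\<phi> x)\<^sup>2) \<partial>lborel) = ennreal (LINT x|lebesgue. (\<phi> x)\<^sup>2)"
      using nn_integral_eq_integral[OF square_integrable_integrable[OF sq\<phi>]] by (simp add: nn_integral_completion)
    define m where "m = (\<lambda>k. (LINT x|lborel. indicator (Q k) x * \<phi> x) / V)"
    define D where "D = cbox (- \<delta> *\<^sub>R One) (\<delta> *\<^sub>R One :: 'a)"
    have [measurable]: "D \<in> sets borel" by (simp add: D_def)
    have De: "emeasure lborel D = ennreal ((2 * \<delta>) ^ n)"
    proof -
      have "(\<Prod>i\<in>Basis. ((\<delta> *\<^sub>R One :: 'a) - (- \<delta> *\<^sub>R One)) \<bullet> i) = (\<Prod>i\<in>(Basis :: 'a set). 2 * \<delta>)"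
        by (intro prod.cong) (auto simp: inner_diff_left inner_add_left)
      then show ?thesis unfolding D_def using \<delta>(1) by (subst emeasure_lborel_cbox) (auto simp: n_def)
    qed
    \<comment> \<open>Differences y - x within one cell lie in \<open>D\<close>. Passing from the
      cell to \<open>D\<close> makes the range of z independent of x, so that the integrations can
      be exchanged.\<close>
    define T where "T = (\<lambda>x. \<integral>\<^sup>+z. ennreal ((\<phi> (x + z) - \<phi> x)\<^sup>2) * indicator D z \<partial>lborel)"
    have [measurable]: "T \<in> borel_measurable borel" unfolding T_def by measurable
    have pt: "ennreal ((\<phi> x)\<^sup>2) \<le> (\<Sum>k\<in>C. indicator (Q k) x * ennreal (2 * (m k)\<^sup>2)) + ennreal (2 / V) * T x" for x
    proof (cases "\<phi> x = 0")
      case False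
      then have "x \<in> \<Omega>" using T(5) T(6)[of x] by blast
      define k where "k = cell_index \<delta> x"
      have kC: "k \<in> C" using \<open>x \<in> \<Omega>\<close> by (simp add: C_def k_def)
      have xQ: "x \<in> Q k" using cell_index_mem[OF \<delta>(1)] by (simp add: Q_def k_def)
      let ?M = "restrict_space lborel (Q k)"
      have eV: "emeasure ?M (space ?M) = ennreal V" by (simp add: emeasure_restrict_space space_restrict_space Qe)
      have fin: "finite_measure ?M" by (rule finite_measureI) (unfold eV, simp)
      have mV: "measure ?M (space ?M) = V" unfolding measure_def eV using V by simp
      have mM: "\<phi> \<in> borel_measurable ?M" by (rule measurable_restrict_space1) measurable
      interpret M: finite_measure ?M by fact
      have i: "integrable ?M \<phi>" by (rule M.integrable_const_bound[of _ A]) (use A mM in auto)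
      have "(LINT y|?M. \<phi> x - \<phi> y) = V * \<phi> x - (LINT y|?M. \<phi> y)" using i mV by simp
      also have "(LINT y|?M. \<phi> y) = V * m k" using V by (simp add: integral_restrict_space m_def)
      finally have hi: "(LINT y|?M. \<phi> x - \<phi> y) = V * (\<phi> x - m k)" by (simp add: algebra_simps)
      have bnd: "\<bar>\<phi> x - \<phi> y\<bar> \<le> 2 * A" for y using A(2)[of x] A(2)[of y] by linarith
      have "ennreal ((LINT y|?M. \<phi> x - \<phi> y)\<^sup>2) \<le> ennreal (measure ?M (space ?M)) * (\<integral>\<^sup>+y. ennreal ((\<phi> x - \<phi> y)\<^sup>2) \<partial>?M)"
        by (rule integral_square_le[OF fin _ bnd]) (intro borel_measurable_diff borel_measurable_const mM)
      then have "ennreal ((V * (\<phi> x - m k))\<^sup>2) \<le> ennreal V * (\<integral>\<^sup>+y. ennreal ((\<phi> x - \<phi> y)\<^sup>2) \<partial>?M)"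
        unfolding hi mV .
      also have "(\<integral>\<^sup>+y. ennreal ((\<phi> x - \<phi> y)\<^sup>2) \<partial>?M) \<le> T x"
      proof -
        have "(\<integral>\<^sup>+y. ennreal ((\<phi> x - \<phi> y)\<^sup>2) \<partial>?M) = (\<integral>\<^sup>+y. ennreal ((\<phi> x - \<phi> y)\<^sup>2) * indicator (Q k) y \<partial>lborel)"
          by (rule nn_integral_restrict_space) simp
        also have "\<dots> \<le> (\<integral>\<^sup>+y. ennreal ((\<phi> y - \<phi> x)\<^sup>2) * indicator D (y - x) \<partial>lborel)"
        proof (rule nn_integral_mono)
          fix y
          have "y - x \<in> D" if "y \<in> Q k"
          proof -
            have "- \<delta> \<le> y \<bullet> i - x \<bullet> i \<and> y \<bullet> i - x \<bullet> i \<le> \<delta>" if "i \<in> Basis" for i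
              using \<open>y \<in> Q k\<close> xQ that unfolding Q_def cell_def distrib_right by fastforce
            then show ?thesis by (simp add: D_def mem_box inner_diff_left)
          qed
          then show "ennreal ((\<phi> x - \<phi> y)\<^sup>2) * indicator (Q k) y \<le> ennreal ((\<phi> y - \<phi> x)\<^sup>2) * indicator D (y - x)"
            by (auto simp: indicator_def power2_commute)
        qed
        also have "\<dots> = (\<integral>\<^sup>+z. ennreal ((\<phi> (x + z) - \<phi> x)\<^sup>2) * indicator D (x + z - x) \<partial>lborel)"
          by (rule nn_integral_translation[symmetric]) measurable
        finally show ?thesis by (simp add: T_def)
      qed
      finally have le1: "ennreal ((V * (\<phi> x - m k))\<^sup>2) \<le> ennreal V * T x" by (simp add: mult_left_mono)
      have "ennreal ((\<phi> x - m k)\<^sup>2) = ennreal (1 / V\<^sup>2) * ennreal ((V * (\<phi> x - m k))\<^sup>2)"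
        using V by (simp add: power_mult_distrib flip: ennreal_mult)
      also have "\<dots> \<le> ennreal (1 / V\<^sup>2) * (ennreal V * T x)" by (intro mult_left_mono le1) simp
      also have "\<dots> = ennreal (1 / V) * T x"
        using V by (simp add: power2_eq_square flip: ennreal_mult mult.assoc)
      finally have le2: "ennreal ((\<phi> x - m k)\<^sup>2) \<le> ennreal (1 / V) * T x" .
      have "(\<phi> x)\<^sup>2 \<le> 2 * (m k)\<^sup>2 + 2 * (\<phi> x - m k)\<^sup>2"
        using norm_add_power2_le[of "m k" "\<phi> x - m k"] by simp
      then have "ennreal ((\<phi> x)\<^sup>2) \<le> ennreal (2 * (m k)\<^sup>2 + 2 * (\<phi> x - m k)\<^sup>2)" by (rule ennreal_leI)
      also have "\<dots> = ennreal (2 * (m k)\<^sup>2) + 2 * ennreal ((\<phi> x - m k)\<^sup>2)" by (simp add: ennreal_mult)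
      also have "\<dots> \<le> ennreal (2 * (m k)\<^sup>2) + 2 * (ennreal (1 / V) * T x)" by (intro add_left_mono mult_left_mono le2) simp
      also have "2 * (ennreal (1 / V) * T x) = ennreal (2 / V) * T x"
      proof -
        have "ennreal (2 / V) = 2 * ennreal (1 / V)" using V ennreal_mult[of 2 "1 / V"] by simp
        then show ?thesis by (simp add: mult.assoc)
      qed
      also have "ennreal (2 * (m k)\<^sup>2) \<le> (\<Sum>k\<in>C. indicator (Q k) x * ennreal (2 * (m k)\<^sup>2))"
        using member_le_sum[OF kC _ C, of "\<lambda>k. indicator (Q k) x * ennreal (2 * (m k)\<^sup>2)"] xQ by simp
      finally show ?thesis by (simp add: add_right_mono)
    qed simp
    have TI: "(\<integral>\<^sup>+x. T x \<partial>lborel) \<le> ennreal ((2 * \<delta>) ^ n * (real n * \<delta>)\<^sup>2 * E)"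
    proof -
      have "(\<integral>\<^sup>+x. T x \<partial>lborel) = (\<integral>\<^sup>+z. (\<integral>\<^sup>+x. ennreal ((\<phi> (x + z) - \<phi> x)\<^sup>2) * indicator D z \<partial>lborel) \<partial>lborel)"
      proof -
        have "(\<lambda>(x::'a, z::'a). ennreal ((\<phi> (x + z) - \<phi> x)\<^sup>2) * indicator D z) \<in> borel_measurable (lborel \<Otimes>\<^sub>M lborel)"
          by measurable
        from lborel_pair.Fubini[OF this] show ?thesis by (simp add: T_def)
      qed
      also have "\<dots> \<le> (\<integral>\<^sup>+z. (ennreal ((real n * \<delta>)\<^sup>2) * ennreal E) * indicator D z \<partial>lborel)"
      proof (rule nn_integral_mono)
        fix z :: 'a
        have nz: "norm z \<le> real n * \<delta>" if "z \<in> D"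
        proof -
          have "norm z \<le> (\<Sum>i\<in>Basis. \<bar>z \<bullet> i\<bar>)" by (rule norm_le_l1)
          also have "\<dots> \<le> (\<Sum>i\<in>(Basis :: 'a set). \<delta>)" using that
            by (intro sum_mono) (auto simp: D_def mem_box abs_le_iff minus_le_iff)
          finally show ?thesis by (simp add: n_def)
        qed
        have "(\<integral>\<^sup>+x. ennreal ((\<phi> (x + z) - \<phi> x)\<^sup>2) \<partial>lborel) \<le> ennreal ((real n * \<delta>)\<^sup>2) * ennreal E" if "z \<in> D"
        proof -
          have "(\<integral>\<^sup>+x. ennreal ((\<phi> (x + z) - \<phi> x)\<^sup>2) \<partial>lborel) \<le> ennreal ((norm z)\<^sup>2) * ennreal E"
            using translation_estimate[OF T(1) gc B, of z] unfolding E .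
          also have "\<dots> \<le> ennreal ((real n * \<delta>)\<^sup>2) * ennreal E"
            using nz[OF that] by (intro mult_right_mono ennreal_leI power_mono) auto
          finally show ?thesis .
        qed
        then show "(\<integral>\<^sup>+x. ennreal ((\<phi> (x + z) - \<phi> x)\<^sup>2) * indicator D z \<partial>lborel) \<le> (ennreal ((real n * \<delta>)\<^sup>2) * ennreal E) * indicator D z"
          by (cases "z \<in> D") auto
      qed
      also have "\<dots> = (ennreal ((real n * \<delta>)\<^sup>2) * ennreal E) * ennreal ((2 * \<delta>) ^ n)"
        by (simp add: nn_integral_cmult De)
      also have "\<dots> = ennreal ((2 * \<delta>) ^ n * (real n * \<delta>)\<^sup>2 * E)"
        using E0 \<delta>(1) by (simp add: mult_ac flip: ennreal_mult)
      finally show ?thesis .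
    qed
    have "(\<integral>\<^sup>+x. ennreal ((\<phi> x)\<^sup>2) \<partial>lborel) \<le> (\<integral>\<^sup>+x. ((\<Sum>k\<in>C. indicator (Q k) x * ennreal (2 * (m k)\<^sup>2)) + ennreal (2 / V) * T x) \<partial>lborel)"
      by (rule nn_integral_mono) (rule pt)
    also have "\<dots> = (\<Sum>k\<in>C. ennreal V * ennreal (2 * (m k)\<^sup>2)) + ennreal (2 / V) * (\<integral>\<^sup>+x. T x \<partial>lborel)"
      by (simp add: nn_integral_add nn_integral_sum nn_integral_multc nn_integral_cmult Qe)
    also have "\<dots> \<le> (\<Sum>k\<in>C. ennreal V * ennreal (2 * (m k)\<^sup>2)) + ennreal (2 / V) * ennreal ((2 * \<delta>) ^ n * (real n * \<delta>)\<^sup>2 * E)"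
      by (intro add_left_mono mult_left_mono TI) simp
    also have "(\<Sum>k\<in>C. ennreal V * ennreal (2 * (m k)\<^sup>2)) = ennreal (\<Sum>k\<in>C. V * (2 * (m k)\<^sup>2))"
      using V by (simp add: sum_ennreal flip: ennreal_mult)
    also have "ennreal (2 / V) * ennreal ((2 * \<delta>) ^ n * (real n * \<delta>)\<^sup>2 * E) = ennreal (\<epsilon> * E)"
    proof -
      have "2 / V * ((2 * \<delta>) ^ n * (real n * \<delta>)\<^sup>2 * E) = (c * \<delta>\<^sup>2) * E"
        using \<delta>(1) by (simp add: V_def c_def power_mult_distrib)
      then show ?thesis using V E0 \<delta> by (simp flip: ennreal_mult)
    qed
    also have "ennreal (\<Sum>k\<in>C. V * (2 * (m k)\<^sup>2)) + ennreal (\<epsilon> * E) = ennreal ((\<Sum>k\<in>C. V * (2 * (m k)\<^sup>2)) + \<epsilon> * E)"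
      using V E0 \<epsilon> by (intro ennreal_plus[symmetric] sum_nonneg) auto
    finally have fin: "ennreal (LINT x|lebesgue. (\<phi> x)\<^sup>2) \<le> ennreal ((\<Sum>k\<in>C. V * (2 * (m k)\<^sup>2)) + \<epsilon> * E)" unfolding N .
    have "(\<Sum>k\<in>C. V * (2 * (m k)\<^sup>2)) + \<epsilon> * E \<ge> 0" using V E0 \<epsilon> by (intro add_nonneg_nonneg sum_nonneg) auto
    then have fin': "(LINT x|lebesgue. (\<phi> x)\<^sup>2) \<le> (\<Sum>k\<in>C. V * (2 * (m k)\<^sup>2)) + \<epsilon> * E" using fin by (subst (asm) ennreal_le_iff)
    have "V * (2 * (m k)\<^sup>2) = (LINT x|lebesgue. \<phi> x * w k x)\<^sup>2" for k
    proof -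
      have "(LINT x|lebesgue. \<phi> x * w k x) = (LINT x|lborel. \<phi> x * w k x)"
        by (rule integral_completion) (simp add: w_def)
      also have "\<dots> = (LINT x|lborel. sqrt (2 / V) * (indicator (Q k) x * \<phi> x))"
        by (simp add: w_def mult_ac)
      also have "\<dots> = sqrt (2 / V) * (V * m k)" using V by (simp add: m_def)
      finally have e: "(LINT x|lebesgue. \<phi> x * w k x) = sqrt (2 / V) * (V * m k)" .
      have "(sqrt (2 / V) * (V * m k))\<^sup>2 = (sqrt (2 / V))\<^sup>2 * (V * m k)\<^sup>2" by (rule power_mult_distrib)
      also have "\<dots> = 2 / V * (V * m k)\<^sup>2" using V by simp
      also have "\<dots> = V * (2 * (m k)\<^sup>2)" using V by (simp add: power2_eq_square)
      finally show ?thesis unfolding e by simp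
    qed
    then show ?thesis using fin' by (simp add: E_def)
  qed
  show ?thesis
    by (intro exI[of _ "w ` C"] conjI ballI) (use C wsq main in \<open>auto simp: sum.reindex[OF winj]\<close>)
qed

section \<open>Sobolev functions as a closed subspace\<close>

lemma norm_fst_le_norm: "norm (fst p) \<le> norm p"
  by (metis norm_fst_le prod.collapse)

lemma square_integrable_fst: "square_integrable (\<lambda>x. fst (u x))" if u: "square_integrable u"
proof (rule square_integrable_bound[OF _ square_integrable_integrable[OF u]])
  have "continuous_on UNIV (fst :: 'b \<times> 'c \<Rightarrow> 'b)" by (intro continuous_intros)
  from measurable_compose[OF square_integrable_measurable[OF u] borel_measurable_continuous_onI[OF this]]
  show "(\<lambda>x. fst (u x)) \<in> borel_measurable lebesgue" .
  show "(norm (fst (u x)))\<^sup>2 \<le> (norm (u x))\<^sup>2" for x by (intro power_mono norm_fst_le_norm norm_ge_zero)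
qed

text \<open>With Sobolev functions represented as pairs (u, grad u), the embedding into L2 is the
  projection to the first component.\<close>

lift_definition fstL :: "('a::euclidean_space, 'b::euclidean_space \<times> 'c::euclidean_space) Lsq \<Rightarrow> ('a, 'b) Lsq"
  is "\<lambda>u x. fst (u x)"
  by (auto simp: square_integrable_fst)

lemma fstL_toL: "square_integrable u \<Longrightarrow> fstL (toL u) = toL (\<lambda>x. fst (u x))"
  by (simp add: toL_def fstL.abs_eq)

lemma norm_fstL: "norm (fstL X) \<le> norm X"
proof -
  obtain u where u: "square_integrable u" "X = toL u" by (rule Lsq_cases)
  have "(norm (fstL X))\<^sup>2 \<le> (norm X)\<^sup>2"
    unfolding u(2) fstL_toL[OF u(1)] norm_toL(1)[OF u(1)] norm_toL(1)[OF square_integrable_fst[OF u(1)]]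
    by (intro integral_mono square_integrable_integrable u square_integrable_fst power_mono norm_fst_le_norm) auto
  then show ?thesis by (rule power2_le_imp_le) simp
qed

lemma bounded_linear_fstL: "bounded_linear fstL"
proof (rule bounded_linear_intro[of _ 1])
  fix X Y :: "('a, 'b \<times> 'c) Lsq" and r :: real
  obtain u where u: "square_integrable u" "X = toL u" by (rule Lsq_cases)
  obtain v where v: "square_integrable v" "Y = toL v" by (rule Lsq_cases)
  show "fstL (X + Y) = fstL X + fstL Y"
    unfolding u(2) v(2) toL_simps(1)[OF u(1) v(1), symmetric] fstL_toL[OF square_integrable_add[OF u(1) v(1)]]
      fstL_toL[OF u(1)] fstL_toL[OF v(1)] toL_simps(1)[OF square_integrable_fst[OF u(1)] square_integrable_fst[OF v(1)], symmetric]
    by simp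
  show "fstL (r *\<^sub>R X) = r *\<^sub>R fstL X"
    unfolding u(2) toL_scaleR[OF u(1), symmetric] fstL_toL[OF square_integrable_scaleR[OF u(1)]] fstL_toL[OF u(1)]
      toL_scaleR[OF square_integrable_fst[OF u(1)], symmetric]
    by simp
  show "norm (fstL X) \<le> norm X * 1" using norm_fstL by simp
qed

locale bounded_open_set =
  fixes \<Omega> :: "'a::euclidean_space set"
  assumes open_\<Omega>: "open \<Omega>" and bounded_\<Omega>: "bounded \<Omega>"
begin

lemma \<Omega>_sets [measurable, simp]: "\<Omega> \<in> sets lebesgue" "\<Omega> \<inter> space lebesgue \<in> sets lebesgue"
  using open_\<Omega> by (auto intro: lebesgue_openin)

lemma \<Omega>_lmeasurable: "\<Omega> \<in> lmeasurable"
  using lmeasurable_open[OF bounded_\<Omega> open_\<Omega>] .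

text \<open>Extension by zero. It preserves inner products (\<open>emb_inner\<close>), so integrals
  over \<Omega> become inner products in a Hilbert space independent of \<Omega>.\<close>

definition emb :: "('a \<Rightarrow> 'b::euclidean_space) \<Rightarrow> ('a, 'b) Lsq" where
  "emb u = toL (\<lambda>x. indicator \<Omega> x *\<^sub>R u x)"

lemma L2_iff: "u \<in> L2 \<Omega> \<longleftrightarrow> square_integrable (\<lambda>x. indicator \<Omega> x *\<^sub>R u x)"
proof -
  have "(\<lambda>x. indicator \<Omega> x *\<^sub>R (norm (u x))\<^sup>2) = (\<lambda>x. (norm (indicator \<Omega> x *\<^sub>R u x))\<^sup>2)"
    by (auto simp: indicator_def)
  then show ?thesis
    by (simp add: L2_def square_integrable_def borel_measurable_restrict_space_iff integrable_restrict_space)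
qed

lemma emb_inner: "emb u \<bullet> emb v = (LINT x|lebesgue_on \<Omega>. u x \<bullet> v x)" if "u \<in> L2 \<Omega>" "v \<in> L2 \<Omega>"
proof -
  have "(\<lambda>x. (indicator \<Omega> x *\<^sub>R u x) \<bullet> (indicator \<Omega> x *\<^sub>R v x)) = (\<lambda>x. indicator \<Omega> x *\<^sub>R (u x \<bullet> v x))"
    by (auto simp: indicator_def)
  then show ?thesis using that by (simp add: L2_iff emb_def toL_simps integral_restrict_space)
qed

lemma emb_norm: "norm (emb u) = L2_norm \<Omega> u" if "u \<in> L2 \<Omega>"
  using emb_inner[OF that that] by (simp add: norm_eq_sqrt_inner L2_norm_def power2_norm_eq_inner)

lemma L2_add: "u \<in> L2 \<Omega> \<Longrightarrow> v \<in> L2 \<Omega> \<Longrightarrow> (\<lambda>x. u x + v x) \<in> L2 \<Omega>"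
  unfolding L2_iff scaleR_add_right by (rule square_integrable_add)

lemma L2_diff: "u \<in> L2 \<Omega> \<Longrightarrow> v \<in> L2 \<Omega> \<Longrightarrow> (\<lambda>x. u x - v x) \<in> L2 \<Omega>"
  unfolding L2_iff scaleR_diff_right by (rule square_integrable_diff)

lemma L2_scaleR: "u \<in> L2 \<Omega> \<Longrightarrow> (\<lambda>x. c *\<^sub>R u x) \<in> L2 \<Omega>"
  unfolding L2_iff scaleR_left_commute[of _ c] by (rule square_integrable_scaleR)

lemma emb_add: "u \<in> L2 \<Omega> \<Longrightarrow> v \<in> L2 \<Omega> \<Longrightarrow> emb (\<lambda>x. u x + v x) = emb u + emb v"
  unfolding L2_iff emb_def scaleR_add_right by (rule toL_simps)

lemma emb_diff: "u \<in> L2 \<Omega> \<Longrightarrow> v \<in> L2 \<Omega> \<Longrightarrow> emb (\<lambda>x. u x - v x) = emb u - emb v"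
  unfolding L2_iff emb_def scaleR_diff_right by (rule toL_simps)

lemma emb_scaleR: "u \<in> L2 \<Omega> \<Longrightarrow> emb (\<lambda>x. c *\<^sub>R u x) = c *\<^sub>R emb u"
  unfolding L2_iff emb_def scaleR_left_commute[of _ c] by (rule toL_scaleR)

lemma emb_eq_iff: "u \<in> L2 \<Omega> \<Longrightarrow> v \<in> L2 \<Omega> \<Longrightarrow> emb u = emb v \<longleftrightarrow> (AE x in lebesgue_on \<Omega>. u x = v x)"
  unfolding L2_iff emb_def toL_simps(4) AE_restrict_space_iff[OF \<Omega>_sets(2)]
  by (intro AE_cong) (auto simp: indicator_def)

lemma L2_Pair: "u \<in> L2 \<Omega> \<Longrightarrow> U \<in> L2 \<Omega> \<Longrightarrow> (\<lambda>x. (u x, U x)) \<in> L2 \<Omega>"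
  unfolding L2_def
  by (auto simp: norm_Pair intro!: borel_measurable_Pair Bochner_Integration.integrable_add)

lemma L2_inner_integrable:
  assumes "u \<in> L2 \<Omega>" "v \<in> L2 \<Omega>"
  shows "integrable (lebesgue_on \<Omega>) (\<lambda>x. u x \<bullet> v x)"
proof -
  have "(\<lambda>x. (indicator \<Omega> x *\<^sub>R u x) \<bullet> (indicator \<Omega> x *\<^sub>R v x)) = (\<lambda>x. indicator \<Omega> x *\<^sub>R (u x \<bullet> v x))"
    by (auto simp: indicator_def)
  then show ?thesis using square_integrable_inner[OF assms[unfolded L2_iff]] by (simp add: integrable_restrict_space)
qed

lemma emb_Pair_inner:
  assumes "u \<in> L2 \<Omega>" "U \<in> L2 \<Omega>" "v \<in> L2 \<Omega>" "V \<in> L2 \<Omega>"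
  shows "emb (\<lambda>x. (u x, U x)) \<bullet> emb (\<lambda>x. (v x, V x)) = (LINT x|lebesgue_on \<Omega>. u x \<bullet> v x) + (LINT x|lebesgue_on \<Omega>. U x \<bullet> V x)"
  unfolding emb_inner[OF L2_Pair[OF assms(1,2)] L2_Pair[OF assms(3,4)]] inner_Pair
  using L2_inner_integrable[OF assms(1,3)] L2_inner_integrable[OF assms(2,4)] by (rule Bochner_Integration.integral_add)

lemma fstL_emb: "u \<in> L2 \<Omega> \<Longrightarrow> U \<in> L2 \<Omega> \<Longrightarrow> fstL (emb (\<lambda>x. (u x, U x))) = emb u"
  using L2_Pair[of u U] by (simp add: emb_def L2_iff fstL_toL)

lemma emb_vanishing: "u \<in> L2 \<Omega>" "emb u = toL u" if "square_integrable u" "\<And>x. x \<notin> \<Omega> \<Longrightarrow> u x = 0"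
proof -
  have "(\<lambda>x. indicator \<Omega> x *\<^sub>R u x) = u" using that(2) by (auto simp: indicator_def)
  then show "u \<in> L2 \<Omega>" "emb u = toL u" using that(1) by (simp_all add: L2_iff emb_def)
qed

lemma compact_support_L2:
  fixes h :: "'a \<Rightarrow> real"
  assumes "continuous_on UNIV h" "compact K" "K \<subseteq> \<Omega>" "\<And>x. x \<notin> K \<Longrightarrow> h x = 0"
  shows "h \<in> L2 \<Omega>" "emb h = toL h" "square_integrable h"
proof -
  show sq: "square_integrable h" by (rule compact_support_integrable(2)[OF assms(1,2,4)])
  have "h x = 0" if "x \<notin> \<Omega>" for x using assms(3,4) that by blast
  then show "h \<in> L2 \<Omega>" "emb h = toL h" using emb_vanishing[OF sq] by blast+
qed

lemma test_L2:
  assumes "\<phi> \<in> test_functions \<Omega>"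
  shows "\<phi> \<in> L2 \<Omega>" "b \<in> Basis \<Longrightarrow> (\<lambda>x. frechet_derivative \<phi> (at x) b) \<in> L2 \<Omega>" "(\<lambda>x. \<phi> x *\<^sub>R b) \<in> L2 \<Omega>" "grad \<phi> \<in> L2 \<Omega>"
proof -
  note T = test_functionD[OF assms]
  show p: "\<phi> \<in> L2 \<Omega>" by (rule compact_support_L2(1)[OF T(2,4,5,6)])
  show d: "(\<lambda>x. frechet_derivative \<phi> (at x) b) \<in> L2 \<Omega>" if "b \<in> Basis" for b
    by (rule compact_support_L2(1)[OF T(3)[OF that] T(4,5)]) (simp add: T(7))
  have sc: "(\<lambda>x. h x *\<^sub>R b) \<in> L2 \<Omega>" if "h \<in> L2 \<Omega>" for h and b :: 'a
    using that unfolding L2_def by (auto simp: power_mult_distrib)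
  show "(\<lambda>x. \<phi> x *\<^sub>R b) \<in> L2 \<Omega>" by (rule sc[OF p])
  have "(\<lambda>x. \<Sum>b\<in>A. frechet_derivative \<phi> (at x) b *\<^sub>R b) \<in> L2 \<Omega>" if "finite A" "A \<subseteq> Basis" for A
    using that
  proof (induction A rule: finite_induct)
    case (insert b A)
    then show ?case by (simp add: L2_add sc d)
  qed (simp add: L2_def)
  then show "grad \<phi> \<in> L2 \<Omega>" unfolding grad_def[abs_def] by simp
qed

text \<open>As orthogonality of the pair (u, U) to fixed vectors the defining identity is stable
  under limits; this is the source of the completeness of the Sobolev space.\<close>

lemma weak_gradient_iff:
  assumes u: "u \<in> L2 \<Omega>" and U: "U \<in> L2 \<Omega>"
  shows "has_weak_gradient \<Omega> u U \<longleftrightarrow> (\<forall>\<phi>\<in>test_functions \<Omega>. \<forall>b\<in>Basis.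
    emb (\<lambda>x. (u x, U x)) \<bullet> emb (\<lambda>x. (frechet_derivative \<phi> (at x) b, \<phi> x *\<^sub>R b)) = 0)"
proof -
  have "(LINT x|lebesgue_on \<Omega>. u x * frechet_derivative \<phi> (at x) b) = - (LINT x|lebesgue_on \<Omega>. (U x \<bullet> b) * \<phi> x) \<longleftrightarrow>
    emb (\<lambda>x. (u x, U x)) \<bullet> emb (\<lambda>x. (frechet_derivative \<phi> (at x) b, \<phi> x *\<^sub>R b)) = 0" if "\<phi> \<in> test_functions \<Omega>" "b \<in> Basis" for \<phi> b
    using emb_Pair_inner[OF u U test_L2(2)[OF that] test_L2(3)[OF that(1)], of b]
    by (auto simp: mult.commute add_eq_0_iff2)
  then show ?thesis unfolding has_weak_gradient_def by (intro ball_cong refl)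
qed

text \<open>Each component of the difference is annihilated by all test functions, so the
  fundamental lemma applies.\<close>

lemma weak_gradient_unique:
  assumes "u \<in> L2 \<Omega>" "U \<in> L2 \<Omega>" "U' \<in> L2 \<Omega>" "has_weak_gradient \<Omega> u U" "has_weak_gradient \<Omega> u U'"
  shows "AE x in lebesgue_on \<Omega>. U x = U' x"
proof -
  have comp: "AE x in lebesgue. x \<in> \<Omega> \<longrightarrow> (indicator \<Omega> x *\<^sub>R ((U x - U' x) \<bullet> b)) = 0" if b: "b \<in> Basis" for b
  proof (rule fundamental_lemma[OF _ open_\<Omega>])
    have W: "(\<lambda>x. U x - U' x) \<in> L2 \<Omega>" using assms L2_diff by blast
    have "(\<lambda>x. (U x - U' x) \<bullet> b) \<in> L2 \<Omega>"
    proof -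
      have m: "(\<lambda>x. U x - U' x) \<in> borel_measurable (lebesgue_on \<Omega>)" and i: "integrable (lebesgue_on \<Omega>) (\<lambda>x. (norm (U x - U' x))\<^sup>2)"
        using W by (auto simp: L2_def)
      have "norm ((norm (w \<bullet> b))\<^sup>2) \<le> norm ((norm w)\<^sup>2)" for w
        using power_mono[OF Basis_le_norm[OF b, of w], of 2] by simp
      then have "integrable (lebesgue_on \<Omega>) (\<lambda>x. (norm ((U x - U' x) \<bullet> b))\<^sup>2)"
        using m by (intro Bochner_Integration.integrable_bound[OF i]) auto
      then show ?thesis using m unfolding L2_def by simp
    qed
    then show "square_integrable (\<lambda>x. indicator \<Omega> x *\<^sub>R ((U x - U' x) \<bullet> b))" by (simp add: L2_iff)
    fix \<phi> assume \<phi>: "\<phi> \<in> test_functions \<Omega>"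
    have int: "integrable (lebesgue_on \<Omega>) (\<lambda>x. (V x \<bullet> b) * \<phi> x)" if "V \<in> L2 \<Omega>" for V
    proof -
      have "(\<lambda>x. (indicator \<Omega> x *\<^sub>R V x) \<bullet> (indicator \<Omega> x *\<^sub>R (\<phi> x *\<^sub>R b))) = (\<lambda>x. indicator \<Omega> x *\<^sub>R ((V x \<bullet> b) * \<phi> x))"
        by (auto simp: indicator_def)
      then show ?thesis
        using square_integrable_inner[OF that[unfolded L2_iff] test_L2(3)[OF \<phi>, of b, unfolded L2_iff]]
        by (simp add: integrable_restrict_space)
    qed
    have "(LINT x|lebesgue_on \<Omega>. (U x \<bullet> b) * \<phi> x) = (LINT x|lebesgue_on \<Omega>. (U' x \<bullet> b) * \<phi> x)"
    proof -
      have "(LINT x|lebesgue_on \<Omega>. u x * frechet_derivative \<phi> (at x) b) = - (LINT x|lebesgue_on \<Omega>. (U x \<bullet> b) * \<phi> x)"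
        by (rule assms(4)[unfolded has_weak_gradient_def, rule_format, OF \<phi> b])
      moreover have "(LINT x|lebesgue_on \<Omega>. u x * frechet_derivative \<phi> (at x) b) = - (LINT x|lebesgue_on \<Omega>. (U' x \<bullet> b) * \<phi> x)"
        by (rule assms(5)[unfolded has_weak_gradient_def, rule_format, OF \<phi> b])
      ultimately show ?thesis by linarith
    qed
    then have "(LINT x|lebesgue_on \<Omega>. ((U x - U' x) \<bullet> b) * \<phi> x) = 0"
      unfolding inner_diff_left left_diff_distrib Bochner_Integration.integral_diff[OF int[OF assms(2)] int[OF assms(3)]] by simp
    then show "(LINT x|lebesgue. indicator \<Omega> x *\<^sub>R ((U x - U' x) \<bullet> b) * \<phi> x) = 0"
      by (simp add: integral_restrict_space mult.assoc)
  qed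
  then have "AE x in lebesgue. \<forall>b\<in>Basis. x \<in> \<Omega> \<longrightarrow> (indicator \<Omega> x *\<^sub>R ((U x - U' x) \<bullet> b)) = 0"
    by (intro AE_finite_allI) auto
  then show ?thesis unfolding AE_restrict_space_iff[OF \<Omega>_sets(2)]
  proof eventually_elim
    case (elim x)
    then show ?case by (auto simp: euclidean_eq_iff[of "U x"] inner_diff_left)
  qed
qed

text \<open>The graph embedding u -> (u, grad u), an isometry for the Sobolev norm; not the energy
  that bears this letter in the abstract part. The choice inside \<open>wgrad\<close> is harmless,
  as weak gradients are unique almost everywhere (\<open>J_eqI\<close>).\<close>

definition J :: "('a \<Rightarrow> real) \<Rightarrow> ('a, real \<times> 'a) Lsq" where
  "J u = emb (\<lambda>x. (u x, wgrad \<Omega> u x))"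

lemma W12D: "u \<in> L2 \<Omega>" "wgrad \<Omega> u \<in> L2 \<Omega>" "has_weak_gradient \<Omega> u (wgrad \<Omega> u)" if "u \<in> W12 \<Omega>"
proof -
  show "u \<in> L2 \<Omega>" using that by (simp add: W12_def)
  have "\<exists>U. U \<in> L2 \<Omega> \<and> has_weak_gradient \<Omega> u U" using that by (auto simp: W12_def)
  from someI_ex[OF this] show "wgrad \<Omega> u \<in> L2 \<Omega>" "has_weak_gradient \<Omega> u (wgrad \<Omega> u)" by (simp_all add: wgrad_def)
qed

lemma J_eqI:
  assumes "u \<in> L2 \<Omega>" "U \<in> L2 \<Omega>" "has_weak_gradient \<Omega> u U"
  shows "u \<in> W12 \<Omega>" "J u = emb (\<lambda>x. (u x, U x))"
proof -
  show u: "u \<in> W12 \<Omega>" using assms by (auto simp: W12_def)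
  have "AE x in lebesgue_on \<Omega>. wgrad \<Omega> u x = U x"
    by (rule weak_gradient_unique[OF assms(1) W12D(2)[OF u] assms(2) W12D(3)[OF u] assms(3)])
  then show "J u = emb (\<lambda>x. (u x, U x))" unfolding J_def
    using W12D(2)[OF u] assms by (subst emb_eq_iff) (auto intro: L2_Pair)
qed

lemma J_norm: "u \<in> W12 \<Omega> \<Longrightarrow> norm (J u) = W12_norm \<Omega> u"
proof -
  assume u: "u \<in> W12 \<Omega>"
  note D = W12D[OF u]
  have "(LINT x|lebesgue_on \<Omega>. u x \<bullet> u x) = (L2_norm \<Omega> u)\<^sup>2" "(LINT x|lebesgue_on \<Omega>. wgrad \<Omega> u x \<bullet> wgrad \<Omega> u x) = (L2_norm \<Omega> (wgrad \<Omega> u))\<^sup>2"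
    using emb_inner[OF D(1,1)] emb_inner[OF D(2,2)] emb_norm[OF D(1)] emb_norm[OF D(2)]
    by (metis power2_norm_eq_inner)+
  then show ?thesis unfolding J_def W12_norm_def norm_eq_sqrt_inner emb_Pair_inner[OF D(1,2,1,2)] by simp
qed

lemma J_lin: "(\<lambda>x. u x + c * v x) \<in> W12 \<Omega>" "J (\<lambda>x. u x + c * v x) = J u + c *\<^sub>R J v" if u: "u \<in> W12 \<Omega>" and v: "v \<in> W12 \<Omega>"
proof -
  note Du = W12D[OF u] and Dv = W12D[OF v]
  let ?w = "\<lambda>x. u x + c * v x" and ?W = "\<lambda>x. wgrad \<Omega> u x + c *\<^sub>R wgrad \<Omega> v x"
  have w: "?w \<in> L2 \<Omega>" using L2_add[OF Du(1) L2_scaleR[OF Dv(1), of c]] by simp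
  have W: "?W \<in> L2 \<Omega>" using L2_add[OF Du(2) L2_scaleR[OF Dv(2), of c]] by simp
  have e: "emb (\<lambda>x. (?w x, ?W x)) = J u + c *\<^sub>R J v"
    using emb_add[OF L2_Pair[OF Du(1,2)] L2_scaleR[OF L2_Pair[OF Dv(1,2)], of c]] emb_scaleR[OF L2_Pair[OF Dv(1,2)], of c]
    by (simp add: J_def)
  have "has_weak_gradient \<Omega> ?w ?W"
    unfolding weak_gradient_iff[OF w W] e
    using Du(3) Dv(3) unfolding weak_gradient_iff[OF Du(1,2)] weak_gradient_iff[OF Dv(1,2)] J_def[symmetric]
    by (simp add: inner_add_left)
  from J_eqI[OF w W this] show "?w \<in> W12 \<Omega>" "J ?w = J u + c *\<^sub>R J v" by (simp_all add: e)
qed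

text \<open>The partial derivative of a product of two test functions has integral 0; with the
  product rule this is the weak gradient identity for the classical gradient.\<close>

lemma J_test: "\<phi> \<in> W12 \<Omega>" "J \<phi> = emb (\<lambda>x. (\<phi> x, grad \<phi> x))" if \<phi>: "\<phi> \<in> test_functions \<Omega>"
proof -
  note T = test_functionD[OF \<phi>]
  have "has_weak_gradient \<Omega> \<phi> (grad \<phi>)" unfolding has_weak_gradient_def
  proof (intro ballI)
    fix \<psi> b assume \<psi>: "\<psi> \<in> test_functions \<Omega>" and b: "b \<in> (Basis :: 'a set)"
    note S = test_functionD[OF \<psi>]
    let ?K = "closure {x. \<phi> x \<noteq> 0}"
    define p where "p = (\<lambda>x. \<phi> x * \<psi> x)"
    have fd: "frechet_derivative p (at x) b = \<phi> x * frechet_derivative \<psi> (at x) b + frechet_derivative \<phi> (at x) b * \<psi> x" for x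
      using frechet_derivative_mult[OF T(1)[of x] S(1)[of x]] by (simp add: p_def)
    have z: "(LINT x|lebesgue. frechet_derivative p (at x) b) = 0"
    proof (rule integral_partial_derivative_zero)
      show "p differentiable at x" for x unfolding p_def using T(1) S(1) by (rule differentiable_mult)
      show "continuous_on UNIV (\<lambda>x. frechet_derivative p (at x) b)" unfolding fd
        by (intro continuous_intros T(2) S(2) T(3)[OF b] S(3)[OF b])
      show "compact ?K" by (rule T(4))
      show "p x = 0" if "x \<notin> ?K" for x using T(6)[OF that] by (simp add: p_def)
      show "frechet_derivative p (at x) b = 0" if "x \<notin> ?K" for x using T(6)[OF that] T(7)[OF that] by (simp add: fd)
      show "norm b \<le> 1" using b by simp
    qed
    have i1: "integrable lebesgue (\<lambda>x. \<phi> x * frechet_derivative \<psi> (at x) b)"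
      by (rule compact_support_integrable(1)[OF _ T(4)]) (auto intro!: continuous_intros T(2) S(3)[OF b] dest: T(6))
    have i2: "integrable lebesgue (\<lambda>x. frechet_derivative \<phi> (at x) b * \<psi> x)"
      by (rule compact_support_integrable(1)[OF _ T(4)]) (auto intro!: continuous_intros T(3)[OF b] S(2) dest: T(7))
    have "(LINT x|lebesgue. \<phi> x * frechet_derivative \<psi> (at x) b) + (LINT x|lebesgue. frechet_derivative \<phi> (at x) b * \<psi> x) = 0"
      using z unfolding fd by (simp add: i1 i2)
    moreover have "\<phi> x = 0 \<and> frechet_derivative \<phi> (at x) b = 0" if "x \<notin> \<Omega>" for x
    proof -
      have "x \<notin> ?K" using T(5) that by blast
      then show ?thesis using T(6)[of x] T(7)[of x] by simp
    qed
    then have "(\<lambda>x. indicator \<Omega> x *\<^sub>R (\<phi> x * frechet_derivative \<psi> (at x) b)) = (\<lambda>x. \<phi> x * frechet_derivative \<psi> (at x) b)"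
      "(\<lambda>x. indicator \<Omega> x *\<^sub>R (frechet_derivative \<phi> (at x) b * \<psi> x)) = (\<lambda>x. frechet_derivative \<phi> (at x) b * \<psi> x)"
      by (auto simp: indicator_def fun_eq_iff)
    moreover have "grad \<phi> x \<bullet> b = frechet_derivative \<phi> (at x) b" for x using frechet_derivative_grad[OF T(1)] by simp
    ultimately show "(LINT x|lebesgue_on \<Omega>. \<phi> x * frechet_derivative \<psi> (at x) b) = - (LINT x|lebesgue_on \<Omega>. (grad \<phi> x \<bullet> b) * \<psi> x)"
      by (simp add: integral_restrict_space)
  qed
  from J_eqI[OF test_L2(1,4)[OF \<phi>] this] show "\<phi> \<in> W12 \<Omega>" "J \<phi> = emb (\<lambda>x. (\<phi> x, grad \<phi> x))" by blast+
qed

end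

section \<open>Orthonormal systems of eigenvectors\<close>

context compact_embedding begin

lemma eig_distinct_orth: "x \<bullet> y = 0" if "eig \<nu> x" "eig \<mu> y" "\<nu> \<noteq> \<mu>"
proof -
  have "x \<bullet> y = \<nu> * (P x \<bullet> P y)" "y \<bullet> x = \<mu> * (P y \<bullet> P x)" using that by (auto simp: eig_def)
  then have "(\<nu> - \<mu>) * (P x \<bullet> P y) = 0" by (simp add: inner_commute algebra_simps)
  then have "P x \<bullet> P y = 0" using that(3) by simp
  then show ?thesis using \<open>x \<bullet> y = \<nu> * (P x \<bullet> P y)\<close> by simp
qed

text \<open>Gram-Schmidt inside each of finitely many eigenspaces; across different values
  orthogonality is automatic. Completeness is stated as the absence of further eigenvectors
  orthogonal to \<open>B\<close>, the form that combines with \<open>rayleigh_max\<close>.\<close>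

lemma orthonormal_eigenbasis:
  assumes \<Lambda>: "finite \<Lambda>" and fin: "\<And>\<nu>. \<nu> \<in> \<Lambda> \<Longrightarrow> \<exists>A. finite A \<and> A \<subseteq> {x. eig \<nu> x} \<and> {x. eig \<nu> x} \<subseteq> span A"
  shows "\<exists>B \<nu>. finite B \<and> pairwise orthogonal B \<and> (\<forall>e\<in>B. norm e = 1 \<and> eig (\<nu> e) e \<and> \<nu> e \<in> \<Lambda>) \<and>
    (\<forall>\<mu>\<in>\<Lambda>. \<forall>x. eig \<mu> x \<longrightarrow> (\<forall>e\<in>B. x \<bullet> e = 0) \<longrightarrow> x = 0)"
proof -
  have ex: "\<exists>C. finite C \<and> pairwise orthogonal C \<and> (\<forall>e\<in>C. norm e = 1 \<and> eig \<nu> e) \<and> (\<forall>x. eig \<nu> x \<longrightarrow> (\<forall>e\<in>C. x \<bullet> e = 0) \<longrightarrow> x = 0)"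
    if \<nu>: "\<nu> \<in> \<Lambda>" for \<nu>
  proof -
    obtain A where A: "finite A" "A \<subseteq> {x. eig \<nu> x}" "{x. eig \<nu> x} \<subseteq> span A" using fin[OF \<nu>] by blast
    obtain D where D: "finite D" "span D = span A" "pairwise orthogonal D" using basis_orthogonal[OF A(1)] by blast
    have DE: "eig \<nu> e" if "e \<in> D" for e
    proof -
      have "e \<in> span A" using span_base[OF that] D(2) by simp
      then show ?thesis using span_minimal[OF A(2) subspace_eig] by blast
    qed
    define C where "C = (\<lambda>e. (1 / norm e) *\<^sub>R e) ` (D - {0})"
    have 1: "finite C" using D by (simp add: C_def)
    have 2: "pairwise orthogonal C" using D(3) unfolding C_def pairwise_def orthogonal_def by auto
    have 3: "norm e = 1 \<and> eig \<nu> e" if eC: "e \<in> C" for e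
    proof -
      obtain d where d: "d \<in> D" "d \<noteq> 0" "e = (1 / norm d) *\<^sub>R d" using eC unfolding C_def by blast
      have "eig \<nu> e" using subspace_scale[OF subspace_eig, of d \<nu> "1 / norm d"] DE[OF d(1)] d(3) by simp
      then show ?thesis using d by simp
    qed
    have 4: "x = 0" if x: "eig \<nu> x" and o: "\<forall>e\<in>C. x \<bullet> e = 0" for x
    proof -
      have "x \<bullet> d = 0" if "d \<in> D" for d
      proof (cases "d = 0")
        case False
        then have "x \<bullet> ((1 / norm d) *\<^sub>R d) = 0" using o that by (auto simp: C_def)
        then show ?thesis using False by simp
      qed simp
      then have "D \<subseteq> {y. x \<bullet> y = 0}" by auto
      moreover have "subspace {y. x \<bullet> y = 0}" by (simp add: subspace_hyperplane)
      ultimately have "span D \<subseteq> {y. x \<bullet> y = 0}" by (rule span_minimal)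
      then have "x \<bullet> x = 0" using A(3) x D(2) by auto
      then show ?thesis by simp
    qed
    show ?thesis by (intro exI[of _ C] conjI ballI allI impI) (fact 1 | fact 2 | (rule 3[THEN conjunct1], assumption) | (rule 3[THEN conjunct2], assumption) | (rule 4, assumption+))+
  qed
  have "\<forall>\<nu>\<in>\<Lambda>. \<exists>C. finite C \<and> pairwise orthogonal C \<and> (\<forall>e\<in>C. norm e = 1 \<and> eig \<nu> e) \<and> (\<forall>x. eig \<nu> x \<longrightarrow> (\<forall>e\<in>C. x \<bullet> e = 0) \<longrightarrow> x = 0)"
    by (intro ballI ex)
  from bchoice[OF this] obtain C where C: "\<forall>\<nu>\<in>\<Lambda>. finite (C \<nu>) \<and> pairwise orthogonal (C \<nu>) \<and> (\<forall>e\<in>C \<nu>. norm e = 1 \<and> eig \<nu> e) \<and> (\<forall>x. eig \<nu> x \<longrightarrow> (\<forall>e\<in>C \<nu>. x \<bullet> e = 0) \<longrightarrow> x = 0)" ..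
  define B where "B = (\<Union>\<nu>\<in>\<Lambda>. C \<nu>)"
  have "\<forall>e\<in>B. \<exists>\<nu>. \<nu> \<in> \<Lambda> \<and> e \<in> C \<nu>" by (auto simp: B_def)
  from bchoice[OF this] obtain n where n: "\<forall>e\<in>B. n e \<in> \<Lambda> \<and> e \<in> C (n e)" ..
  have "finite B" using \<Lambda> C by (auto simp: B_def)
  moreover have "pairwise orthogonal B" unfolding pairwise_def orthogonal_def
  proof (intro ballI impI)
    fix e f assume ef: "e \<in> B" "f \<in> B" "e \<noteq> f"
    show "e \<bullet> f = 0"
    proof (cases "n e = n f")
      case True
      then have "pairwise orthogonal (C (n e))" "e \<in> C (n e)" "f \<in> C (n e)" using n C ef by auto
      then show ?thesis using ef(3) by (simp add: pairwise_def orthogonal_def)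
    next
      case False
      have "eig (n e) e" "eig (n f) f" using n C ef by auto
      then show ?thesis using False by (rule eig_distinct_orth)
    qed
  qed
  moreover have "\<forall>e\<in>B. norm e = 1 \<and> eig (n e) e \<and> n e \<in> \<Lambda>" using n C by blast
  moreover have "x = 0" if "\<mu> \<in> \<Lambda>" "eig \<mu> x" "\<forall>e\<in>B. x \<bullet> e = 0" for \<mu> x
  proof -
    have "\<forall>e\<in>C \<mu>. x \<bullet> e = 0" using that(1,3) by (auto simp: B_def)
    then show ?thesis using C that(1,2) by blast
  qed
  ultimately show ?thesis by (intro exI[of _ B] exI[of _ n] conjI) auto
qed

end

lemma test_functions_lin: "(\<lambda>x. \<phi> x + c * \<psi> x) \<in> test_functions \<Omega>" if "\<phi> \<in> test_functions \<Omega>" "\<psi> \<in> test_functions \<Omega>"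
proof -
  have sub: "{x. \<phi> x + c * \<psi> x \<noteq> 0} \<subseteq> {x. \<phi> x \<noteq> 0} \<union> {x. \<psi> x \<noteq> 0}" by auto
  then have s: "closure {x. \<phi> x + c * \<psi> x \<noteq> 0} \<subseteq> closure {x. \<phi> x \<noteq> 0} \<union> closure {x. \<psi> x \<noteq> 0}"
    unfolding closure_Un[symmetric] by (rule closure_mono)
  have b: "bounded {x. \<phi> x \<noteq> 0}" "bounded {x. \<psi> x \<noteq> 0}" using that by (simp_all add: test_functions_def)
  have "bounded {x. \<phi> x + c * \<psi> x \<noteq> 0}"
    by (rule bounded_subset[OF _ sub]) (simp add: b)
  then have "compact (closure {x. \<phi> x + c * \<psi> x \<noteq> 0})" by simp
  moreover have "closure {x. \<phi> x + c * \<psi> x \<noteq> 0} \<subseteq> \<Omega>" using s that by (simp add: test_functions_def) (rule subset_trans[OF s], simp)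
  moreover have "C_k k (\<lambda>x. \<phi> x + c * \<psi> x)" for k using that by (simp add: test_functions_def C_k_add C_k_cmult)
  ultimately show ?thesis by (simp add: test_functions_def)
qed

lemma test_functions_0: "(\<lambda>x. 0) \<in> test_functions \<Omega>"
  by (simp add: test_functions_def C_k_0)

section \<open>The closed subspace of Sobolev functions with zero boundary values and its
  eigenspaces\<close>

context bounded_open_set begin

definition S :: "('a, real \<times> 'a) Lsq set" where "S = J ` W12_0 \<Omega>"

text \<open>Two families of orthogonality conditions describe the image: vanishing outside \<Omega>
  and the weak gradient identity. An intersection of kernels of continuous functionals is
  closed.\<close>

lemma J_W12_orthogonal_complement:
  "J ` W12 \<Omega> = {X. (\<forall>y. square_integrable y \<longrightarrow> (\<forall>x\<in>\<Omega>. y x = 0) \<longrightarrow> X \<bullet> toL y = 0) \<and>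
     (\<forall>\<phi>\<in>test_functions \<Omega>. \<forall>b\<in>Basis. X \<bullet> emb (\<lambda>x. (frechet_derivative \<phi> (at x) b, \<phi> x *\<^sub>R b)) = 0)}" (is "_ = ?R")
proof
  show "J ` W12 \<Omega> \<subseteq> ?R"
  proof
    fix X assume "X \<in> J ` W12 \<Omega>"
    then obtain u where u: "u \<in> W12 \<Omega>" "X = J u" by blast
    note D = W12D[OF u(1)]
    have "X \<bullet> toL y = 0" if y: "square_integrable y" "\<forall>x\<in>\<Omega>. y x = 0" for y
    proof -
      have "(\<lambda>x. (indicator \<Omega> x *\<^sub>R (u x, wgrad \<Omega> u x)) \<bullet> y x) = (\<lambda>x. 0)" using y(2) by (auto simp: indicator_def fun_eq_iff inner_prod_def)
      then show ?thesis unfolding u(2) J_def emb_def toL_simps(3)[OF L2_Pair[OF D(1,2), unfolded L2_iff] y(1)] by simp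
    qed
    then show "X \<in> ?R" using D(3) unfolding weak_gradient_iff[OF D(1,2)] u(2) J_def by blast
  qed
  show "?R \<subseteq> J ` W12 \<Omega>"
  proof
    fix X assume X: "X \<in> ?R"
    obtain p where p: "square_integrable p" "X = toL p" by (rule Lsq_cases)
    have [measurable]: "p \<in> borel_measurable lebesgue" using p by measurable
    \<comment> \<open>The part of \<open>p\<close> outside \<Omega> is itself one of the vectors to
      which \<open>X\<close> is orthogonal, so its norm vanishes.\<close>
    define y where "y = (\<lambda>x. indicator (- \<Omega>) x *\<^sub>R p x)"
    have y: "square_integrable y"
      by (rule square_integrable_bound[OF _ square_integrable_integrable[OF p(1)]]) (auto simp: y_def indicator_def)
    have "X \<bullet> toL y = 0" using X y by (auto simp: y_def)
    moreover have "X \<bullet> toL y = (norm (toL y))\<^sup>2"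
    proof -
      have "(\<lambda>x. p x \<bullet> y x) = (\<lambda>x. y x \<bullet> y x)" by (auto simp: y_def indicator_def)
      then show ?thesis unfolding p(2) power2_norm_eq_inner toL_simps(3)[OF p(1) y] toL_simps(3)[OF y y] by simp
    qed
    ultimately have "toL y = toL (\<lambda>x. 0)" by (simp add: toL_0)
    then have "AE x in lebesgue. y x = 0" unfolding toL_simps(4)[OF y square_integrable_0] .
    then have ae: "AE x in lebesgue. p x = indicator \<Omega> x *\<^sub>R p x" by eventually_elim (auto simp: y_def indicator_def split: if_splits)
    have sq: "square_integrable (\<lambda>x. indicator \<Omega> x *\<^sub>R p x)" by (rule square_integrable_AE[OF p(1) ae]) measurable
    have Xe: "X = emb p" unfolding p(2) emb_def toL_simps(4)[OF p(1) sq] by (rule ae)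
    define u where "u = (\<lambda>x. fst (p x))"
    define U where "U = (\<lambda>x. snd (p x))"
    have pu: "p = (\<lambda>x. (u x, U x))" by (simp add: u_def U_def)
    have pm: "p \<in> L2 \<Omega>" using sq by (simp add: L2_iff)
    have um: "u \<in> borel_measurable (lebesgue_on \<Omega>)" "U \<in> borel_measurable (lebesgue_on \<Omega>)"
    proof -
      have c: "continuous_on UNIV (fst :: real \<times> 'a \<Rightarrow> real)" "continuous_on UNIV (snd :: real \<times> 'a \<Rightarrow> 'a)" by (intro continuous_intros)+
      have m: "p \<in> borel_measurable (lebesgue_on \<Omega>)" using pm by (simp add: L2_def)
      show "u \<in> borel_measurable (lebesgue_on \<Omega>)" "U \<in> borel_measurable (lebesgue_on \<Omega>)"
        unfolding u_def U_def using measurable_compose[OF m borel_measurable_continuous_onI[OF c(1)]] measurable_compose[OF m borel_measurable_continuous_onI[OF c(2)]] .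
    qed
    have pi: "integrable (lebesgue_on \<Omega>) (\<lambda>x. (norm (p x))\<^sup>2)" using pm by (simp add: L2_def)
    have uL: "u \<in> L2 \<Omega>" unfolding L2_def
      using um Bochner_Integration.integrable_bound[OF pi, of "\<lambda>x. (norm (u x))\<^sup>2"] by (auto simp: pu norm_Pair)
    have UL: "U \<in> L2 \<Omega>" unfolding L2_def
      using um Bochner_Integration.integrable_bound[OF pi, of "\<lambda>x. (norm (U x))\<^sup>2"] by (auto simp: pu norm_Pair)
    have "has_weak_gradient \<Omega> u U" unfolding weak_gradient_iff[OF uL UL] using X unfolding Xe pu by blast
    then have "u \<in> W12 \<Omega>" "J u = X" using J_eqI[OF uL UL] by (simp_all add: Xe pu)
    then show "X \<in> J ` W12 \<Omega>" by blast
  qed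
qed

lemma closed_J_W12: "closed (J ` W12 \<Omega>)"
proof -
  have c: "closed {X :: ('a, real \<times> 'a) Lsq. X \<bullet> y = 0}" for y by (intro closed_Collect_eq continuous_intros)
  have "J ` W12 \<Omega> = (\<Inter>y\<in>{y. square_integrable y \<and> (\<forall>x\<in>\<Omega>. y x = 0)}. {X. X \<bullet> toL y = 0}) \<inter>
    (\<Inter>\<phi>\<in>test_functions \<Omega>. \<Inter>b\<in>Basis. {X. X \<bullet> emb (\<lambda>x. (frechet_derivative \<phi> (at x) b, \<phi> x *\<^sub>R b)) = 0})"
    unfolding J_W12_orthogonal_complement by auto
  also have "closed \<dots>" by (intro closed_Int closed_INT ballI c)
  finally show ?thesis .
qed

lemma W12_0_iff: "u \<in> W12_0 \<Omega> \<longleftrightarrow> u \<in> W12 \<Omega> \<and> J u \<in> closure (J ` test_functions \<Omega>)"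
proof -
  have "W12_norm \<Omega> (\<lambda>x. u x - \<phi> x) = dist (J \<phi>) (J u)" if "u \<in> W12 \<Omega>" "\<phi> \<in> test_functions \<Omega>" for \<phi>
  proof -
    have "(\<lambda>x. u x - \<phi> x) = (\<lambda>x. u x + (-1) * \<phi> x)" by simp
    then show ?thesis using J_lin[OF that(1) J_test(1)[OF that(2)], of "-1"]
      by (simp add: J_norm[symmetric] dist_norm norm_minus_commute)
  qed
  then show ?thesis unfolding W12_0_def closure_approachable by auto
qed

text \<open>Since \<open>J\<close> is isometric, approximation by test functions in the Sobolev norm
  is a topological closure; a limit is again of the form \<open>J u\<close> because the image of
  \<open>W12 \<Omega>\<close> is closed.\<close>

lemma S_eq_closure: "S = closure (J ` test_functions \<Omega>)"
proof
  show "S \<subseteq> closure (J ` test_functions \<Omega>)" by (auto simp: S_def W12_0_iff)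
  have "closure (J ` test_functions \<Omega>) \<subseteq> J ` W12 \<Omega>"
    using J_test(1) by (intro closure_minimal closed_J_W12) blast
  then show "closure (J ` test_functions \<Omega>) \<subseteq> S" by (auto simp: S_def W12_0_iff)
qed

lemma subspace_S: "subspace S"
proof -
  have lin: "X + c *\<^sub>R Y \<in> S" if XY: "X \<in> S" "Y \<in> S" for X Y c
  proof -
    obtain x y where x: "\<And>n. x n \<in> J ` test_functions \<Omega>" "x \<longlonglongrightarrow> X" and y: "\<And>n. y n \<in> J ` test_functions \<Omega>" "y \<longlonglongrightarrow> Y"
      using XY unfolding S_eq_closure closure_sequential by blast
    have m: "x n + c *\<^sub>R y n \<in> J ` test_functions \<Omega>" for n
    proof -
      obtain \<phi> \<psi> where \<phi>: "\<phi> \<in> test_functions \<Omega>" "x n = J \<phi>" and \<psi>: "\<psi> \<in> test_functions \<Omega>" "y n = J \<psi>" using x(1)[of n] y(1)[of n] by blast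
      show ?thesis unfolding \<phi>(2) \<psi>(2) J_lin(2)[OF J_test(1)[OF \<phi>(1)] J_test(1)[OF \<psi>(1)], symmetric]
        by (intro imageI test_functions_lin \<phi>(1) \<psi>(1))
    qed
    have "(\<lambda>n. x n + c *\<^sub>R y n) \<longlonglongrightarrow> X + c *\<^sub>R Y" by (intro tendsto_intros x(2) y(2))
    then show ?thesis unfolding S_eq_closure closure_sequential
      by (intro exI[of _ "\<lambda>n. x n + c *\<^sub>R y n"] conjI allI m)
  qed
  have 0: "0 \<in> S"
  proof -
    have 0: "J (\<lambda>x. 0) \<in> S" unfolding S_eq_closure using test_functions_0 closure_subset by blast
    show ?thesis using lin[OF 0 0, of "-1"] by simp
  qed
  show ?thesis unfolding subspace_def
    using 0 lin[of _ _ 1] lin[OF 0] by auto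
qed

text \<open>Both sides are continuous in \<open>X\<close>, so the inequality for test functions
  extends to their closure.\<close>

lemma friedrichs_S:
  assumes "\<epsilon> > 0"
  shows "\<exists>W. finite W \<and> (\<forall>X\<in>S. (norm (fstL X))\<^sup>2 \<le> (\<Sum>w\<in>W. (fstL X \<bullet> w)\<^sup>2) + \<epsilon> * (norm X)\<^sup>2)"
proof -
  obtain W :: "('a \<Rightarrow> real) set" where W: "finite W" "\<forall>w\<in>W. square_integrable w"
    and fr: "\<forall>\<phi>\<in>test_functions \<Omega>. (LINT x|lebesgue. (\<phi> x)\<^sup>2) \<le> (\<Sum>w\<in>W. (LINT x|lebesgue. \<phi> x * w x)\<^sup>2) + \<epsilon> * (LINT x|lebesgue. (norm (grad \<phi> x))\<^sup>2)"
    using friedrichs_inequality_test[OF bounded_\<Omega> assms] by blast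
  define A where "A = {X :: ('a, real \<times> 'a) Lsq. (norm (fstL X))\<^sup>2 \<le> (\<Sum>w\<in>W. (fstL X \<bullet> toL w)\<^sup>2) + \<epsilon> * (norm X)\<^sup>2}"
  have cf: "continuous_on UNIV (fstL :: ('a, real \<times> 'a) Lsq \<Rightarrow> _)" by (rule linear_continuous_on[OF bounded_linear_fstL])
  have "closed A" unfolding A_def by (intro closed_Collect_le continuous_intros cf)
  moreover have "J ` test_functions \<Omega> \<subseteq> A"
  proof
    fix X assume "X \<in> J ` test_functions \<Omega>"
    then obtain \<phi> where \<phi>: "\<phi> \<in> test_functions \<Omega>" "X = J \<phi>" by blast
    note T = test_functionD[OF \<phi>(1)]
    have PX: "fstL X = emb \<phi>" unfolding \<phi>(2) J_test(2)[OF \<phi>(1)] by (rule fstL_emb[OF test_L2(1,4)[OF \<phi>(1)]])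
    have e: "emb \<phi> = toL \<phi>" and sq: "square_integrable \<phi>" using compact_support_L2(2,3)[OF T(2,4,5,6)] by blast+
    have g0: "grad \<phi> x = 0" if "x \<notin> \<Omega>" for x
    proof -
      have "x \<notin> closure {x. \<phi> x \<noteq> 0}" using T(5) that by blast
      then show ?thesis using T(7)[of x] by (simp add: grad_def)
    qed
    have "(LINT x|lebesgue. (norm (grad \<phi> x))\<^sup>2) = (LINT x|lebesgue_on \<Omega>. grad \<phi> x \<bullet> grad \<phi> x)"
    proof -
      have "(\<lambda>x. indicator \<Omega> x *\<^sub>R (grad \<phi> x \<bullet> grad \<phi> x)) = (\<lambda>x. (norm (grad \<phi> x))\<^sup>2)"
        using g0 by (auto simp: indicator_def power2_norm_eq_inner fun_eq_iff)
      then show ?thesis by (simp add: integral_restrict_space)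
    qed
    also have "\<dots> \<le> (norm X)\<^sup>2"
      unfolding \<phi>(2) power2_norm_eq_inner J_test(2)[OF \<phi>(1)] emb_Pair_inner[OF test_L2(1,4,1,4)[OF \<phi>(1)]]
      by (simp add: integral_nonneg_AE)
    finally have "\<epsilon> * (LINT x|lebesgue. (norm (grad \<phi> x))\<^sup>2) \<le> \<epsilon> * (norm X)\<^sup>2" using assms by (intro mult_left_mono) auto
    moreover have "(norm (fstL X))\<^sup>2 = (LINT x|lebesgue. (\<phi> x)\<^sup>2)" unfolding PX e norm_toL(1)[OF sq] by simp
    moreover have "fstL X \<bullet> toL w = (LINT x|lebesgue. \<phi> x * w x)" if "w \<in> W" for w
      unfolding PX e using toL_simps(3)[OF sq W(2)[rule_format, OF that]] by simp
    ultimately show "X \<in> A" using fr[rule_format, OF \<phi>(1)] by (simp add: A_def)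
  qed
  ultimately have "S \<subseteq> A" unfolding S_eq_closure by (intro closure_minimal)
  \<comment> \<open>The map \<open>toL\<close> may identify elements of \<open>W\<close>; rescaling compensates for the lost summands.\<close>
  define c where "c = sqrt (real (card W) + 1)"
  have c: "c\<^sup>2 = real (card W) + 1" "c \<noteq> 0" by (auto simp: c_def add_nonneg_eq_0_iff)
  have inj: "inj_on (\<lambda>y :: ('a, real) Lsq. c *\<^sub>R y) (toL ` W)" using c(2) by (auto simp: inj_on_def)
  show ?thesis
  proof (intro exI[of _ "(\<lambda>y. c *\<^sub>R y) ` toL ` W"] conjI ballI)
    show "finite ((\<lambda>y. c *\<^sub>R y) ` toL ` W)" using W by simp
    fix X assume "X \<in> S"
    then have X: "(norm (fstL X))\<^sup>2 \<le> (\<Sum>w\<in>W. (fstL X \<bullet> toL w)\<^sup>2) + \<epsilon> * (norm X)\<^sup>2" using \<open>S \<subseteq> A\<close> by (auto simp: A_def)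
    define s where "s = (\<Sum>y\<in>toL ` W. (fstL X \<bullet> y)\<^sup>2)"
    have s0: "s \<ge> 0" unfolding s_def by (intro sum_nonneg) simp
    have "(fstL X \<bullet> toL w)\<^sup>2 \<le> s" if "w \<in> W" for w
      unfolding s_def using W that by (intro member_le_sum[of "toL w"]) auto
    then have "(\<Sum>w\<in>W. (fstL X \<bullet> toL w)\<^sup>2) \<le> real (card W) * s" by (intro sum_bounded_above) auto
    also have "\<dots> \<le> c\<^sup>2 * s" unfolding c(1) using s0 by (simp add: distrib_right)
    also have "\<dots> = (\<Sum>w\<in>(\<lambda>y. c *\<^sub>R y) ` toL ` W. (fstL X \<bullet> w)\<^sup>2)"
      unfolding sum.reindex[OF inj] s_def sum_distrib_left by (simp add: power_mult_distrib)
    finally show "(norm (fstL X))\<^sup>2 \<le> (\<Sum>w\<in>(\<lambda>y. c *\<^sub>R y) ` toL ` W. (fstL X \<bullet> w)\<^sup>2) + \<epsilon> * (norm X)\<^sup>2" using X by linarith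
  qed
qed

sublocale CE: compact_embedding S fstL
proof (rule compact_embedding.intro)
  show "closed S" by (simp add: S_eq_closure)
qed (fact subspace_S bounded_linear_fstL norm_fstL friedrichs_S)+

lemma W12_0D: "u \<in> W12 \<Omega>" "u \<in> L2 \<Omega>" "wgrad \<Omega> u \<in> L2 \<Omega>" "J u \<in> S" "fstL (J u) = emb u" if "u \<in> W12_0 \<Omega>"
proof -
  show u: "u \<in> W12 \<Omega>" using that by (simp add: W12_0_def)
  note D = W12D[OF u]
  show "u \<in> L2 \<Omega>" "wgrad \<Omega> u \<in> L2 \<Omega>" by fact+
  show "J u \<in> S" using that by (simp add: S_def)
  show "fstL (J u) = emb u" unfolding J_def by (rule fstL_emb[OF D(1,2)])
qed

lemma J_inner: "J u \<bullet> J v = (LINT x|lebesgue_on \<Omega>. u x * v x) + (LINT x|lebesgue_on \<Omega>. wgrad \<Omega> u x \<bullet> wgrad \<Omega> v x)"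
  "emb u \<bullet> emb v = (LINT x|lebesgue_on \<Omega>. u x * v x)" if "u \<in> W12_0 \<Omega>" "v \<in> W12_0 \<Omega>"
  using emb_Pair_inner[OF W12_0D(2,3)[OF that(1)] W12_0D(2,3)[OF that(2)]] emb_inner[OF W12_0D(2)[OF that(1)] W12_0D(2)[OF that(2)]]
  by (simp_all add: J_def)

text \<open>The inner product of \<open>S\<close> exceeds the Dirichlet form by the L2 product,
  which moves the value from \<mu> to 1 + \<mu>.\<close>

lemma eig_iff: "CE.eig (1 + \<mu>) (J u) \<longleftrightarrow> u \<in> eigenspace \<Omega> \<mu>" if u: "u \<in> W12_0 \<Omega>"
proof -
  have "J u \<bullet> J v = (1 + \<mu>) * (fstL (J u) \<bullet> fstL (J v)) \<longleftrightarrow>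
     (LINT x|lebesgue_on \<Omega>. wgrad \<Omega> u x \<bullet> wgrad \<Omega> v x) = \<mu> * (LINT x|lebesgue_on \<Omega>. u x * v x)" if "v \<in> W12_0 \<Omega>" for v
    unfolding W12_0D(5)[OF u] W12_0D(5)[OF that] J_inner[OF u that] by (simp add: distrib_right)
  then show ?thesis using u W12_0D(4)[OF u] unfolding CE.eig_def eigenspace_def by (auto simp: S_def)
qed

lemma emb_sum:
  assumes "finite I" "\<And>i. i \<in> I \<Longrightarrow> \<phi> i \<in> L2 \<Omega>"
  shows "(\<lambda>x. \<Sum>i\<in>I. c i * \<phi> i x) \<in> L2 \<Omega>" "emb (\<lambda>x. \<Sum>i\<in>I. c i * \<phi> i x) = (\<Sum>i\<in>I. c i *\<^sub>R emb (\<phi> i))"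
proof -
  have "(\<lambda>x. \<Sum>i\<in>I. c i * \<phi> i x) \<in> L2 \<Omega> \<and> emb (\<lambda>x. \<Sum>i\<in>I. c i * \<phi> i x) = (\<Sum>i\<in>I. c i *\<^sub>R emb (\<phi> i))"
    using assms
  proof (induction I rule: finite_induct)
    case empty
    have "emb (\<lambda>x. 0 :: real) = 0" by (simp add: emb_def toL_0)
    then show ?case by (simp add: L2_def)
  next
    case (insert i I)
    have i: "(\<lambda>x. c i * \<phi> i x) \<in> L2 \<Omega>" "emb (\<lambda>x. c i * \<phi> i x) = c i *\<^sub>R emb (\<phi> i)"
      using L2_scaleR[of "\<phi> i" "c i"] emb_scaleR[of "\<phi> i" "c i"] insert.prems by simp_all
    have IH: "(\<lambda>x. \<Sum>i\<in>I. c i * \<phi> i x) \<in> L2 \<Omega>" "emb (\<lambda>x. \<Sum>i\<in>I. c i * \<phi> i x) = (\<Sum>i\<in>I. c i *\<^sub>R emb (\<phi> i))"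
      using insert by auto
    show ?case using L2_add[OF i(1) IH(1)] emb_add[OF i(1) IH(1)] i(2) IH(2) insert.hyps by simp
  qed
  then show "(\<lambda>x. \<Sum>i\<in>I. c i * \<phi> i x) \<in> L2 \<Omega>" "emb (\<lambda>x. \<Sum>i\<in>I. c i * \<phi> i x) = (\<Sum>i\<in>I. c i *\<^sub>R emb (\<phi> i))" by blast+
qed

text \<open>Multiplicity compares functions almost everywhere, that is, in L2. An eigenvector whose
  L2 part is zero is zero by \<open>eig_norm\<close>, so the comparison lifts to \<open>S\<close>.
  The last conjunct records that multiplicity 0 leaves no nonzero eigenvector.\<close>

lemma has_multiplicity_span:
  assumes "has_multiplicity \<Omega> \<mu> m"
  shows "\<exists>A. finite A \<and> A \<subseteq> {X. CE.eig (1 + \<mu>) X} \<and> {X. CE.eig (1 + \<mu>) X} \<subseteq> span A \<and> (m = 0 \<longrightarrow> A = {})"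
proof -
  obtain \<phi> :: "nat \<Rightarrow> 'a \<Rightarrow> real" where \<phi>: "\<forall>i<m. \<phi> i \<in> eigenspace \<Omega> \<mu>"
    and sp: "\<forall>u\<in>eigenspace \<Omega> \<mu>. \<exists>c::nat \<Rightarrow> real. AE x in lebesgue_on \<Omega>. u x = (\<Sum>i<m. c i * \<phi> i x)"
    using assms unfolding has_multiplicity_def by blast
  have \<phi>W: "\<phi> i \<in> W12_0 \<Omega>" if "i < m" for i using \<phi> that by (simp add: eigenspace_def)
  have \<phi>e: "CE.eig (1 + \<mu>) (J (\<phi> i))" if "i < m" for i using eig_iff[OF \<phi>W[OF that]] \<phi> that by blast
  define A where "A = (\<lambda>i. J (\<phi> i)) ` {..<m}"
  have "X \<in> span A" if X: "CE.eig (1 + \<mu>) X" for X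
  proof -
    have "X \<in> S" using X by (simp only: CE.eig_def)
    then obtain u where u: "u \<in> W12_0 \<Omega>" "X = J u" unfolding S_def by blast
    then have "u \<in> eigenspace \<Omega> \<mu>" using eig_iff X by blast
    then obtain c where c: "AE x in lebesgue_on \<Omega>. u x = (\<Sum>i<m. c i * \<phi> i x)" using sp by blast
    have L: "\<phi> i \<in> L2 \<Omega>" if "i \<in> {..<m}" for i using W12_0D(2)[OF \<phi>W] that by simp
    have es: "emb u = (\<Sum>i<m. c i *\<^sub>R emb (\<phi> i))"
    proof -
      have sL: "(\<lambda>x. \<Sum>i<m. c i * \<phi> i x) \<in> L2 \<Omega>" by (rule emb_sum(1)) (auto intro: L)
      have "emb u = emb (\<lambda>x. \<Sum>i<m. c i * \<phi> i x)" using c emb_eq_iff[OF W12_0D(2)[OF u(1)] sL] by blast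
      also have "\<dots> = (\<Sum>i<m. c i *\<^sub>R emb (\<phi> i))" by (rule emb_sum(2)) (auto intro: L)
      finally show ?thesis .
    qed
    define Y where "Y = (\<Sum>i<m. c i *\<^sub>R J (\<phi> i))"
    have Y: "CE.eig (1 + \<mu>) Y" unfolding Y_def
      using subspace_sum[OF CE.subspace_eig, of "{..<m}" "\<lambda>i. c i *\<^sub>R J (\<phi> i)" "1 + \<mu>"] subspace_scale[OF CE.subspace_eig] \<phi>e by auto
    have fY: "fstL Y = emb u" unfolding Y_def es
      by (simp add: linear_sum[OF bounded_linear.linear[OF bounded_linear_fstL]] CE.P_simps W12_0D(5)[OF \<phi>W])
    have "CE.eig (1 + \<mu>) (X - Y)" using subspace_diff[OF CE.subspace_eig] X Y by blast
    then have "(norm (X - Y))\<^sup>2 = 0" using CE.eig_norm fY u W12_0D(5)[OF u(1)] by (simp add: CE.P_simps)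
    then have "X = Y" by simp
    also have "Y \<in> span A" unfolding Y_def A_def by (intro span_sum span_scale span_base) auto
    finally show ?thesis .
  qed
  then show ?thesis using \<phi>e by (intro exI[of _ A]) (auto simp: A_def)
qed

end

section \<open>Superposition operators\<close>

lemma primitive_has_derivative:
  assumes g: "continuous_on UNIV g"
  shows "(primitive g has_real_derivative g s) (at s)"
proof -
  \<comment> \<open>An interval with 0 and \<open>s\<close> in its interior, so that the derivative
    within it is a full derivative.\<close>
  define a where "a = min 0 s - 1"
  define b where "b = max 0 s + 1"
  have ab: "a \<le> 0" "0 \<le> b" "a < s" "s < b" by (auto simp: a_def b_def)
  have "((\<lambda>u. LBINT y=0..u. g y) has_vector_derivative g s) (at s within {a..b})"
    using interval_integral_FTC2[of a 0 b g s] ab continuous_on_subset[OF g, of "{a..b}"] by (simp add: zero_ereal_def)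
  moreover have "at s within {a..b} = at s" using ab by (intro at_within_interior) simp
  ultimately show ?thesis unfolding primitive_def[abs_def] by (simp add: has_real_derivative_iff_has_vector_derivative)
qed

lemma primitive_0: "primitive g 0 = 0"
  by (simp add: primitive_def zero_ereal_def)

lemma mean_value_between:
  assumes "\<And>x. (F has_real_derivative f x) (at x)"
  shows "\<exists>\<xi>. min s t \<le> \<xi> \<and> \<xi> \<le> max s t \<and> F t - F s = (t - s) * f \<xi>"
proof -
  consider "s < t" | "t < s" | "s = t" by linarith
  then show ?thesis
  proof cases
    case 1
    then obtain \<xi> where "s < \<xi>" "\<xi> < t" "F t - F s = (t - s) * f \<xi>" using MVT2[of s t F f] assms by blast
    then show ?thesis by (intro exI[of _ \<xi>]) auto
  next
    case 2
    then obtain \<xi> where "t < \<xi>" "\<xi> < s" "F s - F t = (s - t) * f \<xi>" using MVT2[of t s F f] assms by blast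
    then show ?thesis by (intro exI[of _ \<xi>]) (auto simp: algebra_simps)
  qed auto
qed

lemma derivative_bound_lipschitz:
  assumes d: "\<And>x. (F has_real_derivative f x) (at x)" and b: "\<And>x. \<bar>f x\<bar> \<le> C"
  shows "\<bar>F t - F s\<bar> \<le> C * \<bar>t - s\<bar>"
proof -
  obtain \<xi> where "F t - F s = (t - s) * f \<xi>" using mean_value_between[OF d, of s t] by blast
  then have "\<bar>F t - F s\<bar> = \<bar>f \<xi>\<bar> * \<bar>t - s\<bar>" by (simp add: abs_mult)
  also have "\<dots> \<le> C * \<bar>t - s\<bar>" using b by (intro mult_right_mono) auto
  finally show ?thesis .
qed

text \<open>The Steklov mean: for F' = f it is the average of \<open>f\<close> over an interval of
  length 1/(j+1). Applied to the primitive \<open>G\<close> it regularises \<open>g\<close>; applied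
  to a primitive of \<open>G\<close> it regularises \<open>G\<close>, and
  \<open>avg_has_derivative\<close> makes the former the derivative of the latter.\<close>

definition avg :: "nat \<Rightarrow> (real \<Rightarrow> real) \<Rightarrow> real \<Rightarrow> real" where
  "avg j F s = real (Suc j) * (F (s + 1 / real (Suc j)) - F s)"

lemma avg_mean_value:
  assumes "\<And>x. (F has_real_derivative f x) (at x)"
  shows "\<exists>\<xi>. s \<le> \<xi> \<and> \<xi> \<le> s + 1 / real (Suc j) \<and> avg j F s = f \<xi>"
proof -
  have p: "(0::real) < 1 / real (Suc j)" by simp
  obtain \<xi> where x: "min s (s + 1 / real (Suc j)) \<le> \<xi>" "\<xi> \<le> max s (s + 1 / real (Suc j))"
    "F (s + 1 / real (Suc j)) - F s = (s + 1 / real (Suc j) - s) * f \<xi>"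
    using mean_value_between[OF assms, of s "s + 1 / real (Suc j)"] by blast
  have "avg j F s = f \<xi>" unfolding avg_def x(3) by simp
  moreover have "s \<le> \<xi>" "\<xi> \<le> s + 1 / real (Suc j)" using x(1,2) p by auto
  ultimately show ?thesis by blast
qed

lemma avg_bound:
  assumes "\<And>x. (F has_real_derivative f x) (at x)" "\<And>x. \<bar>f x\<bar> \<le> C"
  shows "\<bar>avg j F s\<bar> \<le> C"
  using avg_mean_value[OF assms(1), of s j] assms(2) by metis

text \<open>The two increments of \<open>F\<close> are estimated separately, which leaves the factor
  j + 1 in the constant.\<close>

lemma avg_lipschitz:
  assumes "\<And>x. (F has_real_derivative f x) (at x)" "\<And>x. \<bar>f x\<bar> \<le> C"
  shows "\<bar>avg j F t - avg j F s\<bar> \<le> (2 * C * real (Suc j)) * \<bar>t - s\<bar>"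
proof -
  let ?h = "1 / real (Suc j)"
  have "\<bar>avg j F t - avg j F s\<bar> = real (Suc j) * \<bar>(F (t + ?h) - F (s + ?h)) - (F t - F s)\<bar>"
  proof -
    have "avg j F t - avg j F s = real (Suc j) * ((F (t + ?h) - F (s + ?h)) - (F t - F s))"
      unfolding avg_def by (simp add: algebra_simps)
    then show ?thesis by (simp only: abs_mult abs_of_nat)
  qed
  also have "\<dots> \<le> real (Suc j) * (C * \<bar>t - s\<bar> + C * \<bar>t - s\<bar>)"
    using derivative_bound_lipschitz[OF assms, of "t + ?h" "s + ?h"] derivative_bound_lipschitz[OF assms, of t s]
    by (intro mult_left_mono) auto
  finally show ?thesis by (simp add: algebra_simps)
qed

lemma avg_has_derivative:
  assumes "\<And>x. (F has_real_derivative f x) (at x)"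
  shows "(avg j F has_real_derivative avg j f s) (at s)"
proof -
  have "((\<lambda>s. F (s + 1 / real (Suc j))) has_real_derivative f (s + 1 / real (Suc j))) (at s)"
    using assms[of "s + 1 / real (Suc j)"] by (simp add: DERIV_shift)
  then show ?thesis unfolding avg_def[abs_def] by (intro DERIV_cmult DERIV_diff assms)
qed

text \<open>The mean value theorem at an intermediate point gives \<open>L\<close> in place of the
  optimal \<open>L / 2\<close>; the step size of the descent is computed for this constant.\<close>

lemma taylor_lipschitz_derivative:
  assumes d: "\<And>x. (H has_real_derivative h x) (at x)" and L: "\<And>s t. \<bar>h t - h s\<bar> \<le> L * \<bar>t - s\<bar>" "L \<ge> 0"
  shows "H (s + t) \<le> H s + h s * t + L * t\<^sup>2"
proof -
  obtain \<xi> where x: "min s (s + t) \<le> \<xi>" "\<xi> \<le> max s (s + t)" "H (s + t) - H s = (s + t - s) * h \<xi>"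
    using mean_value_between[OF d, of s "s + t"] by blast
  have "\<bar>\<xi> - s\<bar> \<le> \<bar>t\<bar>" using x(1,2) by (auto simp: abs_if min_def max_def split: if_splits)
  then have "\<bar>h \<xi> - h s\<bar> \<le> L * \<bar>t\<bar>" using L(1)[of \<xi> s] L(2) by (meson mult_left_mono order_trans)
  then have "t * (h \<xi> - h s) \<le> \<bar>t\<bar> * (L * \<bar>t\<bar>)"
    by (metis abs_ge_self abs_mult abs_ge_zero mult_left_mono order_trans)
  also have "\<dots> = L * t\<^sup>2" by (simp add: power2_eq_square)
  finally show ?thesis using x(3) by (simp add: algebra_simps)
qed

text \<open>Index and argument move together, because the almost critical points change with the
  regularisation. The intermediate points of the mean value theorem are squeezed to
  \<open>l\<close>.\<close>

lemma avg_limit: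
  assumes d: "\<And>x. (F has_real_derivative f x) (at x)" and c: "continuous_on UNIV f"
    and p: "strict_mono (p :: nat \<Rightarrow> nat)" and s: "s \<longlonglongrightarrow> l"
  shows "(\<lambda>n. avg (p n) F (s n)) \<longlonglongrightarrow> f l"
proof -
  have "\<forall>n. \<exists>\<xi>. s n \<le> \<xi> \<and> \<xi> \<le> s n + 1 / real (Suc (p n)) \<and> avg (p n) F (s n) = f \<xi>"
    using avg_mean_value[OF d] by blast
  from choice[OF this] obtain \<xi> where \<xi>: "\<forall>n. s n \<le> \<xi> n \<and> \<xi> n \<le> s n + 1 / real (Suc (p n)) \<and> avg (p n) F (s n) = f (\<xi> n)" ..
  have "(\<lambda>n. s n + 1 / real (Suc (p n))) \<longlonglongrightarrow> l + 0"
    using LIMSEQ_subseq_LIMSEQ[OF LIMSEQ_inverse_Suc p] by (intro tendsto_add s) (simp add: o_def)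
  then have lim: "(\<lambda>n. s n + 1 / real (Suc (p n))) \<longlonglongrightarrow> l" by (simp only: add_0_right)
  have "\<xi> \<longlonglongrightarrow> l"
  proof (rule tendsto_sandwich[OF _ _ s lim])
    show "\<forall>\<^sub>F n in sequentially. s n \<le> \<xi> n" "\<forall>\<^sub>F n in sequentially. \<xi> n \<le> s n + 1 / real (Suc (p n))"
      by (rule always_eventually, use \<xi> in blast)+
  qed
  then have "(\<lambda>n. f (\<xi> n)) \<longlonglongrightarrow> f l" by (rule continuous_on_tendsto_compose[OF c]) simp_all
  moreover have "(\<lambda>n. avg (p n) F (s n)) = (\<lambda>n. f (\<xi> n))" using \<xi> by blast
  ultimately show ?thesis by (simp only:)
qed

text \<open>A representative of a class; algebraic identities hold for representatives only almost
  everywhere (\<open>fn_AE\<close>).\<close>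

definition fn :: "('a::euclidean_space, 'b::euclidean_space) Lsq \<Rightarrow> 'a \<Rightarrow> 'b" where
  "fn X = (SOME u. square_integrable u \<and> X = toL u)"

lemma fn: "square_integrable (fn X)" "toL (fn X) = X"
proof -
  have "\<exists>u. square_integrable u \<and> X = toL u" using Lsq_cases[of X] by blast
  from someI_ex[OF this] show "square_integrable (fn X)" "toL (fn X) = X" by (simp_all add: fn_def)
qed

lemma fn_AE:
  "square_integrable u \<Longrightarrow> AE x in lebesgue. fn (toL u) x = u x"
  "AE x in lebesgue. fn (X + Y) x = fn X x + fn Y x"
proof -
  show "AE x in lebesgue. fn (toL u) x = u x" if "square_integrable u"
    using toL_simps(4)[OF fn(1) that, of "toL u"] fn(2)[of "toL u"] by simp
  show "AE x in lebesgue. fn (X + Y) x = fn X x + fn Y x"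
    using toL_simps(4)[OF fn(1) square_integrable_add[OF fn(1) fn(1)], of "X + Y" X Y] by (simp add: fn toL_simps)
qed

context bounded_open_set begin

lemma AE_on: "AE x in lebesgue. Q x \<Longrightarrow> AE x in lebesgue_on \<Omega>. Q x"
  unfolding AE_restrict_space_iff[OF \<Omega>_sets(2)] by auto

lemma square_integrable_L2: "square_integrable p \<Longrightarrow> p \<in> L2 \<Omega>"
  unfolding L2_iff by (rule square_integrable_bound[OF _ square_integrable_integrable]) (auto simp: indicator_def)

lemma norm_emb_le: "norm (emb p) \<le> norm (toL p)" if "square_integrable p"
proof -
  have sq: "square_integrable (\<lambda>x. indicator \<Omega> x *\<^sub>R p x)" using square_integrable_L2[OF that] by (simp add: L2_iff)
  have "(norm (emb p))\<^sup>2 \<le> (norm (toL p))\<^sup>2" unfolding emb_def norm_toL(1)[OF sq] norm_toL(1)[OF that]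
    by (intro integral_mono square_integrable_integrable sq that) (auto simp: indicator_def)
  then show ?thesis by (rule power2_le_imp_le) simp
qed

lemma emb_inner_toL: "emb p \<bullet> toL q = emb p \<bullet> emb q" if p: "p \<in> L2 \<Omega>" and q: "square_integrable q"
proof -
  have "(\<lambda>x. (indicator \<Omega> x *\<^sub>R p x) \<bullet> q x) = (\<lambda>x. indicator \<Omega> x *\<^sub>R (p x \<bullet> q x))" by (auto simp: indicator_def)
  then show ?thesis
    unfolding emb_inner[OF p square_integrable_L2[OF q]] unfolding emb_def toL_simps(3)[OF p[unfolded L2_iff] q]
    by (simp add: integral_restrict_space)
qed

lemma finite_measure_\<Omega>: "finite_measure (lebesgue_on \<Omega>)"
  using \<Omega>_lmeasurable by (intro finite_measureI) (auto simp: fmeasurable_def emeasure_restrict_space space_restrict_space)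

definition vol :: real where "vol = measure (lebesgue_on \<Omega>) (space (lebesgue_on \<Omega>))"

lemma vol_nonneg: "vol \<ge> 0" by (simp add: vol_def)

lemma L2_dominated:
  assumes m: "w \<in> borel_measurable (lebesgue_on \<Omega>)" and u: "u \<in> L2 \<Omega>" and le: "\<And>x. norm (w x) \<le> norm (u x)"
  shows "w \<in> L2 \<Omega>" "norm (emb w) \<le> norm (emb u)"
proof -
  have iu: "integrable (lebesgue_on \<Omega>) (\<lambda>x. (norm (u x))\<^sup>2)" using u by (simp add: L2_def)
  have le2: "(norm (w x))\<^sup>2 \<le> (norm (u x))\<^sup>2" for x by (intro power_mono le norm_ge_zero)
  have iw: "integrable (lebesgue_on \<Omega>) (\<lambda>x. (norm (w x))\<^sup>2)"
    by (rule Bochner_Integration.integrable_bound[OF iu]) (use m le2 in auto)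
  then show w: "w \<in> L2 \<Omega>" using m by (simp add: L2_def)
  show "norm (emb w) \<le> norm (emb u)" unfolding emb_norm[OF w] emb_norm[OF u] L2_norm_def
    by (intro real_sqrt_le_mono integral_mono iw iu le2)
qed

lemma L2_const: "(\<lambda>x. c :: real) \<in> L2 \<Omega>" "norm (emb (\<lambda>x. c)) = \<bar>c\<bar> * sqrt vol"
proof -
  interpret finite_measure "lebesgue_on \<Omega>" by (rule finite_measure_\<Omega>)
  show c: "(\<lambda>x. c) \<in> L2 \<Omega>" by (simp add: L2_def)
  show "norm (emb (\<lambda>x. c)) = \<bar>c\<bar> * sqrt vol" unfolding emb_norm[OF c] L2_norm_def by (simp add: vol_def real_sqrt_mult)
qed

lemma L2_measurable: "u \<in> L2 \<Omega> \<Longrightarrow> u \<in> borel_measurable (lebesgue_on \<Omega>)"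
  by (simp add: L2_def)

lemmas fn_L2 = square_integrable_L2[OF fn(1)] L2_measurable[OF square_integrable_L2[OF fn(1)]]

text \<open>The superposition (Nemytskii) operator on classes. The cut-off to \<Omega> inside
  \<open>emb\<close> keeps a bounded \<open>h\<close> with nonzero value at 0 within L2.\<close>

definition nem :: "(real \<Rightarrow> real) \<Rightarrow> ('a, real) Lsq \<Rightarrow> ('a, real) Lsq" where
  "nem h v = emb (\<lambda>x. h (fn v x))"

definition pot :: "(real \<Rightarrow> real) \<Rightarrow> ('a, real) Lsq \<Rightarrow> real" where
  "pot H v = (LINT x|lebesgue_on \<Omega>. H (fn v x))"

lemma nem_L2:
  fixes h :: "real \<Rightarrow> real" and u :: "'a \<Rightarrow> real"
  assumes h: "h \<in> borel_measurable borel" "\<And>s. \<bar>h s\<bar> \<le> C" and u: "u \<in> borel_measurable (lebesgue_on \<Omega>)"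
  shows "(\<lambda>x. h (u x)) \<in> L2 \<Omega>" "norm (emb (\<lambda>x. h (u x))) \<le> C * sqrt vol"
proof -
  have C0: "C \<ge> 0" using h(2)[of 0] by linarith
  have m: "(\<lambda>x. h (u x)) \<in> borel_measurable (lebesgue_on \<Omega>)" using measurable_compose[OF u h(1)] .
  have le: "norm (h (u x)) \<le> norm C" for x using h(2)[of "u x"] C0 by simp
  show "(\<lambda>x. h (u x)) \<in> L2 \<Omega>" by (rule L2_dominated(1)[OF m L2_const(1) le])
  show "norm (emb (\<lambda>x. h (u x))) \<le> C * sqrt vol" using L2_dominated(2)[OF m L2_const(1) le] L2_const(2)[of C] C0 by simp
qed

lemma fn_emb: "AE x in lebesgue_on \<Omega>. fn (emb u) x = u x" if "u \<in> L2 \<Omega>"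
  unfolding AE_restrict_space_iff[OF \<Omega>_sets(2)] using fn_AE(1)[OF that[unfolded L2_iff]]
  unfolding emb_def by eventually_elim (auto simp: indicator_def)

lemma nem_emb:
  assumes h: "h \<in> borel_measurable borel" "\<And>s. \<bar>h s\<bar> \<le> C" and u: "u \<in> L2 \<Omega>"
  shows "nem h (emb u) = emb (\<lambda>x. h (u x))"
proof -
  have um: "u \<in> borel_measurable (lebesgue_on \<Omega>)" using u by (simp add: L2_def)
  have "AE x in lebesgue_on \<Omega>. h (fn (emb u) x) = h (u x)" using fn_emb[OF u] by eventually_elim simp
  then show ?thesis unfolding nem_def emb_eq_iff[OF nem_L2(1)[OF h fn_L2(2)] nem_L2(1)[OF h um]] .
qed

lemma pot_emb:
  assumes h: "H \<in> borel_measurable borel" and u: "u \<in> L2 \<Omega>"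
  shows "pot H (emb u) = (LINT x|lebesgue_on \<Omega>. H (u x))"
proof -
  have um: "u \<in> borel_measurable (lebesgue_on \<Omega>)" using u by (simp add: L2_def)
  have "AE x in lebesgue_on \<Omega>. H (fn (emb u) x) = H (u x)" using fn_emb[OF u] by eventually_elim simp
  then show ?thesis unfolding pot_def
    by (intro integral_cong_AE measurable_compose[OF fn_L2(2) h] measurable_compose[OF um h])
qed

lemma pot_integrable:
  fixes H :: "real \<Rightarrow> real"
  assumes H: "H \<in> borel_measurable borel" "\<And>s. \<bar>H s\<bar> \<le> A + A * \<bar>s\<bar>" and u: "u \<in> L2 \<Omega>"
  shows "integrable (lebesgue_on \<Omega>) (\<lambda>x. H (u x))"
proof -
  interpret finite_measure "lebesgue_on \<Omega>" by (rule finite_measure_\<Omega>)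
  have um: "u \<in> borel_measurable (lebesgue_on \<Omega>)" and i: "integrable (lebesgue_on \<Omega>) (\<lambda>x. (norm (u x))\<^sup>2)" using u by (simp_all add: L2_def)
  have "\<bar>H 0\<bar> \<le> A" using H(2)[of 0] by simp
  then have A0: "A \<ge> 0" by linarith
  have Hb: "\<bar>H s\<bar> \<le> 2 * A + A * (norm s)\<^sup>2" for s
  proof -
    have "\<bar>s\<bar> \<le> 1 + s\<^sup>2" using zero_le_power2[of "\<bar>s\<bar> - 1"] zero_le_power2[of s] by (simp add: power2_diff)
    then have "A * \<bar>s\<bar> \<le> A * (1 + s\<^sup>2)" using A0 by (rule mult_left_mono)
    then show ?thesis using H(2)[of s] by (simp add: distrib_left)
  qed
  have bd: "norm (H (u x)) \<le> norm (2 * A + A * (norm (u x))\<^sup>2)" for x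
    unfolding real_norm_def[of "H (u x)"] by (rule order_trans[OF Hb]) (simp only: real_norm_def abs_ge_self)
  have "integrable (lebesgue_on \<Omega>) (\<lambda>x. 2 * A + A * (norm (u x))\<^sup>2)"
    by (intro Bochner_Integration.integrable_add integrable_mult_right i integrable_const)
  then show ?thesis
    by (rule Bochner_Integration.integrable_bound[OF _ measurable_compose[OF um H(1)]]) (rule AE_I2, rule bd)
qed

lemma nem_lipschitz:
  assumes h: "h \<in> borel_measurable borel" "\<And>s. \<bar>h s\<bar> \<le> C" and L: "\<And>s t. \<bar>h t - h s\<bar> \<le> L * \<bar>t - s\<bar>" "L \<ge> 0"
  shows "norm (nem h v - nem h w) \<le> L * norm (v - w)"
proof -
  note hv = nem_L2(1)[OF h fn_L2(2)[of v]] and hw = nem_L2(1)[OF h fn_L2(2)[of w]]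
  have dL: "(\<lambda>x. fn v x - fn w x) \<in> L2 \<Omega>" by (rule L2_diff[OF fn_L2(1) fn_L2(1)])
  have "norm (nem h v - nem h w) = norm (emb (\<lambda>x. h (fn v x) - h (fn w x)))"
    unfolding nem_def emb_diff[OF hv hw] ..
  also have "\<dots> \<le> norm (emb (\<lambda>x. L *\<^sub>R (fn v x - fn w x)))"
  proof (rule L2_dominated(2)[OF _ L2_scaleR[OF dL]])
    show "(\<lambda>x. h (fn v x) - h (fn w x)) \<in> borel_measurable (lebesgue_on \<Omega>)" using L2_diff[OF hv hw] by (simp add: L2_def)
    show "norm (h (fn v x) - h (fn w x)) \<le> norm (L *\<^sub>R (fn v x - fn w x))" for x
      using L(1)[of "fn v x" "fn w x"] L(2) by (simp add: abs_mult)
  qed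
  also have "\<dots> = L * norm (emb (\<lambda>x. fn v x - fn w x))" unfolding emb_scaleR[OF dL] using L(2) by simp
  also have "\<dots> \<le> L * norm (toL (\<lambda>x. fn v x - fn w x))"
    by (intro mult_left_mono norm_emb_le square_integrable_diff fn L)
  also have "toL (\<lambda>x. fn v x - fn w x) = v - w" by (simp add: toL_simps fn)
  finally show ?thesis .
qed

text \<open>The pointwise inequality integrated over \<Omega>. As \<open>w\<close> need not vanish
  outside \<Omega>, the quadratic term is finally enlarged to the norm over the whole space.\<close>

lemma pot_taylor:
  assumes h: "h \<in> borel_measurable borel" "\<And>s. \<bar>h s\<bar> \<le> C" and H: "H \<in> borel_measurable borel" "\<And>s. \<bar>H s\<bar> \<le> A + A * \<bar>s\<bar>"
    and taylor: "\<And>s t. H (s + t) \<le> H s + h s * t + L * t\<^sup>2" and L: "L \<ge> 0"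
  shows "pot H (v + w) \<le> pot H v + nem h v \<bullet> w + L * (norm w)\<^sup>2"
proof -
  note hv = nem_L2(1)[OF h fn_L2(2)[of v]]
  have i2: "integrable (lebesgue_on \<Omega>) (\<lambda>x. h (fn v x) \<bullet> fn w x)" by (rule L2_inner_integrable[OF hv fn_L2(1)])
  have i3: "integrable (lebesgue_on \<Omega>) (\<lambda>x. fn w x \<bullet> fn w x)" by (rule L2_inner_integrable[OF fn_L2(1) fn_L2(1)])
  have i1: "integrable (lebesgue_on \<Omega>) (\<lambda>x. H (fn u x))" for u by (rule pot_integrable[OF H fn_L2(1)])
  have ae: "AE x in lebesgue_on \<Omega>. fn (v + w) x = fn v x + fn w x" by (rule AE_on[OF fn_AE(2)])
  have "pot H (v + w) \<le> (LINT x|lebesgue_on \<Omega>. (H (fn v x) + h (fn v x) \<bullet> fn w x) + L * (fn w x \<bullet> fn w x))"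
    unfolding pot_def
  proof (rule integral_mono_AE)
    show "integrable (lebesgue_on \<Omega>) (\<lambda>x. (H (fn v x) + h (fn v x) \<bullet> fn w x) + L * (fn w x \<bullet> fn w x))"
      by (intro Bochner_Integration.integrable_add integrable_mult_right i1 i2 i3)
    show "AE x in lebesgue_on \<Omega>. H (fn (v + w) x) \<le> (H (fn v x) + h (fn v x) \<bullet> fn w x) + L * (fn w x \<bullet> fn w x)"
      using ae by eventually_elim (use taylor in \<open>simp add: power2_eq_square\<close>)
  qed (rule i1)
  also have "\<dots> = pot H v + (LINT x|lebesgue_on \<Omega>. h (fn v x) \<bullet> fn w x) + L * (LINT x|lebesgue_on \<Omega>. fn w x \<bullet> fn w x)"
    using i1[of v] i2 i3 by (simp add: pot_def)
  also have "(LINT x|lebesgue_on \<Omega>. h (fn v x) \<bullet> fn w x) = nem h v \<bullet> w"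
    using emb_inner[OF hv fn_L2(1)] emb_inner_toL[OF hv fn(1), of w] by (simp add: nem_def fn)
  also have "(LINT x|lebesgue_on \<Omega>. fn w x \<bullet> fn w x) = (norm (emb (fn w)))\<^sup>2"
    using emb_inner[OF fn_L2(1) fn_L2(1), of w w] by (simp add: power2_norm_eq_inner)
  also have "L * (norm (emb (fn w)))\<^sup>2 \<le> L * (norm w)\<^sup>2"
    using norm_emb_le[OF fn(1), of w] L by (intro mult_left_mono power_mono) (simp_all add: fn)
  finally show ?thesis by simp
qed

lemma pot_close:
  assumes H: "H \<in> borel_measurable borel" "\<And>s. \<bar>H s\<bar> \<le> A + A * \<bar>s\<bar>" and K: "K \<in> borel_measurable borel" "\<And>s. \<bar>K s\<bar> \<le> A' + A' * \<bar>s\<bar>"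
    and le: "\<And>s. \<bar>H s - K s\<bar> \<le> C"
  shows "\<bar>pot H v - pot K v\<bar> \<le> C * vol"
proof -
  interpret finite_measure "lebesgue_on \<Omega>" by (rule finite_measure_\<Omega>)
  have i: "integrable (lebesgue_on \<Omega>) (\<lambda>x. H (fn v x))" "integrable (lebesgue_on \<Omega>) (\<lambda>x. K (fn v x))"
    by (rule pot_integrable[OF H fn_L2(1)] pot_integrable[OF K fn_L2(1)])+
  have "\<bar>pot H v - pot K v\<bar> = \<bar>LINT x|lebesgue_on \<Omega>. H (fn v x) - K (fn v x)\<bar>" using i by (simp add: pot_def)
  also have "\<dots> \<le> (LINT x|lebesgue_on \<Omega>. \<bar>H (fn v x) - K (fn v x)\<bar>)" by (rule integral_abs_bound)
  also have "\<dots> \<le> (LINT x|lebesgue_on \<Omega>. C)" using i le by (intro integral_mono) auto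
  also have "\<dots> = C * vol" by (simp add: vol_def)
  finally show ?thesis .
qed

lemma pot_growth:
  assumes H: "H \<in> borel_measurable borel" "\<And>s. \<bar>H s\<bar> \<le> C * \<bar>s\<bar>" and C: "C \<ge> 0"
  shows "\<bar>pot H v\<bar> \<le> C * sqrt vol * norm v"
proof -
  have aL: "(\<lambda>x. \<bar>fn v x\<bar>) \<in> L2 \<Omega>" "norm (emb (\<lambda>x. \<bar>fn v x\<bar>)) \<le> norm (emb (fn v))"
    using L2_dominated[OF borel_measurable_abs[OF fn_L2(2)[of v]] fn_L2(1)[of v]] by simp_all
  have ia: "integrable (lebesgue_on \<Omega>) (\<lambda>x. \<bar>fn v x\<bar>)" using L2_inner_integrable[OF L2_const(1)[of 1] aL(1)] by simp
  have "\<bar>H s\<bar> \<le> C + C * \<bar>s\<bar>" for s using H(2)[of s] C by linarith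
  then have iH: "integrable (lebesgue_on \<Omega>) (\<lambda>x. H (fn v x))" by (rule pot_integrable[OF H(1) _ fn_L2(1)])
  have "\<bar>pot H v\<bar> \<le> (LINT x|lebesgue_on \<Omega>. \<bar>H (fn v x)\<bar>)" unfolding pot_def by (rule integral_abs_bound)
  also have "\<dots> \<le> (LINT x|lebesgue_on \<Omega>. C * \<bar>fn v x\<bar>)" using iH ia H(2) by (intro integral_mono) auto
  also have "\<dots> = C * (emb (\<lambda>x. 1) \<bullet> emb (\<lambda>x. \<bar>fn v x\<bar>))" unfolding emb_inner[OF L2_const(1) aL(1)] by simp
  also have "\<dots> \<le> C * (norm (emb (\<lambda>x. 1 :: real)) * norm (emb (\<lambda>x. \<bar>fn v x\<bar>)))" using C by (intro mult_left_mono norm_cauchy_schwarz)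
  also have "\<dots> \<le> C * (sqrt vol * norm v)"
    using aL(2) norm_emb_le[OF fn(1), of v] C vol_nonneg by (intro mult_left_mono mult_mono) (simp_all add: L2_const fn)
  finally show ?thesis by (simp add: mult.assoc)
qed

text \<open>Convergence almost everywhere is available only along a subsequence of an L2 convergent
  sequence, hence the form of the conclusion. Along it dominated convergence applies: squared
  differences are at most (2C)^2 and \<Omega> has finite measure.\<close>

lemma nem_convergence:
  assumes h: "\<And>j. h j \<in> borel_measurable borel" "\<And>j s. \<bar>h j s\<bar> \<le> C" and g: "g \<in> borel_measurable borel" "\<And>s. \<bar>g s\<bar> \<le> C"
    and conv: "\<And>p s l. strict_mono (p :: nat \<Rightarrow> nat) \<Longrightarrow> s \<longlonglongrightarrow> l \<Longrightarrow> (\<lambda>n. h (p n) (s n)) \<longlonglongrightarrow> g l"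
    and r: "strict_mono (r :: nat \<Rightarrow> nat)" and X: "X \<longlonglongrightarrow> v"
  shows "\<exists>q. strict_mono (q :: nat \<Rightarrow> nat) \<and> (\<lambda>j. nem (h (r (q j))) (X (q j))) \<longlonglongrightarrow> nem g v"
proof -
  interpret finite_measure "lebesgue_on \<Omega>" by (rule finite_measure_\<Omega>)
  have "(\<lambda>n. toL (fn (X n))) \<longlonglongrightarrow> toL (fn v)" using X by (simp add: fn)
  from Lsq_limit_AE_subsequence[OF fn(1) fn(1) this] obtain q where q: "strict_mono (q :: nat \<Rightarrow> nat)"
    and ae: "AE x in lebesgue. (\<lambda>n. fn (X (q n)) x) \<longlonglongrightarrow> fn v x" by blast
  have rq: "strict_mono (\<lambda>j. r (q j))" using strict_mono_o[OF r q] by (simp add: o_def)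
  define d where "d = (\<lambda>j x. h (r (q j)) (fn (X (q j)) x) - g (fn v x))"
  note hL = nem_L2(1)[OF h fn_L2(2)] and gL = nem_L2(1)[OF g fn_L2(2)]
  have dL: "d j \<in> L2 \<Omega>" for j unfolding d_def by (rule L2_diff[OF hL gL])
  have db: "(d j x)\<^sup>2 \<le> (2 * C)\<^sup>2" for j x
  proof -
    have "\<bar>d j x\<bar> \<le> 2 * C" using h(2)[of "r (q j)" "fn (X (q j)) x"] g(2)[of "fn v x"] unfolding d_def by linarith
    then show ?thesis using power_mono[of "\<bar>d j x\<bar>" "2 * C" 2] by simp
  qed
  have "(\<lambda>j. LINT x|lebesgue_on \<Omega>. (d j x)\<^sup>2) \<longlonglongrightarrow> (LINT x|lebesgue_on \<Omega>. 0)"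
  proof (rule integral_dominated_convergence[where w = "\<lambda>x. (2 * C)\<^sup>2"])
    show "(\<lambda>x. (d j x)\<^sup>2) \<in> borel_measurable (lebesgue_on \<Omega>)" for j by (rule borel_measurable_power[OF L2_measurable[OF dL]])
    show "AE x in lebesgue_on \<Omega>. (\<lambda>j. (d j x)\<^sup>2) \<longlonglongrightarrow> 0"
      using AE_on[OF ae]
    proof eventually_elim
      case (elim x)
      have "(\<lambda>j. d j x) \<longlonglongrightarrow> g (fn v x) - g (fn v x)" unfolding d_def by (intro tendsto_diff tendsto_const conv[OF rq elim])
      from tendsto_power[OF this, of 2] show ?case by simp
    qed
    show "AE x in lebesgue_on \<Omega>. norm ((d j x)\<^sup>2) \<le> (2 * C)\<^sup>2" for j using db by simp
  qed auto
  then have "(\<lambda>j. sqrt (LINT x|lebesgue_on \<Omega>. (d j x)\<^sup>2)) \<longlonglongrightarrow> sqrt 0" by (intro tendsto_real_sqrt) simp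
  moreover have "sqrt (LINT x|lebesgue_on \<Omega>. (d j x)\<^sup>2) = norm (nem (h (r (q j))) (X (q j)) - nem g v)" for j
  proof -
    have "nem (h (r (q j))) (X (q j)) - nem g v = emb (d j)" unfolding nem_def d_def by (rule emb_diff[OF hL gL, symmetric])
    then show ?thesis using emb_norm[OF dL[of j]] by (simp add: L2_norm_def)
  qed
  ultimately have "(\<lambda>j. norm (nem (h (r (q j))) (X (q j)) - nem g v)) \<longlonglongrightarrow> 0" by simp
  then have "(\<lambda>j. nem (h (r (q j))) (X (q j))) \<longlonglongrightarrow> nem g v" by (rule LIM_zero_cancel[OF tendsto_norm_zero_cancel])
  then show ?thesis using q by blast
qed

end

section \<open>The boundary value problem at resonance\<close>

context bounded_open_set begin

text \<open>Positive multiplicity provides a nonzero eigenvector, whose shifted value 1 + \<mu> is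
  at least 1. It ensures that the shifted resonant value is positive.\<close>

lemma eigenvalue_nonneg:
  assumes mult: "has_multiplicity \<Omega> \<mu> m" and m: "m > 0"
  shows "\<mu> \<ge> 0"
proof -
  obtain \<phi> :: "nat \<Rightarrow> 'a \<Rightarrow> real" where \<phi>: "\<forall>i<m. \<phi> i \<in> eigenspace \<Omega> \<mu>"
    and ind: "\<forall>c::nat \<Rightarrow> real. (AE x in lebesgue_on \<Omega>. (\<Sum>i<m. c i * \<phi> i x) = 0) \<longrightarrow> (\<forall>i<m. c i = 0)"
    using mult unfolding has_multiplicity_def by blast
  have e0: "\<phi> 0 \<in> eigenspace \<Omega> \<mu>" using \<phi> m by blast
  then have W: "\<phi> 0 \<in> W12_0 \<Omega>" by (simp add: eigenspace_def)
  have eig: "CE.eig (1 + \<mu>) (J (\<phi> 0))" using eig_iff[OF W] e0 by blast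
  have "J (\<phi> 0) \<noteq> 0"
  proof
    assume "J (\<phi> 0) = 0"
    then have "emb (\<phi> 0) = 0" using W12_0D(5)[OF W] by (simp add: CE.P_simps)
    then have z: "emb (\<phi> 0) = emb (\<lambda>x. 0 :: real)" by (simp add: emb_def toL_0)
    have "AE x in lebesgue_on \<Omega>. \<phi> 0 x = 0"
      using z emb_eq_iff[OF W12_0D(2)[OF W] L2_const(1)[of 0]] by blast
    moreover have "(\<Sum>i<m. (if i = 0 then 1 else 0) * \<phi> i x) = \<phi> 0 x" for x
    proof -
      have "(\<Sum>i<m. (if i = 0 then 1 else 0) * \<phi> i x) = (\<Sum>i<m. if i = 0 then \<phi> 0 x else 0)" by (intro sum.cong) auto
      then show ?thesis using m by simp
    qed
    ultimately have "AE x in lebesgue_on \<Omega>. (\<Sum>i<m. (if i = 0 then 1 else 0 :: real) * \<phi> i x) = 0" by simp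
    then have "(if (0::nat) = 0 then 1 else 0 :: real) = 0" using ind[rule_format, of "\<lambda>i. if i = 0 then 1 else 0" 0] m by blast
    then show False by simp
  qed
  then show ?thesis using CE.eig_eval_ge_1[OF eig] by simp
qed

text \<open>Transfers the premises of the abstract solvability condition to functions: norms,
  normalised limits and the functional agree under \<open>J\<close>.\<close>

lemma SC_sequence_J:
  assumes X: "\<And>n. X n \<in> S" and inf: "filterlim (\<lambda>n. norm (fstL (X n))) at_top sequentially"
    and z: "CE.eig (1 + \<mu>) z" and lim: "(\<lambda>n. (1 / norm (fstL (X n))) *\<^sub>R fstL (X n)) \<longlonglongrightarrow> fstL z"
    and G: "G \<in> borel_measurable borel" and fb: "fbar \<in> W12_0 \<Omega>"
  shows "\<exists>u. SC_sequence \<Omega> (eigenspace \<Omega> \<mu>) u \<and> (\<forall>n. pot G (fstL (X n)) - emb fbar \<bullet> fstL (X n) =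
    (LINT x|lebesgue_on \<Omega>. G (u n x)) - (LINT x|lebesgue_on \<Omega>. fbar x * u n x))"
proof -
  have "\<forall>n. \<exists>u. u \<in> W12_0 \<Omega> \<and> X n = J u" using X unfolding S_def by blast
  from choice[OF this] obtain u where u: "\<forall>n. u n \<in> W12_0 \<Omega> \<and> X n = J (u n)" ..
  have uW: "u n \<in> W12_0 \<Omega>" for n using u by blast
  have PX: "fstL (X n) = emb (u n)" for n using u W12_0D(5)[OF uW] by simp
  have "z \<in> S" using z by (simp only: CE.eig_def)
  then obtain \<phi> where \<phi>: "\<phi> \<in> W12_0 \<Omega>" "z = J \<phi>" unfolding S_def by blast
  have \<phi>e: "\<phi> \<in> eigenspace \<Omega> \<mu>" using eig_iff[OF \<phi>(1)] z \<phi>(2) by blast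
  have nu: "norm (fstL (X n)) = L2_norm \<Omega> (u n)" for n unfolding PX by (rule emb_norm[OF W12_0D(2)[OF uW]])
  have "L2_norm \<Omega> (\<lambda>x. u n x / L2_norm \<Omega> (u n) - \<phi> x) = norm ((1 / norm (fstL (X n))) *\<^sub>R fstL (X n) - fstL z)" for n
  proof -
    define c where "c = 1 / L2_norm \<Omega> (u n)"
    have cu: "(\<lambda>x. c *\<^sub>R u n x) \<in> L2 \<Omega>" by (rule L2_scaleR[OF W12_0D(2)[OF uW]])
    have "(\<lambda>x. u n x / L2_norm \<Omega> (u n) - \<phi> x) = (\<lambda>x. c *\<^sub>R u n x - \<phi> x)" by (simp add: c_def)
    moreover have "L2_norm \<Omega> (\<lambda>x. c *\<^sub>R u n x - \<phi> x) = norm (c *\<^sub>R emb (u n) - emb \<phi>)"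
      unfolding emb_norm[OF L2_diff[OF cu W12_0D(2)[OF \<phi>(1)]], symmetric] emb_diff[OF cu W12_0D(2)[OF \<phi>(1)]]
        emb_scaleR[OF W12_0D(2)[OF uW]] ..
    ultimately show ?thesis unfolding PX emb_norm[OF W12_0D(2)[OF uW]] \<phi>(2) W12_0D(5)[OF \<phi>(1)] by (simp add: c_def)
  qed
  moreover have "(\<lambda>n. norm ((1 / norm (fstL (X n))) *\<^sub>R fstL (X n) - fstL z)) \<longlonglongrightarrow> 0"
    using tendsto_norm_zero[OF LIM_zero[OF lim]] .
  ultimately have "(\<lambda>n. L2_norm \<Omega> (\<lambda>x. u n x / L2_norm \<Omega> (u n) - \<phi> x)) \<longlonglongrightarrow> 0" by simp
  then have "SC_sequence \<Omega> (eigenspace \<Omega> \<mu>) u" unfolding SC_sequence_def using uW inf \<phi>e unfolding nu by blast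
  moreover have "pot G (fstL (X n)) - emb fbar \<bullet> fstL (X n) = (LINT x|lebesgue_on \<Omega>. G (u n x)) - (LINT x|lebesgue_on \<Omega>. fbar x * u n x)" for n
    unfolding PX pot_emb[OF G W12_0D(2)[OF uW]] J_inner(2)[OF fb uW] ..
  ultimately show ?thesis by blast
qed

text \<open>The values listed up to index \<open>k\<close> suffice: any other number up to 1 +
  \<lambda>_k is absent from the shifted list, has multiplicity 0 and admits no nonzero
  eigenvector.\<close>

lemma dirichlet_eigenbasis:
  assumes lam: "dirichlet_eigenvalues \<Omega> lam" and k: "1 \<le> k"
  shows "\<exists>B \<nu>. finite B \<and> pairwise orthogonal B \<and> (\<forall>e\<in>B. norm e = 1 \<and> CE.eig (\<nu> e) e \<and> \<nu> e \<le> 1 + lam k) \<and>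
    (\<forall>\<mu> x. \<mu> \<le> 1 + lam k \<longrightarrow> CE.eig \<mu> x \<longrightarrow> (\<forall>e\<in>B. x \<bullet> e = 0) \<longrightarrow> x = 0)"
proof -
  have mono: "lam i \<le> lam j" if "1 \<le> i" "i \<le> j" for i j using lam that unfolding dirichlet_eigenvalues_def by blast
  have mult: "has_multiplicity \<Omega> \<mu> (card {i. 1 \<le> i \<and> lam i = \<mu>})" for \<mu>
    using lam unfolding dirichlet_eigenvalues_def by blast
  define \<Lambda> where "\<Lambda> = (\<lambda>i. 1 + lam i) ` {1..k}"
  have "finite \<Lambda>" by (simp add: \<Lambda>_def)
  moreover have "\<exists>A. finite A \<and> A \<subseteq> {x. CE.eig \<nu> x} \<and> {x. CE.eig \<nu> x} \<subseteq> span A" if "\<nu> \<in> \<Lambda>" for \<nu>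
    using has_multiplicity_span[OF mult, of "\<nu> - 1"] by auto
  ultimately have "\<exists>B \<nu>. finite B \<and> pairwise orthogonal B \<and> (\<forall>e\<in>B. norm e = 1 \<and> CE.eig (\<nu> e) e \<and> \<nu> e \<in> \<Lambda>) \<and>
    (\<forall>\<mu>\<in>\<Lambda>. \<forall>x. CE.eig \<mu> x \<longrightarrow> (\<forall>e\<in>B. x \<bullet> e = 0) \<longrightarrow> x = 0)"
    by (rule CE.orthonormal_eigenbasis)
  then obtain B \<nu> where B\<nu>: "finite B \<and> pairwise orthogonal B \<and> (\<forall>e\<in>B. norm e = 1 \<and> CE.eig (\<nu> e) e \<and> \<nu> e \<in> \<Lambda>) \<and>
    (\<forall>\<mu>\<in>\<Lambda>. \<forall>x. CE.eig \<mu> x \<longrightarrow> (\<forall>e\<in>B. x \<bullet> e = 0) \<longrightarrow> x = 0)"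
    by (elim exE)
  note B = B\<nu>[THEN conjunct1] B\<nu>[THEN conjunct2, THEN conjunct1] B\<nu>[THEN conjunct2, THEN conjunct2, THEN conjunct1]
    and compl = B\<nu>[THEN conjunct2, THEN conjunct2, THEN conjunct2]
  have le: "\<nu> \<le> 1 + lam k" if "\<nu> \<in> \<Lambda>" for \<nu> using that mono by (auto simp: \<Lambda>_def)
  have c: "x = 0" if \<mu>: "\<mu> \<le> 1 + lam k" and x: "CE.eig \<mu> x" and o: "\<forall>e\<in>B. x \<bullet> e = 0" for \<mu> x
  proof (cases "{i. 1 \<le> i \<and> lam i = \<mu> - 1} = {}")
    case True
    from has_multiplicity_span[OF mult[of "\<mu> - 1"]] obtain A where
      A: "finite A \<and> A \<subseteq> {X. CE.eig (1 + (\<mu> - 1)) X} \<and> {X. CE.eig (1 + (\<mu> - 1)) X} \<subseteq> span A \<and> (card {i. 1 \<le> i \<and> lam i = \<mu> - 1} = 0 \<longrightarrow> A = {})" ..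
    have "A = {}" using A[THEN conjunct2, THEN conjunct2, THEN conjunct2] unfolding True by simp
    then have "{X. CE.eig (1 + (\<mu> - 1)) X} \<subseteq> {0}" using A[THEN conjunct2, THEN conjunct2, THEN conjunct1] by simp
    then show ?thesis using x by auto
  next
    case False
    then obtain i where i: "1 \<le> i" "lam i = \<mu> - 1" by blast
    have "\<mu> \<in> \<Lambda>"
    proof (cases "i \<le> k")
      case True
      then show ?thesis using i unfolding \<Lambda>_def by (intro image_eqI[of _ _ i]) auto
    next
      case False
      \<comment> \<open>When \<lambda>_k is multiple it may reappear beyond the index
        \<open>k\<close>; monotonicity identifies such a value with \<lambda>_k itself.\<close>
      then have "lam k \<le> lam i" using mono k by simp
      then have "\<mu> = 1 + lam k" using i(2) \<mu> by simp
      then show ?thesis using k unfolding \<Lambda>_def by (intro image_eqI[of _ _ k]) auto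
    qed
    then show ?thesis using compl[rule_format, OF _ x o[rule_format]] by blast
  qed
  show ?thesis
  proof (intro exI[of _ B] exI[of _ \<nu>] conjI allI impI)
    show "\<forall>e\<in>B. norm e = 1 \<and> CE.eig (\<nu> e) e \<and> \<nu> e \<le> 1 + lam k" using B(3) le by blast
  qed (fact B(1) B(2) | rule c, assumption+)+
qed

end

theorem theorem1:
  fixes \<Omega> :: "(real ^ 'n) set"
    and g :: "real \<Rightarrow> real"
    and f fbar :: "real ^ 'n \<Rightarrow> real"
    and lam :: "nat \<Rightarrow> real"
    and k :: nat
  assumes domain: "open \<Omega>" "connected \<Omega>" "\<Omega> \<noteq> {}" "bounded \<Omega>"
    and g: "continuous_on UNIV g" "bounded (range g)"
    and f: "f \<in> L2 \<Omega>"
    and lam: "dirichlet_eigenvalues \<Omega> lam"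
    and k: "1 \<le> k"
    and fbar: "fbar \<in> eigenspace \<Omega> (lam k)"
      "\<forall>v\<in>eigenspace \<Omega> (lam k). (LINT x|lebesgue_on \<Omega>. (f x - fbar x) * v x) = 0"
    and SC: "SC_plus \<Omega> (eigenspace \<Omega> (lam k)) g fbar \<or> SC_minus \<Omega> (eigenspace \<Omega> (lam k)) g fbar"
  shows "\<exists>u\<in>W12_0 \<Omega>. \<forall>v\<in>W12_0 \<Omega>.
    (LINT x|lebesgue_on \<Omega>. wgrad \<Omega> u x \<bullet> wgrad \<Omega> v x)
      - lam k * (LINT x|lebesgue_on \<Omega>. u x * v x)
      + (LINT x|lebesgue_on \<Omega>. g (u x) * v x)
    = (LINT x|lebesgue_on \<Omega>. f x * v x)"
proof -
  interpret bounded_open_set \<Omega> by (rule bounded_open_set.intro[OF domain(1,4)])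
  obtain C where gb: "\<And>s. \<bar>g s\<bar> \<le> C" using g(2) by (auto simp: bounded_iff)
  have C0: "C \<ge> 0" using gb[of 0] by linarith
  define G where "G = primitive g"
  \<comment> \<open>The second primitive of \<open>g\<close>: its Steklov mean is a potential of the
    regularised nonlinearity \<open>avg j G\<close>.\<close>
  define PG where "PG = primitive G"
  have dG: "(G has_real_derivative g s) (at s)" for s unfolding G_def by (rule primitive_has_derivative[OF g(1)])
  have cG: "continuous_on UNIV G" by (rule DERIV_continuous_on) (rule has_field_derivative_at_within[OF dG])
  have dPG: "(PG has_real_derivative G s) (at s)" for s unfolding PG_def by (rule primitive_has_derivative[OF cG])
  have cPG: "continuous_on UNIV PG" by (rule DERIV_continuous_on) (rule has_field_derivative_at_within[OF dPG])
  have [measurable]: "g \<in> borel_measurable borel" "G \<in> borel_measurable borel" "PG \<in> borel_measurable borel"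
    using g(1) cG cPG by (auto intro: borel_measurable_continuous_onI)
  have mh: "avg j G \<in> borel_measurable borel" and mH: "avg j PG \<in> borel_measurable borel" for j
    unfolding avg_def by measurable
  have Gb: "\<bar>G s\<bar> \<le> C * \<bar>s\<bar>" for s
    using derivative_bound_lipschitz[OF dG gb, of s 0] by (simp add: G_def primitive_0)
  have Gb': "\<bar>G s\<bar> \<le> C + C * \<bar>s\<bar>" for s using Gb[of s] C0 by linarith
  have hb: "\<bar>avg j G s\<bar> \<le> C" for j s by (rule avg_bound[OF dG gb])
  define L where "L = (\<lambda>j. 2 * C * real (Suc j))"
  have L0: "L j \<ge> 0" for j using C0 by (simp add: L_def)
  have hL: "\<bar>avg j G t - avg j G s\<bar> \<le> L j * \<bar>t - s\<bar>" for j s t unfolding L_def by (rule avg_lipschitz[OF dG gb])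
  have Ht: "avg j PG (s + t) \<le> avg j PG s + avg j G s * t + L j * t\<^sup>2" for j s t
    by (rule taylor_lipschitz_derivative[OF avg_has_derivative[OF dPG] hL L0])
  \<comment> \<open>The mean is a value of \<open>G\<close> at distance at most 1 from
    \<open>s\<close>, and \<open>G\<close> has Lipschitz constant \<open>C\<close>; so the bound is
    free of \<open>j\<close>.\<close>
  have Hc: "\<bar>avg j PG s - G s\<bar> \<le> C" for j s
  proof -
    obtain \<xi> where \<xi>: "s \<le> \<xi>" "\<xi> \<le> s + 1 / real (Suc j)" "avg j PG s = G \<xi>" using avg_mean_value[OF dPG] by blast
    have "1 / real (Suc j) \<le> 1" by simp
    then have "\<bar>\<xi> - s\<bar> \<le> 1" using \<xi>(1,2) by linarith
    then have "C * \<bar>\<xi> - s\<bar> \<le> C * 1" using C0 by (rule mult_left_mono)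
    then show ?thesis using derivative_bound_lipschitz[OF dG gb, of \<xi> s] \<xi>(3) by simp
  qed
  have Hg: "\<bar>avg j PG s\<bar> \<le> 2 * C + 2 * C * \<bar>s\<bar>" for j s
    using Hc[of j s] Gb[of s] mult_nonneg_nonneg[OF C0 abs_ge_zero[of s]] by linarith
  have mult: "has_multiplicity \<Omega> \<mu> (card {i. 1 \<le> i \<and> lam i = \<mu>})" and finm: "finite {i. 1 \<le> i \<and> lam i = \<mu>}" for \<mu>
    using lam unfolding dirichlet_eigenvalues_def by blast+
  have kc: "card {i. 1 \<le> i \<and> lam i = lam k} > 0" using finm k by (subst card_gt_0_iff) auto
  have kpos: "1 + lam k > 0" using eigenvalue_nonneg[OF mult kc] by simp
  obtain B \<nu> where B\<nu>: "finite B \<and> pairwise orthogonal B \<and> (\<forall>e\<in>B. norm e = 1 \<and> CE.eig (\<nu> e) e \<and> \<nu> e \<le> 1 + lam k) \<and>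
    (\<forall>\<mu> x. \<mu> \<le> 1 + lam k \<longrightarrow> CE.eig \<mu> x \<longrightarrow> (\<forall>e\<in>B. x \<bullet> e = 0) \<longrightarrow> x = 0)"
    using dirichlet_eigenbasis[OF lam k] by (elim exE)
  note B = B\<nu>[THEN conjunct1] B\<nu>[THEN conjunct2, THEN conjunct1] B\<nu>[THEN conjunct2, THEN conjunct2, THEN conjunct1]
    and compl = B\<nu>[THEN conjunct2, THEN conjunct2, THEN conjunct2]
  have fbW: "fbar \<in> W12_0 \<Omega>" using fbar(1) by (simp add: eigenspace_def)
  \<comment> \<open>The sign encodes which condition holds, so that both become divergence to plus
    infinity.\<close>
  have "\<exists>s :: real. (s = 1 \<or> s = -1) \<and> (\<forall>u. SC_sequence \<Omega> (eigenspace \<Omega> (lam k)) u \<longrightarrow>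
      filterlim (\<lambda>n. s * ((LINT x|lebesgue_on \<Omega>. G (u n x)) - (LINT x|lebesgue_on \<Omega>. fbar x * u n x))) at_top sequentially)"
    using SC
  proof
    assume "SC_plus \<Omega> (eigenspace \<Omega> (lam k)) g fbar"
    then show ?thesis unfolding SC_plus_def G_def by (intro exI[of _ 1]) simp
  next
    assume "SC_minus \<Omega> (eigenspace \<Omega> (lam k)) g fbar"
    then show ?thesis unfolding SC_minus_def G_def filterlim_uminus_at_bot by (intro exI[of _ "-1"]) simp
  qed
  then obtain s :: real where s: "s = 1 \<or> s = -1" and SCs: "\<forall>u. SC_sequence \<Omega> (eigenspace \<Omega> (lam k)) u \<longrightarrow>
      filterlim (\<lambda>n. s * ((LINT x|lebesgue_on \<Omega>. G (u n x)) - (LINT x|lebesgue_on \<Omega>. fbar x * u n x))) at_top sequentially"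
    by blast
  \<comment> \<open>One constant for the norm of the nonlinearity, the growth of the potential and
    the distance between the potentials.\<close>
  define D where "D = C * sqrt vol + C * vol"
  have D: "C * sqrt vol \<le> D" "C * vol \<le> D" using C0 vol_nonneg by (simp_all add: D_def)
  \<comment> \<open>The weak formulation with the L2 product of u and v added once, inside the inner
    product of \<open>S\<close>, and subtracted once; hence the factor 1 + \<lambda>_k.\<close>
  have "\<exists>X\<in>S. \<forall>Y\<in>S. X \<bullet> Y - (1 + lam k) * (fstL X \<bullet> fstL Y) + nem g (fstL X) \<bullet> fstL Y = emb f \<bullet> fstL Y"
  proof (rule CE.resonance_solvable[where B = B and \<nu> = \<nu> and Nj = "\<lambda>j. nem (avg j G)" and \<Gamma> = "pot G"
        and \<Gamma>j = "\<lambda>j. pot (avg j PG)" and C = D and L = L and Fbar = "emb fbar" and s = s])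
    show "finite B" "pairwise orthogonal B" by fact+
    show "norm e = 1" "CE.eig (\<nu> e) e" "\<nu> e \<le> 1 + lam k" if "e \<in> B" for e using B(3) that by blast+
    show "0 < 1 + lam k" by (rule kpos)
    show "x = 0" if "\<mu> \<le> 1 + lam k" "CE.eig \<mu> x" "\<forall>e\<in>B. x \<bullet> e = 0" for \<mu> x using compl that by blast
    show "norm (nem (avg j G) v) \<le> D" for j v
      unfolding nem_def by (rule order_trans[OF nem_L2(2)[OF mh hb fn_L2(2)] D(1)])
    show "norm (nem (avg j G) v - nem (avg j G) w) \<le> L j * norm (v - w)" for j v w
      by (rule nem_lipschitz[OF mh hb hL L0])
    show "0 \<le> L j" for j by (rule L0)
    show "pot (avg j PG) (v + w) \<le> pot (avg j PG) v + nem (avg j G) v \<bullet> w + L j * (norm w)\<^sup>2" for j v w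
      by (rule pot_taylor[OF mh hb mH Hg Ht L0])
    show "\<bar>pot (avg j PG) v - pot G v\<bar> \<le> D" for j v
      by (rule order_trans[OF pot_close[OF mH Hg _ Gb' Hc] D(2)]) measurable
    show "\<bar>pot G v\<bar> \<le> D * norm v" for v
    proof -
      have "\<bar>pot G v\<bar> \<le> C * sqrt vol * norm v" by (rule pot_growth[OF _ Gb C0]) measurable
      also have "\<dots> \<le> D * norm v" by (rule mult_right_mono[OF D(1) norm_ge_zero])
      finally show ?thesis .
    qed
    show "\<exists>q. strict_mono q \<and> (\<lambda>j. nem (avg (r (q j)) G) (X (q j))) \<longlonglongrightarrow> nem g v"
      if "strict_mono r" "X \<longlonglongrightarrow> v" for X v and r :: "nat \<Rightarrow> nat"
      by (rule nem_convergence[where h = "\<lambda>j. avg j G", OF mh hb _ gb avg_limit[OF dG g(1)] that]) measurable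
    show "(emb f - emb fbar) \<bullet> fstL z = 0" if z: "CE.eig (1 + lam k) z" for z
    proof -
      have "z \<in> S" using z by (simp only: CE.eig_def)
      then obtain v where v: "v \<in> W12_0 \<Omega>" "z = J v" unfolding S_def by blast
      have "v \<in> eigenspace \<Omega> (lam k)" using eig_iff[OF v(1)] z v(2) by blast
      then have "(LINT x|lebesgue_on \<Omega>. (f x - fbar x) * v x) = 0" using fbar(2) by blast
      then show ?thesis unfolding v(2) W12_0D(5)[OF v(1)] emb_diff[OF f W12_0D(2)[OF fbW], symmetric]
          emb_inner[OF L2_diff[OF f W12_0D(2)[OF fbW]] W12_0D(2)[OF v(1)]] by simp
    qed
    show "s = 1 \<or> s = -1" by (rule s)
    show "filterlim (\<lambda>n. s * (pot G (fstL (X n)) - emb fbar \<bullet> fstL (X n))) at_top sequentially"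
      if X: "\<And>n. X n \<in> S" and inf: "filterlim (\<lambda>n. norm (fstL (X n))) at_top sequentially"
        and z: "CE.eig (1 + lam k) z" and lim: "(\<lambda>n. (1 / norm (fstL (X n))) *\<^sub>R fstL (X n)) \<longlonglongrightarrow> fstL z" for X z
    proof -
      have mG: "G \<in> borel_measurable borel" by measurable
      obtain u where u: "SC_sequence \<Omega> (eigenspace \<Omega> (lam k)) u"
        and e: "\<forall>n. pot G (fstL (X n)) - emb fbar \<bullet> fstL (X n) = (LINT x|lebesgue_on \<Omega>. G (u n x)) - (LINT x|lebesgue_on \<Omega>. fbar x * u n x)"
        using SC_sequence_J[OF X inf z lim mG fbW] by blast
      show ?thesis unfolding e[rule_format] using SCs u by blast
    qed
  qed
  then obtain X where X: "X \<in> S" and eq: "\<forall>Y\<in>S. X \<bullet> Y - (1 + lam k) * (fstL X \<bullet> fstL Y) + nem g (fstL X) \<bullet> fstL Y = emb f \<bullet> fstL Y"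
    by blast
  obtain u where u: "u \<in> W12_0 \<Omega>" "X = J u" using X unfolding S_def by blast
  have gm: "g \<in> borel_measurable borel" by measurable
  have um: "u \<in> borel_measurable (lebesgue_on \<Omega>)" by (rule L2_measurable[OF W12_0D(2)[OF u(1)]])
  have "(LINT x|lebesgue_on \<Omega>. wgrad \<Omega> u x \<bullet> wgrad \<Omega> v x) - lam k * (LINT x|lebesgue_on \<Omega>. u x * v x)
      + (LINT x|lebesgue_on \<Omega>. g (u x) * v x) = (LINT x|lebesgue_on \<Omega>. f x * v x)" if v: "v \<in> W12_0 \<Omega>" for v
    using eq[rule_format, OF W12_0D(4)[OF v]]
    unfolding u(2) W12_0D(5)[OF v] W12_0D(5)[OF u(1)] nem_emb[OF gm gb W12_0D(2)[OF u(1)]] J_inner[OF u(1) v]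
      emb_inner[OF nem_L2(1)[OF gm gb um] W12_0D(2)[OF v]] emb_inner[OF f W12_0D(2)[OF v]]
    by (simp add: distrib_right)
  then show ?thesis using u(1) by blast
qed

end
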